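(* Let $\alpha\geq\omega$ be an ordinal and let $\gamma$ be the unique ordinal satisfying $\omega^{\omega^\gamma}\leq\alpha<\omega^{\omega^{\gamma+1}}$. Then the Szlenk index of the Banach space $C([0,\alpha])$ satisfies \[ Sz(C([0,\alpha]))=\omega^{\gamma+1}. \]
   Context: All arithmetic of ordinals (sums, products, powers) is ordinal arithmetic, and $\omega$ is the first infinite ordinal. For an ordinal $\alpha$, the interval $[0,\alpha]$ carries its order topology, under which it is a scattered compact Hausdorff space; $C([0,\alpha])$ is the Banach space of continuous scalar-valued functions on $[0,\alpha]$ with the supremum norm (it is an Asplund space). For a Banach space $X$, $B_X=\{x\in X:\|x\|\leq 1\}$. Szlenk index: Let $X$ be an Asplund space, $B\subseteq X^*$ and $\epsilon>0$. Define \[ s_\epsilon(B)=\{x\in B : \operatorname{diam}(B\cap V)>\epsilon \text{ for every } w^*\text{-open } V\ni x\}, \] where the diameter is with respect to the norm of $X^*$. Iterate transfinitely: $s_\epsilon^0(B)=B$, $s_\epsilon^{\beta+1}(B)=s_\epsilon(s_\epsilon^\beta(B))$ for every ordinal $\beta$, and $s_\epsilon^\beta(B)=\bigcap_{\sigma<\beta}s_\epsilon^\sigma(B)$ for $\beta$ a limit ordinal. Let $Sz(X,\epsilon)$ be the least ordinal $\beta$ with $s_\epsilon^\beta(B_{X^*})=\emptyset$ (it exists since $X$ is Asplund), and $Sz(X)=\sup_{\epsilon>0}Sz(X,\epsilon)$. *)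

theory Defs
  imports "HOL-Analysis.Analysis"
begin

section \<open>Ordinals\<close>

text \<open>
  HOL has no type of all ordinals, so a family of types is used.  Let \<open>\<kappa>\<close> be the cardinality of
  \<open>'i + nat\<close>, i.e. the maximum of \<open>|'i|\<close> and \<open>\<aleph>\<^sub>0\<close>.  The type \<open>'i ordinal\<close> carries a well-order whose
  order type is the initial ordinal \<open>\<kappa>\<^sup>+\<close>; identifying \<open>x\<close> with the order type of \<open>{..<x}\<close>, its
  elements are exactly the ordinals of cardinality at most \<open>\<kappa>\<close>.  Every ordinal therefore occurs
  in \<open>'i ordinal\<close> for a suitable \<open>'i\<close>, and a statement about all \<open>x :: 'i ordinal\<close> that is
  polymorphic in \<open>'i\<close> is a statement about all ordinals.  By regularity of \<open>\<kappa>\<^sup>+\<close> the type contains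
  the suprema of all subsets of cardinality at most \<open>\<kappa>\<close> (\<open>bdd_above_ordinal\<close>), and hence is
  closed under ordinal arithmetic.
\<close>

lemma infinite_cardSuc_Field: "infinite (Field (cardSuc (card_of (UNIV :: ('i + nat) set))))"
  by (simp add: card_of_cardSuc_finite)

typedef 'i ordinal = "Field (cardSuc (card_of (UNIV :: ('i + nat) set)))"
  using infinite_cardSuc_Field infinite_imp_nonempty by blast

instantiation ordinal :: (type) linorder
begin

definition less_eq_ordinal :: "'a ordinal \<Rightarrow> 'a ordinal \<Rightarrow> bool"
  where "x \<le> y \<longleftrightarrow> (Rep_ordinal x, Rep_ordinal y) \<in> cardSuc (card_of (UNIV :: ('a + nat) set))"

definition less_ordinal :: "'a ordinal \<Rightarrow> 'a ordinal \<Rightarrow> bool"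
  where "(x :: 'a ordinal) < y \<longleftrightarrow> x \<le> y \<and> \<not> y \<le> x"

instance
proof
  have wo: "Well_order (cardSuc (card_of (UNIV :: ('a + nat) set)))"
    using cardSuc_Card_order card_of_Card_order card_order_on_well_order_on by blast
  note d = wo[unfolded well_order_on_def linear_order_on_def partial_order_on_def preorder_on_def]
  fix x y z :: "'a ordinal"
  show "(x < y) = (x \<le> y \<and> \<not> y \<le> x)" by (simp add: less_ordinal_def)
  show "x \<le> x" using d Rep_ordinal[of x] by (auto simp: less_eq_ordinal_def refl_on_def)
  show "x \<le> y \<Longrightarrow> y \<le> z \<Longrightarrow> x \<le> z" using d by (auto simp: less_eq_ordinal_def trans_def)
  show "x \<le> y \<Longrightarrow> y \<le> x \<Longrightarrow> x = y"
    using d unfolding less_eq_ordinal_def by (metis Rep_ordinal_inject antisymD)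
  show "x \<le> y \<or> y \<le> x"
    using d Rep_ordinal[of x] Rep_ordinal[of y] unfolding less_eq_ordinal_def
    by (cases "x = y") (auto simp: total_on_def refl_on_def Rep_ordinal_inject)
qed

end

instance ordinal :: (type) wellorder
proof
  fix P :: "'a ordinal \<Rightarrow> bool" and a
  assume step: "\<And>x. (\<And>y. y < x \<Longrightarrow> P y) \<Longrightarrow> P x"
  let ?r = "cardSuc (card_of (UNIV :: ('a + nat) set))"
  have "Well_order ?r"
    using cardSuc_Card_order card_of_Card_order card_order_on_well_order_on by blast
  then have "wf (?r - Id)" by (simp add: well_order_on_def)
  then have "wf (inv_image (?r - Id) Rep_ordinal)" by (rule wf_inv_image)
  moreover have "inv_image (?r - Id) Rep_ordinal = {(x, y). x < y}"
    by (auto simp: inv_image_def less_le less_eq_ordinal_def Rep_ordinal_inject)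
  ultimately have "wf {(x, y :: 'a ordinal). x < y}" by simp
  then show "P a" by (induction a rule: wf_induct_rule) (auto intro: step)
qed

instantiation ordinal :: (type) conditionally_complete_linorder
begin

definition inf_ordinal :: "'a ordinal \<Rightarrow> 'a ordinal \<Rightarrow> 'a ordinal" where "(inf :: 'a ordinal \<Rightarrow> _) = min"
definition sup_ordinal :: "'a ordinal \<Rightarrow> 'a ordinal \<Rightarrow> 'a ordinal" where "(sup :: 'a ordinal \<Rightarrow> _) = max"
definition Inf_ordinal :: "'a ordinal set \<Rightarrow> 'a ordinal" where "Inf A = (LEAST x :: 'a ordinal. x \<in> A)"
definition Sup_ordinal :: "'a ordinal set \<Rightarrow> 'a ordinal" where "Sup A = (LEAST x :: 'a ordinal. \<forall>y\<in>A. y \<le> x)"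

instance
proof
  fix x z :: "'a ordinal" and A :: "'a ordinal set"
  show "x \<in> A \<Longrightarrow> bdd_below A \<Longrightarrow> Inf A \<le> x" by (simp add: Inf_ordinal_def Least_le)
  show "A \<noteq> {} \<Longrightarrow> (\<And>x. x \<in> A \<Longrightarrow> z \<le> x) \<Longrightarrow> z \<le> Inf A"
    unfolding Inf_ordinal_def by (metis LeastI_ex ex_in_conv)
  show "x \<in> A \<Longrightarrow> bdd_above A \<Longrightarrow> x \<le> Sup A"
    using LeastI_ex[of "\<lambda>x. \<forall>y\<in>A. y \<le> x"] by (auto simp: Sup_ordinal_def bdd_above_def)
  show "A \<noteq> {} \<Longrightarrow> (\<And>x. x \<in> A \<Longrightarrow> x \<le> z) \<Longrightarrow> Sup A \<le> z"
    unfolding Sup_ordinal_def by (simp add: Least_le)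
qed (auto simp: inf_ordinal_def sup_ordinal_def)

end

instantiation ordinal :: (type) linorder_topology
begin

definition open_ordinal :: "'a ordinal set \<Rightarrow> bool"
  where "open_ordinal = generate_topology (range (\<lambda>a. {..<a}) \<union> range (\<lambda>a. {a<..}))"

instance by standard (rule open_ordinal_def)

end

lemma bdd_above_ordinal:
  includes cardinal_syntax
  fixes A :: "'i ordinal set"
  assumes "card_of A \<le>o card_of (UNIV :: ('i + nat) set)"
  shows "bdd_above A"
proof -
  let ?k = "card_of (UNIV :: ('i + nat) set)"
  have co: "Card_order ?k" by (rule card_of_Card_order)
  have inf: "infinite (Field ?k)" by (simp add: Field_card_of)
  have wo: "Well_order (cardSuc ?k)"
    using cardSuc_Card_order card_of_Card_order card_order_on_well_order_on by blast
  note d = wo[unfolded well_order_on_def linear_order_on_def partial_order_on_def preorder_on_def]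
  have chain: "relChain (cardSuc ?k) (\<lambda>i. {j. (j, i) \<in> cardSuc ?k})"
    using d unfolding relChain_def trans_def by blast
  have "Rep_ordinal ` A \<subseteq> (\<Union>i\<in>Field (cardSuc ?k). {j. (j, i) \<in> cardSuc ?k})"
    using d Rep_ordinal by (fastforce simp: refl_on_def)
  moreover have "card_of (Rep_ordinal ` A) \<le>o ?k"
    using card_of_image assms ordLeq_transitive by blast
  ultimately obtain i where "i \<in> Field (cardSuc ?k)" "Rep_ordinal ` A \<subseteq> {j. (j, i) \<in> cardSuc ?k}"
    using cardSuc_UNION[OF co inf chain] by blast
  then have "\<forall>x\<in>A. x \<le> Abs_ordinal i"
    by (auto simp: less_eq_ordinal_def Abs_ordinal_inverse)
  then show ?thesis by (auto simp: bdd_above_def)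
qed

lemma card_of_lessThan_ordinal:
  includes cardinal_syntax
  fixes x :: "'i ordinal"
  shows "card_of {..<x} \<le>o card_of (UNIV :: ('i + nat) set)"
proof -
  let ?k = "card_of (UNIV :: ('i + nat) set)"
  have co: "Card_order ?k" by (rule card_of_Card_order)
  have "Rep_ordinal ` {..<x} \<subseteq> underS (cardSuc ?k) (Rep_ordinal x)"
    by (auto simp: underS_def less_le less_eq_ordinal_def Rep_ordinal_inject)
  moreover have "card_of {..<x} =o card_of (Rep_ordinal ` {..<x})"
    by (meson bij_betw_imageI card_of_ordIso inj_onI Rep_ordinal_inject)
  moreover have "card_of (underS (cardSuc ?k) (Rep_ordinal x)) <o cardSuc ?k"
    by (intro card_of_underS cardSuc_Card_order co Rep_ordinal)
  ultimately have "card_of {..<x} <o cardSuc ?k"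
    by (meson card_of_mono1 ordIso_ordLeq_trans ordLeq_ordLess_trans)
  then show ?thesis by (simp add: cardSuc_ordLeq_ordLess card_of_Card_order)
qed

lemma bdd_above_image_ordinal: "bdd_above (f ` {..<x})" for f :: "'i ordinal \<Rightarrow> 'i ordinal"
  by (rule bdd_above_ordinal[OF ordLeq_transitive[OF card_of_image card_of_lessThan_ordinal]])

lemma ex_greater_ordinal: "\<exists>y. x < y" for x :: "'i ordinal"
proof -
  let ?k = "card_of (UNIV :: ('i + nat) set)"
  have "Rep_ordinal x \<in> Field (cardSuc ?k)" by (rule Rep_ordinal)
  then obtain b where b: "b \<in> Field (cardSuc ?k)" "Rep_ordinal x \<noteq> b" "(Rep_ordinal x, b) \<in> cardSuc ?k"
    using infinite_Card_order_limit[OF cardSuc_Card_order[OF card_of_Card_order] infinite_cardSuc_Field]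
    by blast
  from b(1) obtain y where "b = Rep_ordinal y" by (rule Rep_ordinal_cases)
  then have "x < y"
    using b by (auto simp: less_le less_eq_ordinal_def)
  then show ?thesis ..
qed

instantiation ordinal :: (type) zero
begin
definition zero_ordinal :: "'a ordinal" where "0 = (LEAST x :: 'a ordinal. True)"
instance ..
end

lemma ordinal_zero_le [simp]: "0 \<le> x" for x :: "'i ordinal"
  by (simp add: zero_ordinal_def Least_le)

lemma ordinal_not_less_zero [simp]: "\<not> x < 0" for x :: "'i ordinal"
  by (simp add: not_less)

definition osuc :: "'i ordinal \<Rightarrow> 'i ordinal"
  where "osuc x = (LEAST y. x < y)"

lemma less_osuc [simp]: "x < osuc x"
  unfolding osuc_def using ex_greater_ordinal by (rule LeastI_ex)

lemma osuc_le_iff: "osuc x \<le> y \<longleftrightarrow> x < y"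
  using order_less_le_trans[OF less_osuc] by (auto simp: osuc_def intro: Least_le)

lemma less_osuc_iff: "x < osuc y \<longleftrightarrow> x \<le> y"
  by (metis osuc_le_iff not_le)

lemma osuc_inject [simp]: "osuc x = osuc y \<longleftrightarrow> x = y"
  by (metis less_osuc less_osuc_iff order_antisym)

lemma osuc_neq_0 [simp]: "osuc x \<noteq> 0"
  by (metis less_osuc ordinal_not_less_zero)

text \<open>
  Transfinite recursion: \<open>z\<close> is the value at \<open>0\<close>, \<open>s\<close> gives the value at a successor from the
  previous value, and \<open>l\<close> gives the value at a limit from the set of all earlier values.
\<close>

function transrec :: "'b \<Rightarrow> ('b \<Rightarrow> 'b) \<Rightarrow> ('b set \<Rightarrow> 'b) \<Rightarrow> 'i ordinal \<Rightarrow> 'b" where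
  "transrec z s l x =
    (if x = 0 then z
     else if \<exists>y. x = osuc y then s (transrec z s l (THE y. x = osuc y))
     else l (transrec z s l ` {..<x}))"
  by pat_completeness auto
termination
  by (relation "inv_image {(x, y). x < y} (\<lambda>(z, s, l, x). x)")
    (auto intro!: wf_inv_image wf)

declare transrec.simps [simp del]

lemma transrec_0: "transrec z s l 0 = z"
  by (simp add: transrec.simps)

lemma transrec_osuc: "transrec z s l (osuc x) = s (transrec z s l x)"
  by (subst transrec.simps) simp

definition limit_ordinal :: "'i ordinal \<Rightarrow> bool"
  where "limit_ordinal x \<longleftrightarrow> x \<noteq> 0 \<and> (\<forall>y. x \<noteq> osuc y)"

lemma transrec_limit: "limit_ordinal x \<Longrightarrow> transrec z s l x = l (transrec z s l ` {..<x})"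
  by (subst transrec.simps) (auto simp: limit_ordinal_def)

instantiation ordinal :: (type) "{one, plus, times}"
begin

definition one_ordinal :: "'a ordinal" where "1 = osuc (0 :: 'a ordinal)"

definition plus_ordinal :: "'a ordinal \<Rightarrow> 'a ordinal \<Rightarrow> 'a ordinal"
  where "(x :: 'a ordinal) + y = transrec x osuc Sup y"

definition times_ordinal :: "'a ordinal \<Rightarrow> 'a ordinal \<Rightarrow> 'a ordinal"
  where "(x :: 'a ordinal) * y = transrec 0 (\<lambda>u. u + x) Sup y"

instance ..

end

text \<open>The limit clause is the usual one for bases \<open>x > 0\<close> only; just the base \<open>\<omega>\<close> is used below.\<close>

definition opow :: "'i ordinal \<Rightarrow> 'i ordinal \<Rightarrow> 'i ordinal"  (infixr "^\<^sub>o" 80)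
  where "x ^\<^sub>o y = transrec 1 (\<lambda>u. u * x) Sup y"

definition omega :: "'i ordinal"  ("\<omega>")
  where "\<omega> = (LEAST x. infinite {..<x})"

lemma lessThan_ordinal_0 [simp]: "{..<0 :: 'i ordinal} = {}"
  by auto

lemma limit_ordinal_pos: "limit_ordinal x \<Longrightarrow> 0 < x"
  by (simp add: limit_ordinal_def order_less_le)

lemma limit_ordinal_osuc_less: "limit_ordinal x \<Longrightarrow> y < x \<Longrightarrow> osuc y < x"
  by (metis limit_ordinal_def osuc_le_iff order_less_le)

lemma ordinal_cases [case_names zero succ limit]:
  fixes x :: "'i ordinal"
  obtains "x = 0" | y where "x = osuc y" | "limit_ordinal x"
  by (auto simp: limit_ordinal_def)

lemma ordinal_induct [case_names zero succ limit]:
  fixes x :: "'i ordinal"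
  assumes "P 0" "\<And>y. P y \<Longrightarrow> P (osuc y)"
    and "\<And>y. limit_ordinal y \<Longrightarrow> (\<And>z. z < y \<Longrightarrow> P z) \<Longrightarrow> P y"
  shows "P x"
proof (induction x rule: less_induct)
  case (less x)
  show ?case
    by (cases x rule: ordinal_cases) (use assms less in auto)
qed

lemma less_Sup_ordinal_iff:
  fixes f :: "'i ordinal \<Rightarrow> 'i ordinal"
  assumes "limit_ordinal x"
  shows "u < Sup (f ` {..<x}) \<longleftrightarrow> (\<exists>y<x. u < f y)"
proof -
  have "0 < x" using assms by (rule limit_ordinal_pos)
  then have "f ` {..<x} \<noteq> {}" by auto
  then show ?thesis by (subst less_cSup_iff) (auto intro: bdd_above_image_ordinal)
qed

lemma Sup_ordinal_upper:
  fixes f :: "'i ordinal \<Rightarrow> 'i ordinal"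
  shows "y < x \<Longrightarrow> f y \<le> Sup (f ` {..<x})"
  by (intro cSup_upper bdd_above_image_ordinal) auto

lemma normal_strict_mono:
  fixes f :: "'i ordinal \<Rightarrow> 'i ordinal"
  assumes s: "\<And>x. f x < f (osuc x)" and l: "\<And>x. limit_ordinal x \<Longrightarrow> f x = Sup (f ` {..<x})"
  shows "strict_mono f"
proof (rule strict_monoI)
  show "f y < f x" if "y < x" for x y
    using that
  proof (induction x rule: ordinal_induct)
    case (succ z)
    then have "y < z \<or> y = z" by (auto simp: less_osuc_iff)
    then show ?case using succ.IH s[of z] by auto
  next
    case (limit z)
    then have "f (osuc y) \<le> f z"
      unfolding l[OF limit.hyps] by (intro Sup_ordinal_upper limit_ordinal_osuc_less)
    with s[of y] show ?case by simp
  qed simp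
qed

lemma plus_ordinal_0 [simp]: "x + 0 = x" for x :: "'i ordinal"
  by (simp add: plus_ordinal_def transrec_0)

lemma plus_ordinal_osuc: "x + osuc y = osuc (x + y)" for x :: "'i ordinal"
  by (simp add: plus_ordinal_def transrec_osuc)

lemma plus_ordinal_limit: "limit_ordinal y \<Longrightarrow> x + y = (SUP z\<in>{..<y}. x + z)" for x :: "'i ordinal"
  by (simp add: plus_ordinal_def transrec_limit)

lemma plus_ordinal_1: "x + 1 = osuc x" for x :: "'i ordinal"
  by (simp add: one_ordinal_def plus_ordinal_osuc)

lemma times_ordinal_0 [simp]: "x * 0 = 0" for x :: "'i ordinal"
  by (simp add: times_ordinal_def transrec_0)

lemma times_ordinal_osuc: "x * osuc y = x * y + x" for x :: "'i ordinal"
  by (simp add: times_ordinal_def transrec_osuc)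

lemma times_ordinal_limit: "limit_ordinal y \<Longrightarrow> x * y = (SUP z\<in>{..<y}. x * z)" for x :: "'i ordinal"
  by (simp add: times_ordinal_def transrec_limit)

lemma opow_0 [simp]: "x ^\<^sub>o 0 = 1"
  by (simp add: opow_def transrec_0)

lemma opow_osuc: "x ^\<^sub>o osuc y = x ^\<^sub>o y * x"
  by (simp add: opow_def transrec_osuc)

lemma opow_limit: "limit_ordinal y \<Longrightarrow> x ^\<^sub>o y = (SUP z\<in>{..<y}. x ^\<^sub>o z)"
  by (simp add: opow_def transrec_limit)

lemma Sup_lessThan_limit:
  fixes x :: "'i ordinal"
  assumes "limit_ordinal x"
  shows "Sup {..<x} = x"
proof (rule order_antisym)
  show "Sup {..<x} \<le> x"
    using limit_ordinal_pos[OF assms] by (intro cSup_least) auto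
  show "x \<le> Sup {..<x}"
    using less_Sup_ordinal_iff[OF assms, of "Sup {..<x}" "\<lambda>y. y"] limit_ordinal_osuc_less[OF assms]
    by (metis image_ident less_osuc not_le order_less_irrefl)
qed

lemma plus_ordinal_left_0 [simp]: "0 + x = x" for x :: "'i ordinal"
  by (induction x rule: ordinal_induct)
    (auto simp: plus_ordinal_osuc plus_ordinal_limit Sup_lessThan_limit)

lemma times_ordinal_left_1 [simp]: "1 * x = x" for x :: "'i ordinal"
  by (induction x rule: ordinal_induct)
    (auto simp: times_ordinal_osuc times_ordinal_limit Sup_lessThan_limit plus_ordinal_1)

lemma strict_mono_plus_ordinal: "strict_mono (\<lambda>y. x + y)" for x :: "'i ordinal"
  by (rule normal_strict_mono) (auto simp: plus_ordinal_osuc plus_ordinal_limit)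

lemma infinite_lessThan_omega: "infinite {..<\<omega> :: 'i ordinal}"
proof -
  let ?s = "\<lambda>n. (osuc ^^ n) (0 :: 'i ordinal)"
  have sm: "strict_mono ?s" by (simp add: strict_mono_Suc_iff)
  have "bdd_above (range ?s)"
  proof (rule bdd_above_ordinal)
    have "(card_of (UNIV :: nat set), card_of (UNIV :: ('i + nat) set)) \<in> ordLeq"
      by (rule card_of_ordLeqI[of Inr]) auto
    then show "(card_of (range ?s), card_of (UNIV :: ('i + nat) set)) \<in> ordLeq"
      using card_of_image ordLeq_transitive by blast
  qed
  then obtain x where "range ?s \<subseteq> {..x}" by (auto simp: bdd_above_def)
  then have "range ?s \<subseteq> {..<osuc x}" by (auto simp: less_osuc_iff)
  moreover have "infinite (range ?s)"
    using sm by (simp add: range_inj_infinite strict_mono_imp_inj_on)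
  ultimately have "\<exists>x :: 'i ordinal. infinite {..<x}"
    using finite_subset by blast
  then show ?thesis unfolding omega_def by (rule LeastI_ex)
qed

lemma finite_lessThan_iff_less_omega: "finite {..<x} \<longleftrightarrow> x < \<omega>" for x :: "'i ordinal"
proof
  show "x < \<omega> \<Longrightarrow> finite {..<x}" unfolding omega_def using not_less_Least by blast
  show "finite {..<x} \<Longrightarrow> x < \<omega>"
    using infinite_lessThan_omega finite_subset[of "{..<\<omega>}" "{..<x}"] by (auto simp: not_less[symmetric])
qed

lemma limit_ordinal_omega: "limit_ordinal \<omega>"
  unfolding limit_ordinal_def
proof (intro conjI allI notI)
  show "False" if "(\<omega> :: 'i ordinal) = 0"
    using infinite_lessThan_omega by (metis finite.emptyI lessThan_ordinal_0 that)
  show "False" if y: "\<omega> = osuc y" for y :: "'i ordinal"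
  proof -
    have "{..<osuc y} = insert y {..<y}" by (auto simp: less_osuc_iff)
    moreover have "finite {..<y}" by (simp add: finite_lessThan_iff_less_omega y)
    ultimately show False using infinite_lessThan_omega y by (metis finite_insert)
  qed
qed

lemma less_times_omega:
  fixes x :: "'i ordinal"
  assumes "0 < x"
  shows "x < x * \<omega>"
proof -
  have "0 < (\<omega> :: 'i ordinal)"
    by (intro limit_ordinal_pos limit_ordinal_omega)
  then have "osuc (osuc 0) < (\<omega> :: 'i ordinal)"
    by (intro limit_ordinal_osuc_less limit_ordinal_omega)
  then have "x * osuc (osuc 0) \<le> x * \<omega>"
    unfolding times_ordinal_limit[OF limit_ordinal_omega] by (rule Sup_ordinal_upper)
  moreover have "x + 0 < x + x"
    using strict_mono_plus_ordinal assms by (rule strict_monoD)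
  ultimately show ?thesis by (simp add: times_ordinal_osuc)
qed

lemma omega_opow_pos: "0 < \<omega> ^\<^sub>o x"
proof (induction x rule: ordinal_induct)
  case zero
  show ?case by (simp add: one_ordinal_def order_less_le)
next
  case (succ y)
  then show ?case using less_times_omega[OF succ] by (simp add: opow_osuc)
next
  case (limit y)
  then have "0 < y" by (intro limit_ordinal_pos)
  with limit show ?case by (auto simp: opow_limit less_Sup_ordinal_iff)
qed

lemma strict_mono_omega_opow: "strict_mono (\<lambda>x. \<omega> ^\<^sub>o x)"
  by (rule normal_strict_mono) (auto simp: opow_osuc opow_limit omega_opow_pos less_times_omega)

lemma limit_ordinal_omega_opow:
  assumes "limit_ordinal x"
  shows "limit_ordinal (\<omega> ^\<^sub>o x)"
  unfolding limit_ordinal_def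
proof (intro conjI allI notI)
  show "False" if "\<omega> ^\<^sub>o x = 0" using omega_opow_pos[of x] that by simp
  show "False" if z: "\<omega> ^\<^sub>o x = osuc z" for z
  proof -
    have "z < \<omega> ^\<^sub>o x" using z by simp
    then obtain y where y: "y < x" "z < \<omega> ^\<^sub>o y"
      using assms by (auto simp: opow_limit less_Sup_ordinal_iff)
    then have "\<omega> ^\<^sub>o x \<le> \<omega> ^\<^sub>o y" by (simp add: z osuc_le_iff)
    with strict_monoD[OF strict_mono_omega_opow y(1)] show False by simp
  qed
qed

lemma ex1_omega_opow_interval:
  fixes \<alpha> :: "'i ordinal"
  assumes "\<omega> \<le> \<alpha>"
  shows "\<exists>!\<gamma>. \<omega> ^\<^sub>o (\<omega> ^\<^sub>o \<gamma>) \<le> \<alpha> \<and> \<alpha> < \<omega> ^\<^sub>o (\<omega> ^\<^sub>o (\<gamma> + 1))"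
proof -
  define f :: "'i ordinal \<Rightarrow> 'i ordinal" where "f x = \<omega> ^\<^sub>o \<omega> ^\<^sub>o x" for x
  have mono: "strict_mono f"
    unfolding f_def strict_mono_def using strict_mono_omega_opow by (auto simp: strict_mono_def)
  have ge: "x \<le> f x" for x
  proof (induction x rule: less_induct)
    case (less x)
    show ?case
    proof (rule ccontr)
      assume "\<not> x \<le> f x"
      then have "f x < x" by simp
      then have "f (f x) < f x" "f x \<le> f (f x)" using mono less by (auto simp: strict_mono_def)
      then show False by simp
    qed
  qed
  have "\<alpha> < f (osuc \<alpha>)" using ge[of "osuc \<alpha>"] less_osuc order_less_le_trans by blast
  then have ex: "\<exists>x. \<alpha> < f x" ..
  define \<delta> where "\<delta> = (LEAST x. \<alpha> < f x)"
  have \<delta>: "\<alpha> < f \<delta>" unfolding \<delta>_def using ex by (rule LeastI_ex)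
  have least: "f x \<le> \<alpha>" if "x < \<delta>" for x
    using not_less_Least[of x "\<lambda>x. \<alpha> < f x"] that by (simp add: \<delta>_def)
  obtain \<gamma> where \<gamma>: "\<delta> = osuc \<gamma>"
  proof (cases \<delta> rule: ordinal_cases)
    case zero
    have "\<omega> ^\<^sub>o 1 = (\<omega> :: 'i ordinal)" 
      using opow_osuc[of \<omega> "0 :: 'i ordinal"] by (simp add: one_ordinal_def[symmetric])
    then show ?thesis using \<delta> assms by (simp add: zero f_def)
  next
    case limit
    obtain s where s: "s < \<omega> ^\<^sub>o \<delta>" "\<alpha> < \<omega> ^\<^sub>o s"
      using \<delta> limit_ordinal_omega_opow[OF limit]
      by (auto simp: f_def opow_limit[of "\<omega> ^\<^sub>o \<delta>"] less_Sup_ordinal_iff)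
    then obtain t where t: "t < \<delta>" "s < \<omega> ^\<^sub>o t"
      using limit by (auto simp: opow_limit less_Sup_ordinal_iff)
    have "\<alpha> < f t"
      using s(2) strict_monoD[OF strict_mono_omega_opow t(2)] by (simp add: f_def)
    with least[OF t(1)] show ?thesis by simp
  qed
  have "\<exists>!\<gamma>. f \<gamma> \<le> \<alpha> \<and> \<alpha> < f (osuc \<gamma>)"
  proof (rule ex1I[of _ \<gamma>])
    show "f \<gamma> \<le> \<alpha> \<and> \<alpha> < f (osuc \<gamma>)" using \<delta> least \<gamma> by auto
    fix x assume x: "f x \<le> \<alpha> \<and> \<alpha> < f (osuc x)"
    have "x < osuc \<gamma>" "\<gamma> < osuc x"
      using x \<delta> least[of \<gamma>] \<gamma> strict_mono_less[OF mono] by (auto intro: order_le_less_trans)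
    then show "x = \<gamma>" by (auto simp: less_osuc_iff)
  qed
  then show ?thesis by (simp add: f_def plus_ordinal_1)
qed


section \<open>Normed spaces given by explicit operations\<close>

text \<open>
  The space \<open>C([0,\<alpha>])\<close> depends on the ordinal \<open>\<alpha>\<close>, so it cannot be a type; normed spaces over
  \<open>'k\<close> are therefore described by a carrier and operations on it.
\<close>

record ('k, 'v) nspace =
  vectors :: "'v set"
  vadd :: "'v \<Rightarrow> 'v \<Rightarrow> 'v"
  vscale :: "'k \<Rightarrow> 'v \<Rightarrow> 'v"
  vnorm :: "'v \<Rightarrow> real"

text \<open>Functionals are \<open>undefined\<close> off the carrier, so that distinct elements are distinct functionals.\<close>

definition dual :: "('k::real_normed_field, 'v) nspace \<Rightarrow> ('v \<Rightarrow> 'k) set"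
  where "dual X = {\<phi> \<in> extensional (vectors X).
    (\<forall>u\<in>vectors X. \<forall>v\<in>vectors X. \<phi> (vadd X u v) = \<phi> u + \<phi> v) \<and>
    (\<forall>c. \<forall>u\<in>vectors X. \<phi> (vscale X c u) = c * \<phi> u) \<and>
    (\<exists>C. \<forall>u\<in>vectors X. norm (\<phi> u) \<le> C * vnorm X u)}"

definition dual_norm :: "('k::real_normed_field, 'v) nspace \<Rightarrow> ('v \<Rightarrow> 'k) \<Rightarrow> real"
  where "dual_norm X \<phi> = (SUP u\<in>{u \<in> vectors X. vnorm X u \<le> 1}. norm (\<phi> u))"

definition dual_ball :: "('k::real_normed_field, 'v) nspace \<Rightarrow> ('v \<Rightarrow> 'k) set"
  where "dual_ball X = {\<phi> \<in> dual X. dual_norm X \<phi> \<le> 1}"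

definition weak_star :: "('k::real_normed_field, 'v) nspace \<Rightarrow> ('v \<Rightarrow> 'k) topology"
  where "weak_star X = subtopology (product_topology (\<lambda>_. euclidean) (vectors X)) (dual X)"

definition dual_diam :: "('k::real_normed_field, 'v) nspace \<Rightarrow> ('v \<Rightarrow> 'k) set \<Rightarrow> ennreal"
  where "dual_diam X S = (SUP \<phi>\<in>S. SUP \<psi>\<in>S. ennreal (dual_norm X (\<lambda>u. \<phi> u - \<psi> u)))"


section \<open>The Szlenk index\<close>

definition szlenk_deriv ::
    "('k::real_normed_field, 'v) nspace \<Rightarrow> real \<Rightarrow> ('v \<Rightarrow> 'k) set \<Rightarrow> ('v \<Rightarrow> 'k) set"
  where "szlenk_deriv X \<epsilon> B =
    {\<phi> \<in> B. \<forall>V. openin (weak_star X) V \<and> \<phi> \<in> V \<longrightarrow> dual_diam X (B \<inter> V) > ennreal \<epsilon>}"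

definition szlenk_iter ::
    "('k::real_normed_field, 'v) nspace \<Rightarrow> real \<Rightarrow> ('v \<Rightarrow> 'k) set \<Rightarrow> 'i ordinal \<Rightarrow> ('v \<Rightarrow> 'k) set"
  where "szlenk_iter X \<epsilon> B = transrec B (szlenk_deriv X \<epsilon>) Inter"

text \<open>
  The type \<open>'i ordinal\<close> of the result has to be large enough to contain the index; \<open>LEAST\<close> and
  \<open>SUP\<close> below are meaningful only if some iterate of \<open>dual_ball X\<close> in it is empty for every \<open>\<epsilon> > 0\<close>.
\<close>

definition Szlenk_eps :: "('k::real_normed_field, 'v) nspace \<Rightarrow> real \<Rightarrow> 'i ordinal"
  where "Szlenk_eps X \<epsilon> = (LEAST \<beta>. szlenk_iter X \<epsilon> (dual_ball X) \<beta> = {})"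

definition Szlenk :: "('k::real_normed_field, 'v) nspace \<Rightarrow> 'i ordinal"
  where "Szlenk X = (SUP \<epsilon>\<in>{0<..}. Szlenk_eps X \<epsilon>)"


section \<open>Spaces of continuous functions\<close>

text \<open>
  Functions on \<open>K\<close> are represented by their extensions that are \<open>undefined\<close> off \<open>K\<close>.  For an
  interval \<open>K = {0..\<alpha>}\<close> of ordinals the subspace topology underlying \<open>continuous_on\<close> is the order
  topology of the interval, because the interval is order-convex.

  The scalars are the elements of any type \<open>'k\<close> of class \<open>real_normed_field\<close>.  By the Gelfand--Mazur
  theorem such a field is isometrically isomorphic to \<open>\<real>\<close> or \<open>\<complex>\<close>, so that a statement about all
  these types is one about real and complex scalars.
\<close>

definition C_space :: "'a::topological_space set \<Rightarrow> ('k::real_normed_field, 'a \<Rightarrow> 'k) nspace"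
  where "C_space K =
    \<lparr>vectors = {f \<in> extensional K. continuous_on K f},
     vadd = (\<lambda>f g. \<lambda>x\<in>K. f x + g x),
     vscale = (\<lambda>c f. \<lambda>x\<in>K. c * f x),
     vnorm = (\<lambda>f. SUP x\<in>K. norm (f x))\<rparr>"

end

theory Submission
  imports Defs
begin

text \<open>
  A functional on \<open>C([0,\<alpha>])\<close> is an absolutely summable family of point masses.  Upper bound: for every
  open set \<open>U\<close> the variation on \<open>U\<close> is weak-* lower semicontinuous, so in a weak-* limit mass can only
  move to points of higher Cantor--Bendixson rank or disappear, and a Szlenk derivation forces a fixed
  amount of it to do so.  Points of \<open>[0,\<alpha>]\<close> have rank below \<open>\<omega>\<^sup>\<gamma> n\<close> for some \<open>n\<close>.  More generally one derives
  with respect to the variation distance on finitely many bands of ranks of length \<open>\<omega>\<^sup>\<gamma>\<close> and uses induction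
  on \<open>\<gamma>\<close>: as long as the variation below the ends of the bands is constant up to \<open>\<delta>\<close>, a weak-*
  neighbourhood only sees initial pieces of the bands, which are finite unions of bands of length
  \<open>\<omega>\<^bsup>\<gamma>'\<^esup>\<close> with \<open>\<gamma>' < \<gamma>\<close>; so this lasts for fewer than \<open>\<omega>\<^sup>\<gamma>\<close> steps, and it can stop holding only finitely often.
  Lower bound: the Dirac functional at \<open>\<omega>\<close> to the power \<open>\<omega>\<^sup>\<gamma>\<close> survives \<open>\<omega>\<^sup>\<gamma>\<close> derivations, and averaging
  two elements of the dual ball doubles the number of steps while halving \<open>\<epsilon>\<close>.
\<close>

text \<open>The potentials behind the upper bound are the variations below prescribed ranks, and
  their sum takes finitely many levels only if finitely many ranks are prescribed. For \<gamma> = 0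
  a band is a single rank, and both of its ends can be watched. For \<gamma> > 0 a band contains
  infinitely many ranks; this is the obstacle that forces the induction, which watches only the
  upper ends and leaves the inside to shorter bands. Cutting produces several bands with new
  starting points and spends half of \<epsilon>, so the statement proved by induction covers every
  finite set of starting points and every \<epsilon>. The number of stages that the shorter bands
  need depends on the functional around which one works; since
  \<open>\<omega> ^\<^sub>o \<gamma>\<close> exceeds every finite multiple of a smaller power, it is
  nevertheless a block length valid for all of them.

  The class \<open>heine_borel\<close> of the scalars makes closed balls compact, which is how
  absolutely summable families of masses obtain a sum.\<close>

no_notation Infinite_Set_Sum.abs_summable_on (infix "abs'_summable'_on" 50)

section \<open>Ordinal arithmetic and Cantor--Bendixson rank\<close>

lemma ordinal_le_zero_iff [simp]: "x \<le> 0 \<longleftrightarrow> x = 0" for x :: "'i ordinal"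
  by (metis order_antisym order_refl ordinal_zero_le)

lemma osuc_funpow_less_omega: "(osuc ^^ n) 0 < (\<omega> :: 'i ordinal)"
  by (induction n) (auto simp: limit_ordinal_pos limit_ordinal_omega limit_ordinal_osuc_less)

text \<open>Writing finite ordinals as \<open>(osuc ^^ n) 0\<close> lets later arguments run by
  induction on a natural number. The limit case is contradictory: a limit has all these iterates
  below it, hence infinitely many predecessors.\<close>

lemma less_omega_funpow:
  fixes y :: "'i ordinal"
  assumes "y < \<omega>"
  shows "\<exists>n. y = (osuc ^^ n) 0"
  using assms
proof (induction y rule: ordinal_induct)
  case zero
  show ?case by (rule exI[of _ 0]) simp
next
  case (succ y)
  then obtain n where "y = (osuc ^^ n) 0"
    using less_osuc[of y] by (metis order_less_trans)
  then show ?case by (intro exI[of _ "Suc n"]) simp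
next
  case (limit y)
  have "(osuc ^^ n) 0 < y" for n
    by (induction n) (use limit in \<open>auto simp: limit_ordinal_pos limit_ordinal_osuc_less\<close>)
  then have "range (\<lambda>n. (osuc ^^ n) 0) \<subseteq> {..<y}" by auto
  moreover have "strict_mono (\<lambda>n. (osuc ^^ n) (0 :: 'i ordinal))"
    by (simp add: strict_mono_Suc_iff)
  then have "infinite (range (\<lambda>n. (osuc ^^ n) (0 :: 'i ordinal)))"
    by (simp add: range_inj_infinite strict_mono_imp_inj_on)
  ultimately have "infinite {..<y}" using finite_subset by blast
  then show ?case using limit.prems by (simp add: finite_lessThan_iff_less_omega)
qed

lemma plus_ordinal_less_iff [simp]: "x + y < x + z \<longleftrightarrow> y < z" for x :: "'i ordinal"
  by (rule strict_mono_less[OF strict_mono_plus_ordinal])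

lemma plus_ordinal_le_iff [simp]: "x + y \<le> x + z \<longleftrightarrow> y \<le> z" for x :: "'i ordinal"
  by (rule strict_mono_less_eq[OF strict_mono_plus_ordinal])

lemma le_plus_ordinal: "x \<le> x + y" for x :: "'i ordinal"
  using plus_ordinal_le_iff[of x 0 y] by simp

lemma less_plus_ordinal: "0 < y \<Longrightarrow> x < x + y" for x :: "'i ordinal"
  using plus_ordinal_less_iff[of x 0 y] by simp

lemma less_plus_limit_iff:
  fixes x :: "'i ordinal"
  assumes "limit_ordinal y"
  shows "u < x + y \<longleftrightarrow> (\<exists>z<y. u < x + z)"
  using less_Sup_ordinal_iff[OF assms] by (simp add: plus_ordinal_limit[OF assms])

lemma less_times_limit_iff:
  fixes x :: "'i ordinal"
  assumes "limit_ordinal y"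
  shows "u < x * y \<longleftrightarrow> (\<exists>z<y. u < x * z)"
  using less_Sup_ordinal_iff[OF assms] by (simp add: times_ordinal_limit[OF assms])

lemma less_opow_limit_iff:
  fixes x :: "'i ordinal"
  assumes "limit_ordinal y"
  shows "u < x ^\<^sub>o y \<longleftrightarrow> (\<exists>z<y. u < x ^\<^sub>o z)"
  using less_Sup_ordinal_iff[OF assms] by (simp add: opow_limit[OF assms])

lemma limit_ordinal_iff: "limit_ordinal y \<longleftrightarrow> 0 < y \<and> (\<forall>x<y. osuc x < y)"
proof
  assume "0 < y \<and> (\<forall>x<y. osuc x < y)"
  then show "limit_ordinal y" unfolding limit_ordinal_def by (metis less_osuc order_less_irrefl)
qed (auto simp: limit_ordinal_pos limit_ordinal_osuc_less)

lemma limit_ordinal_plus: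
  fixes x :: "'i ordinal"
  assumes "limit_ordinal y"
  shows "limit_ordinal (x + y)"
  unfolding limit_ordinal_iff less_plus_limit_iff[OF assms]
  using assms limit_ordinal_osuc_less[OF assms]
  by (metis limit_ordinal_pos less_osuc order_less_trans le_plus_ordinal order_le_less_trans
      ordinal_zero_le osuc_le_iff plus_ordinal_less_iff)

lemma plus_ordinal_assoc: "x + (y + z) = (x + y) + z" for x :: "'i ordinal"
proof (induction z rule: ordinal_induct)
  case (limit z)
  have "u < x + (y + z) \<longleftrightarrow> u < (x + y) + z" for u
  proof
    assume "u < x + (y + z)"
    then obtain v where v: "v < y + z" "u < x + v"
      using less_plus_limit_iff[OF limit_ordinal_plus[OF limit.hyps]] by blast
    then obtain w where "w < z" "v < y + w"
      using less_plus_limit_iff[OF limit.hyps] by blast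
    then have "u < x + (y + w)" using v by (meson order_less_trans plus_ordinal_less_iff)
    then show "u < x + y + z" using \<open>w < z\<close> limit
      by (metis order_less_trans plus_ordinal_less_iff)
  next
    assume "u < x + y + z"
    then obtain w where "w < z" "u < x + y + w"
      using less_plus_limit_iff[OF limit.hyps] by blast
    then show "u < x + (y + z)" using limit
      by (metis order_less_trans plus_ordinal_less_iff)
  qed
  then show ?case by (metis linorder_neqE order_less_irrefl)
qed (auto simp: plus_ordinal_osuc)

lemma plus_ordinal_mono_left: "x \<le> y \<Longrightarrow> x + z \<le> y + z" for x :: "'i ordinal"
proof (induction z rule: ordinal_induct)
  case (succ z)
  then show ?case by (metis plus_ordinal_osuc less_osuc_iff osuc_le_iff)
next
  case (limit z)
  have "u < y + z" if "u < x + z" for u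
    using that limit unfolding less_plus_limit_iff[OF limit.hyps]
    by (meson order_less_le_trans)
  then show ?case by (meson not_le order_less_irrefl)
qed auto

lemma times_ordinal_mono_right: "y \<le> z \<Longrightarrow> x * y \<le> x * z" for x :: "'i ordinal"
proof (induction z rule: ordinal_induct)
  case (succ z)
  then show ?case
    by (metis le_plus_ordinal less_osuc_iff order_le_less order_trans times_ordinal_osuc)
next
  case (limit z)
  then show ?case
    by (cases "y = z") (auto simp: times_ordinal_limit intro: Sup_ordinal_upper)
qed auto

lemma times_omega_less: "0 < x \<Longrightarrow> x * (osuc ^^ n) 0 < x * \<omega>" for x :: "'i ordinal"
  using osuc_funpow_less_omega[of "Suc n"] times_ordinal_mono_right[of "(osuc ^^ Suc n) 0" \<omega> x]
    less_plus_ordinal[of x "x * (osuc ^^ n) 0"]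
  by (auto simp: times_ordinal_osuc intro: order_less_le_trans order_less_imp_le)

lemma less_times_omega_iff:
  fixes x :: "'i ordinal"
  shows "u < x * \<omega> \<longleftrightarrow> (\<exists>n. u < x * (osuc ^^ n) 0)"
  unfolding less_times_limit_iff[OF limit_ordinal_omega]
  using osuc_funpow_less_omega less_omega_funpow by blast

text \<open>Stands in for the Cantor normal form: finite multiples of smaller powers are cofinal in
  a power of omega.\<close>

lemma omega_opow_less:
  assumes "u < \<omega> ^\<^sub>o \<gamma>" "0 < \<gamma>"
  shows "\<exists>\<gamma>'<\<gamma>. \<exists>n. u < \<omega> ^\<^sub>o \<gamma>' * (osuc ^^ n) 0"
proof (cases \<gamma> rule: ordinal_cases)
  case zero
  then show ?thesis using assms by simp
next
  case (succ \<gamma>')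
  then show ?thesis using assms less_osuc less_times_omega_iff by (metis opow_osuc)
next
  case limit
  then obtain \<gamma>' where "\<gamma>' < \<gamma>" "u < \<omega> ^\<^sub>o \<gamma>'"
    using assms by (auto simp: less_opow_limit_iff)
  then show ?thesis
    by (intro exI[of _ \<gamma>'] conjI exI[of _ "Suc 0"]) (auto simp: times_ordinal_osuc)
qed

lemma omega_opow_times_less:
  assumes "\<gamma>' < \<gamma>"
  shows "\<omega> ^\<^sub>o \<gamma>' * (osuc ^^ n) 0 < \<omega> ^\<^sub>o \<gamma>"
proof -
  have "\<omega> ^\<^sub>o \<gamma>' * (osuc ^^ n) 0 < \<omega> ^\<^sub>o (osuc \<gamma>')"
    unfolding opow_osuc by (rule times_omega_less[OF omega_opow_pos])
  also have "\<dots> \<le> \<omega> ^\<^sub>o \<gamma>"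
    using assms by (simp add: strict_mono_less_eq[OF strict_mono_omega_opow] osuc_le_iff)
  finally show ?thesis .
qed

lemma limit_ordinal_omega_opow_pos:
  assumes "0 < \<gamma>"
  shows "limit_ordinal (\<omega> ^\<^sub>o \<gamma>)"
  unfolding limit_ordinal_iff
proof (intro conjI allI impI)
  fix x assume "x < \<omega> ^\<^sub>o \<gamma>"
  then obtain \<gamma>' n where *: "\<gamma>' < \<gamma>" "x < \<omega> ^\<^sub>o \<gamma>' * (osuc ^^ n) 0"
    using omega_opow_less assms by blast
  then have "osuc x \<le> \<omega> ^\<^sub>o \<gamma>' * (osuc ^^ n) 0" by (simp add: osuc_le_iff)
  then show "osuc x < \<omega> ^\<^sub>o \<gamma>" using omega_opow_times_less[OF *(1)] by (rule order_le_less_trans)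
qed (rule omega_opow_pos)

text \<open>Locates t in one of n consecutive pieces of length x; used to cut an interval of ranks
  into bands.\<close>

lemma less_plus_times_funpow:
  fixes a x t :: "'i ordinal"
  assumes "a \<le> t" "t < a + x * (osuc ^^ n) 0"
  shows "\<exists>i<n. a + x * (osuc ^^ i) 0 \<le> t \<and> t < a + x * (osuc ^^ i) 0 + x"
  using assms
proof (induction n)
  case (Suc n)
  show ?case
  proof (cases "t < a + x * (osuc ^^ n) 0")
    case True
    then show ?thesis using Suc less_SucI by blast
  next
    case False
    then show ?thesis using Suc.prems
      by (intro exI[of _ n]) (auto simp: times_ordinal_osuc plus_ordinal_assoc)
  qed
qed auto

text \<open>
  The Cantor--Bendixson rank of a point \<open>t > 0\<close> of the ordinal line, i.e. the last exponent of
  its Cantor normal form.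
\<close>

definition cb_rank :: "'i ordinal \<Rightarrow> 'i ordinal"
  where "cb_rank t = (LEAST r. t = 0 \<or> (\<exists>x<t. t \<le> x + \<omega> ^\<^sub>o r))"

lemma le_omega_opow: "x \<le> \<omega> ^\<^sub>o x"
proof (induction x rule: less_induct)
  case (less x)
  show ?case
  proof (rule ccontr)
    assume "\<not> x \<le> \<omega> ^\<^sub>o x"
    then have *: "\<omega> ^\<^sub>o x < x" by simp
    then have "\<omega> ^\<^sub>o x \<le> \<omega> ^\<^sub>o (\<omega> ^\<^sub>o x)" by (rule less)
    with strict_monoD[OF strict_mono_omega_opow *] show False by simp
  qed
qed

lemma cb_rank_le: "x < t \<Longrightarrow> t \<le> x + \<omega> ^\<^sub>o r \<Longrightarrow> cb_rank t \<le> r"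
  unfolding cb_rank_def by (rule Least_le) auto

lemma cb_rank_le_opow: "t \<le> \<omega> ^\<^sub>o r \<Longrightarrow> cb_rank t \<le> r"
  unfolding cb_rank_def by (rule Least_le) (metis order_less_le ordinal_zero_le plus_ordinal_left_0)

lemma cb_rank_witness:
  assumes "0 < t"
  shows "\<exists>x<t. t \<le> x + \<omega> ^\<^sub>o cb_rank t"
proof -
  have "t = 0 \<or> (\<exists>x<t. t \<le> x + \<omega> ^\<^sub>o t)" using assms le_omega_opow[of t] by auto
  then have "t = 0 \<or> (\<exists>x<t. t \<le> x + \<omega> ^\<^sub>o cb_rank t)"
    unfolding cb_rank_def by (rule LeastI)
  then show ?thesis using assms by auto
qed

lemma open_greaterThanAtMost_ordinal: "open {s<..t :: 'i ordinal}"
proof -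
  have "{s<..t} = {s<..<osuc t}" by (auto simp: less_osuc_iff)
  then show ?thesis by simp
qed

lemma open_atMost_ordinal: "open {..t :: 'i ordinal}"
proof -
  have "{..t} = {..<osuc t}" by (auto simp: less_osuc_iff)
  then show ?thesis by simp
qed

text \<open>If x witnesses the rank of t, then x also witnesses the same bound for every point of
  (x, t], so ranks do not rise there. Openness is what makes the variation on low ranks lower
  semicontinuous.\<close>

lemma open_cb_rank_less: "open {t. cb_rank t < r}"
proof (subst open_subopen, intro ballI)
  fix t assume t: "t \<in> {t. cb_rank t < r}"
  show "\<exists>T. open T \<and> t \<in> T \<and> T \<subseteq> {t. cb_rank t < r}"
  proof (cases "t = 0")
    case True
    then show ?thesis using t by (intro exI[of _ "{..t}"]) (auto simp: open_atMost_ordinal)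
  next
    case False
    then obtain x where x: "x < t" "t \<le> x + \<omega> ^\<^sub>o cb_rank t"
      using cb_rank_witness[of t] by (auto simp: order_less_le)
    have "cb_rank u < r" if "u \<in> {x<..t}" for u
    proof -
      have "u \<le> x + \<omega> ^\<^sub>o cb_rank t" using that x(2) by (metis greaterThanAtMost_iff order_trans)
      then have "cb_rank u \<le> cb_rank t" using that cb_rank_le by auto
      then show ?thesis using t by (simp add: order_le_less_trans)
    qed
    then show ?thesis using x(1)
      by (intro exI[of _ "{x<..t}"]) (auto simp: open_greaterThanAtMost_ordinal)
  qed
qed

text \<open>Strictness gains a rank: u is already reached from x by finitely many steps of a smaller
  power of omega.\<close>

lemma cb_rank_less_of_less:
  assumes "u < x + \<omega> ^\<^sub>o r" "x < u" "0 < r"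
  shows "cb_rank u < r"
proof -
  obtain y where y: "y < \<omega> ^\<^sub>o r" "u < x + y"
    using assms(1) less_plus_limit_iff[OF limit_ordinal_omega_opow_pos[OF assms(3)]] by blast
  then obtain r' n where r': "r' < r" "y < \<omega> ^\<^sub>o r' * (osuc ^^ n) 0"
    using omega_opow_less assms(3) by blast
  then have n: "u \<le> x + \<omega> ^\<^sub>o r' * (osuc ^^ n) 0"
    using y by (meson order_less_imp_le order_less_trans plus_ordinal_less_iff)
  \<comment> \<open>By minimality of k, the point u lies beyond the first k - 1 steps and not beyond
    k of them, so the end of step k - 1 witnesses the rank bound.\<close>
  define k where "k = (LEAST n. u \<le> x + \<omega> ^\<^sub>o r' * (osuc ^^ n) 0)"
  have k: "u \<le> x + \<omega> ^\<^sub>o r' * (osuc ^^ k) 0" unfolding k_def using n by (rule LeastI)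
  then have "k \<noteq> 0" using assms(2) by (metis funpow_0 leD plus_ordinal_0 times_ordinal_0)
  then obtain j where j: "k = Suc j" using not0_implies_Suc by blast
  have "x + \<omega> ^\<^sub>o r' * (osuc ^^ j) 0 < u"
    using not_less_Least[of j "\<lambda>n. u \<le> x + \<omega> ^\<^sub>o r' * (osuc ^^ n) 0"] j by (simp add: k_def)
  moreover have "u \<le> x + \<omega> ^\<^sub>o r' * (osuc ^^ j) 0 + \<omega> ^\<^sub>o r'"
    using k by (simp add: j times_ordinal_osuc plus_ordinal_assoc)
  ultimately have "cb_rank u \<le> r'" by (rule cb_rank_le)
  then show ?thesis using r'(1) by simp
qed

lemma cb_rank_isolated:
  assumes "0 < t"
  shows "\<exists>x<t. \<forall>u\<in>{x<..<t}. cb_rank u < cb_rank t"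
proof -
  obtain x where x: "x < t" "t \<le> x + \<omega> ^\<^sub>o cb_rank t" using cb_rank_witness[OF assms] by blast
  have "cb_rank u < cb_rank t" if u: "x < u" "u < t" for u
  proof (cases "cb_rank t = 0")
    \<comment> \<open>Here t is the successor of x, and no point lies strictly between.\<close>
    case True
    then have "t \<le> osuc x" using x(2) by (simp add: plus_ordinal_1)
    then show ?thesis using u by (metis less_osuc_iff order_less_le_trans leD)
  next
    case False
    then have "0 < cb_rank t" by (simp add: order_less_le)
    then show ?thesis
      using cb_rank_less_of_less[of u x "cb_rank t"] x u by (meson order_less_le_trans)
  qed
  then show ?thesis using x(1) by auto
qed

section \<open>Iterated derivations\<close>

text \<open>The diameter condition is spelt out with two points and an arbitrary function d, which
  need not be a metric. The same calculus thus serves the dual norm and the variation distance on a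
  part of the ordinals.\<close>

definition sep_deriv :: "'a topology \<Rightarrow> ('a \<Rightarrow> 'a \<Rightarrow> real) \<Rightarrow> real \<Rightarrow> 'a set \<Rightarrow> 'a set"
  where "sep_deriv T d \<epsilon> A =
    {x \<in> A. \<forall>V. openin T V \<and> x \<in> V \<longrightarrow> (\<exists>y\<in>A \<inter> V. \<exists>z\<in>A \<inter> V. \<epsilon> < d y z)}"

definition sep_iter :: "'a topology \<Rightarrow> ('a \<Rightarrow> 'a \<Rightarrow> real) \<Rightarrow> real \<Rightarrow> 'a set \<Rightarrow> 'i ordinal \<Rightarrow> 'a set"
  where "sep_iter T d \<epsilon> A = transrec A (sep_deriv T d \<epsilon>) Inter"

lemma sep_iter_0 [simp]: "sep_iter T d \<epsilon> A 0 = A"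
  by (simp add: sep_iter_def transrec_0)

lemma sep_iter_osuc: "sep_iter T d \<epsilon> A (osuc \<beta>) = sep_deriv T d \<epsilon> (sep_iter T d \<epsilon> A \<beta>)"
  by (simp add: sep_iter_def transrec_osuc)

lemma sep_iter_limit: "limit_ordinal \<beta> \<Longrightarrow> sep_iter T d \<epsilon> A \<beta> = (\<Inter>\<sigma>\<in>{..<\<beta>}. sep_iter T d \<epsilon> A \<sigma>)"
  by (simp add: sep_iter_def transrec_limit)

lemma sep_deriv_subset: "sep_deriv T d \<epsilon> A \<subseteq> A"
  by (auto simp: sep_deriv_def)

lemma sep_iter_antimono: "\<sigma> \<le> \<beta> \<Longrightarrow> sep_iter T d \<epsilon> A \<beta> \<subseteq> sep_iter T d \<epsilon> A \<sigma>"
proof (induction \<beta> rule: ordinal_induct)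
  case (succ \<beta>)
  show ?case
  proof (cases "\<sigma> = osuc \<beta>")
    case False
    then have "\<sigma> \<le> \<beta>" using succ.prems by (metis less_osuc_iff order_less_le)
    then show ?thesis
      using succ.IH sep_deriv_subset[of T d \<epsilon> "sep_iter T d \<epsilon> A \<beta>"] by (auto simp: sep_iter_osuc)
  qed simp
next
  case (limit \<beta>)
  then show ?case by (cases "\<sigma> = \<beta>") (auto simp: sep_iter_limit)
qed auto

lemma sep_iter_subset: "sep_iter T d \<epsilon> A \<beta> \<subseteq> A"
  using sep_iter_antimono[of 0 \<beta> T d \<epsilon> A] by simp

text \<open>Allows counting in blocks: one block per level of the potential in the upper bound, two
  consecutive blocks in the averaging argument of the lower bound.\<close>

lemma sep_iter_plus: "sep_iter T d \<epsilon> A (\<beta> + \<beta>') = sep_iter T d \<epsilon> (sep_iter T d \<epsilon> A \<beta>) \<beta>'"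
proof (induction \<beta>' rule: ordinal_induct)
  case (limit \<beta>')
  show ?case
  proof (intro subset_antisym subsetI)
    fix x assume "x \<in> sep_iter T d \<epsilon> A (\<beta> + \<beta>')"
    then have "x \<in> sep_iter T d \<epsilon> A (\<beta> + \<sigma>)" if "\<sigma> < \<beta>'" for \<sigma>
      using order_less_imp_le[OF that] sep_iter_antimono[of "\<beta> + \<sigma>" "\<beta> + \<beta>'" T d \<epsilon> A] by auto
    then show "x \<in> sep_iter T d \<epsilon> (sep_iter T d \<epsilon> A \<beta>) \<beta>'"
      using limit by (auto simp: sep_iter_limit)
  next
    fix x assume x: "x \<in> sep_iter T d \<epsilon> (sep_iter T d \<epsilon> A \<beta>) \<beta>'"
    have "x \<in> sep_iter T d \<epsilon> A \<sigma>" if \<sigma>: "\<sigma> < \<beta> + \<beta>'" for \<sigma>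
    proof -
      obtain \<tau> where \<tau>: "\<tau> < \<beta>'" "\<sigma> < \<beta> + \<tau>"
        using \<sigma> unfolding less_plus_limit_iff[OF limit.hyps] by blast
      have "x \<in> sep_iter T d \<epsilon> (sep_iter T d \<epsilon> A \<beta>) \<tau>"
        using x \<tau>(1) unfolding sep_iter_limit[OF limit.hyps] by blast
      then show ?thesis
        using limit.IH[OF \<tau>(1)] sep_iter_antimono[OF order_less_imp_le[OF \<tau>(2)], of T d \<epsilon> A] by blast
    qed
    then show "x \<in> sep_iter T d \<epsilon> A (\<beta> + \<beta>')"
      by (simp add: sep_iter_limit limit_ordinal_plus limit.hyps)
  qed
qed (auto simp: plus_ordinal_osuc sep_iter_osuc)

text \<open>The distances are compared only on the initial set A, so that estimates valid just on A,
  such as small tails, can be used.\<close>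

lemma sep_iter_mono:
  assumes "A \<subseteq> A'" and d: "\<And>y z. y \<in> A \<Longrightarrow> z \<in> A \<Longrightarrow> \<epsilon> < d y z \<Longrightarrow> \<epsilon>' < d' y z"
  shows "sep_iter T d \<epsilon> A \<beta> \<subseteq> sep_iter T d' \<epsilon>' A' \<beta>"
proof (induction \<beta> rule: ordinal_induct)
  case (succ \<beta>)
  show ?case
  proof
    fix x assume x: "x \<in> sep_iter T d \<epsilon> A (osuc \<beta>)"
    have "\<exists>y\<in>sep_iter T d' \<epsilon>' A' \<beta> \<inter> V. \<exists>z\<in>sep_iter T d' \<epsilon>' A' \<beta> \<inter> V. \<epsilon>' < d' y z"
      if V: "openin T V" "x \<in> V" for V
    proof -
      obtain y z where yz: "y \<in> sep_iter T d \<epsilon> A \<beta> \<inter> V" "z \<in> sep_iter T d \<epsilon> A \<beta> \<inter> V" "\<epsilon> < d y z"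
        using x V unfolding sep_iter_osuc sep_deriv_def by blast
      then have "\<epsilon>' < d' y z" using d sep_iter_subset[of T d \<epsilon> A \<beta>] by blast
      then show ?thesis using yz succ by blast
    qed
    then show "x \<in> sep_iter T d' \<epsilon>' A' (osuc \<beta>)"
      using x succ unfolding sep_iter_osuc by (auto simp: sep_deriv_def)
  qed
next
  case (limit \<beta>)
  then show ?case unfolding sep_iter_limit[OF limit.hyps] by blast
qed (use assms in auto)

text \<open>Whether x survives depends only on the part of A near x; hence x is excluded as soon as
  the iterate of a small piece around it is empty.\<close>

lemma sep_iter_local:
  assumes "openin T V"
  shows "sep_iter T d \<epsilon> A \<beta> \<inter> V \<subseteq> sep_iter T d \<epsilon> (A \<inter> V) \<beta>"
proof (induction \<beta> rule: ordinal_induct)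
  case (succ \<beta>)
  show ?case
  proof
    fix x assume x: "x \<in> sep_iter T d \<epsilon> A (osuc \<beta>) \<inter> V"
    have "\<exists>y\<in>sep_iter T d \<epsilon> (A \<inter> V) \<beta> \<inter> W. \<exists>z\<in>sep_iter T d \<epsilon> (A \<inter> V) \<beta> \<inter> W. \<epsilon> < d y z"
      if W: "openin T W" "x \<in> W" for W
    proof -
      have "openin T (W \<inter> V)" "x \<in> W \<inter> V" using W assms x by auto
      then obtain y z where "y \<in> sep_iter T d \<epsilon> A \<beta> \<inter> (W \<inter> V)" "z \<in> sep_iter T d \<epsilon> A \<beta> \<inter> (W \<inter> V)"
        "\<epsilon> < d y z" using x unfolding sep_iter_osuc sep_deriv_def by blast
      then show ?thesis using succ by blast
    qed
    then show "x \<in> sep_iter T d \<epsilon> (A \<inter> V) (osuc \<beta>)"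
      using x succ unfolding sep_iter_osuc by (auto simp: sep_deriv_def)
  qed
next
  case (limit \<beta>)
  have "x \<in> sep_iter T d \<epsilon> (A \<inter> V) \<sigma>" if "\<sigma> < \<beta>" "x \<in> sep_iter T d \<epsilon> A \<beta> \<inter> V" for x \<sigma>
    using limit.IH[OF that(1)] that(2) sep_iter_antimono[OF order_less_imp_le[OF that(1)], of T d \<epsilon> A]
    by blast
  then show ?case using limit.hyps by (auto simp: sep_iter_limit[of \<beta> T d \<epsilon> "A \<inter> V"])
qed auto

text \<open>Preimages of neighbourhoods are neighbourhoods, and separated pairs go to separated
  pairs. Applied to averaging with a fixed functional, where \<epsilon>' is half of
  \<epsilon>.\<close>

lemma sep_iter_image:
  assumes cont: "continuous_map T T' h" and "A \<subseteq> topspace T" "h ` A \<subseteq> A'"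
    and d: "\<And>y z. y \<in> A \<Longrightarrow> z \<in> A \<Longrightarrow> \<epsilon> < d y z \<Longrightarrow> \<epsilon>' < d' (h y) (h z)"
  shows "h ` sep_iter T d \<epsilon> A \<beta> \<subseteq> sep_iter T' d' \<epsilon>' A' \<beta>"
proof (induction \<beta> rule: ordinal_induct)
  case (succ \<beta>)
  show ?case
  proof (rule image_subsetI)
    fix x assume x: "x \<in> sep_iter T d \<epsilon> A (osuc \<beta>)"
    have *: "x \<in> topspace T" "x \<in> sep_iter T d \<epsilon> A \<beta>"
      using x assms(2) sep_iter_subset[of T d \<epsilon> A \<beta>] sep_deriv_subset[of T d \<epsilon> "sep_iter T d \<epsilon> A \<beta>"]
      unfolding sep_iter_osuc by blast+
    have "\<exists>y\<in>sep_iter T' d' \<epsilon>' A' \<beta> \<inter> V. \<exists>z\<in>sep_iter T' d' \<epsilon>' A' \<beta> \<inter> V. \<epsilon>' < d' y z"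
      if V: "openin T' V" "h x \<in> V" for V
    proof -
      have "openin T {u \<in> topspace T. h u \<in> V}"
        using openin_continuous_map_preimage[OF cont V(1)] .
      then obtain y z where yz: "y \<in> sep_iter T d \<epsilon> A \<beta>" "z \<in> sep_iter T d \<epsilon> A \<beta>"
        "h y \<in> V" "h z \<in> V" "\<epsilon> < d y z"
        using x * V(2) unfolding sep_iter_osuc sep_deriv_def by blast
      then have "\<epsilon>' < d' (h y) (h z)"
        using d sep_iter_subset[of T d \<epsilon> A \<beta>] by blast
      then show ?thesis using yz succ by blast
    qed
    then show "h x \<in> sep_iter T' d' \<epsilon>' A' (osuc \<beta>)"
      using * succ unfolding sep_iter_osuc by (auto simp: sep_deriv_def)
  qed
next
  case (limit \<beta>)
  then show ?case unfolding sep_iter_limit[OF limit.hyps] by blast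
qed (use assms in auto)

lemma openin_finite_Inter_nbhds:
  assumes "finite J" and "\<And>j. j \<in> J \<Longrightarrow> \<exists>V. openin T V \<and> x \<in> V \<and> (\<forall>y\<in>B \<inter> V. Q j y)"
    and "x \<in> topspace T"
  shows "\<exists>V. openin T V \<and> x \<in> V \<and> (\<forall>y\<in>B \<inter> V. \<forall>j\<in>J. Q j y)"
  using assms(1,2)
proof (induction J)
  case empty
  then show ?case using assms(3) by auto
next
  case (insert j J)
  then obtain V W where "openin T V" "x \<in> V" "\<forall>y\<in>B \<inter> V. \<forall>j\<in>J. Q j y"
    "openin T W" "x \<in> W" "\<forall>y\<in>B \<inter> W. Q j y"
    by (metis insert_iff)
  then show ?case by (intro exI[of _ "V \<inter> W"]) auto
qed

text \<open>
  The sum of the integer parts of \<open>g j / \<delta>\<close> is an upper semicontinuous potential with finitely many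
  values, and each of its level sets is exhausted after \<open>\<kappa>\<close> derivations.
\<close>

lemma sep_iter_times_empty:
  fixes g :: "'j \<Rightarrow> 'a \<Rightarrow> real" and \<kappa> :: "'i ordinal"
  assumes J: "finite J" and \<delta>: "0 < \<delta>" and B: "B \<subseteq> topspace T"
    and bound: "\<And>j x. j \<in> J \<Longrightarrow> x \<in> B \<Longrightarrow> 0 \<le> g j x \<and> g j x \<le> 1"
    and usc: "\<And>j x c. j \<in> J \<Longrightarrow> x \<in> B \<Longrightarrow> g j x < c \<Longrightarrow>
      \<exists>V. openin T V \<and> x \<in> V \<and> (\<forall>y\<in>B \<inter> V. g j y < c)"
    and step: "\<And>x. x \<in> B \<Longrightarrow> \<exists>V. openin T V \<and> x \<in> V \<and>
      sep_iter T d \<epsilon> {y \<in> B \<inter> V. \<forall>j\<in>J. \<bar>g j y - g j x\<bar> < \<delta>} \<kappa> = {}"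
  shows "\<exists>n. sep_iter T d \<epsilon> B (\<kappa> * (osuc ^^ n) 0) = {}"
proof -
  define \<Phi> where "\<Phi> x = (\<Sum>j\<in>J. nat \<lfloor>g j x / \<delta>\<rfloor>)" for x
  \<comment> \<open>Each block of \<kappa> derivations raises the least potential still present by
    at least 1.\<close>
  have main: "sep_iter T d \<epsilon> B (\<kappa> * (osuc ^^ n) 0) \<subseteq> {x. n \<le> \<Phi> x}" for n
  proof (induction n)
    case (Suc n)
    let ?A = "sep_iter T d \<epsilon> B (\<kappa> * (osuc ^^ n) 0)"
    show ?case
    proof
      fix x assume x: "x \<in> sep_iter T d \<epsilon> B (\<kappa> * (osuc ^^ Suc n) 0)"
      then have x': "x \<in> sep_iter T d \<epsilon> ?A \<kappa>"
        by (simp add: times_ordinal_osuc sep_iter_plus)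
      then have xA: "x \<in> ?A" by (rule subsetD[OF sep_iter_subset])
      then have xB: "x \<in> B" by (rule subsetD[OF sep_iter_subset])
      have "\<Phi> x \<noteq> n"
      proof
        \<comment> \<open>Among the survivors near x the potential is at most n by semicontinuity
          and at least n by the induction hypothesis. Termwise comparable sums that agree have equal
          terms, so every \<open>g j\<close> keeps its integer part and moves by less than \<delta>:
          the survivors near x lie in the set that \<open>step\<close> exhausts.\<close>
        assume n: "\<Phi> x = n"
        obtain V where V: "openin T V" "x \<in> V"
          "sep_iter T d \<epsilon> {y \<in> B \<inter> V. \<forall>j\<in>J. \<bar>g j y - g j x\<bar> < \<delta>} \<kappa> = {}"
          using step[OF xB] by blast
        have "g j x < \<delta> * (\<lfloor>g j x / \<delta>\<rfloor> + 1)" for j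
          using \<delta> floor_correct[of "g j x / \<delta>"] by (simp add: field_simps)
        then obtain W where W: "openin T W" "x \<in> W"
          "\<forall>y\<in>B \<inter> W. \<forall>j\<in>J. g j y < \<delta> * (\<lfloor>g j x / \<delta>\<rfloor> + 1)"
          using openin_finite_Inter_nbhds[OF J, where B = B and x = x and T = T
              and Q = "\<lambda>j y. g j y < \<delta> * (\<lfloor>g j x / \<delta>\<rfloor> + 1)"]
            usc[OF _ xB] B xB by blast
        have "\<bar>g j y - g j x\<bar> < \<delta>" if y: "y \<in> ?A \<inter> (V \<inter> W)" and j: "j \<in> J" for y j
        proof -
          have yB: "y \<in> B" using y sep_iter_subset[of T d \<epsilon> B "\<kappa> * (osuc ^^ n) 0"] by blast
          have le: "nat \<lfloor>g i y / \<delta>\<rfloor> \<le> nat \<lfloor>g i x / \<delta>\<rfloor>" if i: "i \<in> J" for i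
          proof -
            have "g i y < \<delta> * (\<lfloor>g i x / \<delta>\<rfloor> + 1)" using W(3) y yB i by blast
            then have "g i y / \<delta> < of_int (\<lfloor>g i x / \<delta>\<rfloor> + 1)" using \<delta> by (simp add: field_simps)
            then have "\<lfloor>g i y / \<delta>\<rfloor> < \<lfloor>g i x / \<delta>\<rfloor> + 1" by (subst floor_less_iff)
            then show ?thesis by simp
          qed
          have "n \<le> \<Phi> y" using Suc.IH y by auto
          moreover have "\<Phi> y \<le> \<Phi> x" unfolding \<Phi>_def by (intro sum_mono le)
          ultimately have "\<Phi> y = \<Phi> x" using n by simp
          then have "nat \<lfloor>g j y / \<delta>\<rfloor> = nat \<lfloor>g j x / \<delta>\<rfloor>"
            using sum_mono_inv[of "\<lambda>i. nat \<lfloor>g i y / \<delta>\<rfloor>" J "\<lambda>i. nat \<lfloor>g i x / \<delta>\<rfloor>" j] le j J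
            by (auto simp: \<Phi>_def)
          moreover have "0 \<le> \<lfloor>g j y / \<delta>\<rfloor>" "0 \<le> \<lfloor>g j x / \<delta>\<rfloor>"
            using bound[OF j] yB xB \<delta> by auto
          ultimately have eq: "\<lfloor>g j y / \<delta>\<rfloor> = \<lfloor>g j x / \<delta>\<rfloor>" by (meson eq_nat_nat_iff)
          have "\<bar>g j y / \<delta> - g j x / \<delta>\<bar> < 1"
            using floor_correct[of "g j y / \<delta>"] floor_correct[of "g j x / \<delta>"] unfolding eq by linarith
          then have "\<bar>(g j y - g j x) / \<delta>\<bar> < 1" by (simp only: diff_divide_distrib)
          then show ?thesis using \<delta> by (simp add: abs_divide)
        qed
        then have "?A \<inter> (V \<inter> W) \<subseteq> {y \<in> B \<inter> V. \<forall>j\<in>J. \<bar>g j y - g j x\<bar> < \<delta>}"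
          using sep_iter_subset[of T d \<epsilon> B "\<kappa> * (osuc ^^ n) 0"] by blast
        then have "sep_iter T d \<epsilon> (?A \<inter> (V \<inter> W)) \<kappa> = {}"
          using sep_iter_mono[of "?A \<inter> (V \<inter> W)" "{y \<in> B \<inter> V. \<forall>j\<in>J. \<bar>g j y - g j x\<bar> < \<delta>}" \<epsilon> d \<epsilon> d T \<kappa>]
            V(3) by blast
        then show False
          using sep_iter_local[of T "V \<inter> W" d \<epsilon> ?A \<kappa>] x' V W by blast
      qed
      moreover have "n \<le> \<Phi> x" using Suc.IH xA by auto
      ultimately show "x \<in> {x. Suc n \<le> \<Phi> x}" by simp
    qed
  qed auto
  define N where "N = card J * nat \<lfloor>1 / \<delta>\<rfloor>"
  have N: "\<Phi> x \<le> N" if "x \<in> B" for x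
  proof -
    have "nat \<lfloor>g j x / \<delta>\<rfloor> \<le> nat \<lfloor>1 / \<delta>\<rfloor>" if "j \<in> J" for j
      using \<delta> bound[OF that \<open>x \<in> B\<close>] by (intro nat_mono floor_mono divide_right_mono) auto
    then show ?thesis
      using sum_bounded_above[of J "\<lambda>j. nat \<lfloor>g j x / \<delta>\<rfloor>" "nat \<lfloor>1 / \<delta>\<rfloor>"]
      by (simp add: \<Phi>_def N_def)
  qed
  have "x \<notin> sep_iter T d \<epsilon> B (\<kappa> * (osuc ^^ Suc N) 0)" for x
  proof
    assume x: "x \<in> sep_iter T d \<epsilon> B (\<kappa> * (osuc ^^ Suc N) 0)"
    then have "x \<in> B" by (rule subsetD[OF sep_iter_subset])
    moreover have "Suc N \<le> \<Phi> x" using subsetD[OF main x] by simp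
    ultimately show False using N[of x] by simp
  qed
  then show ?thesis by blast
qed

section \<open>Functionals as families of point masses\<close>

lemma abs_summable_tail:
  fixes f :: "'a \<Rightarrow> 'b::real_normed_vector"
  assumes "f abs_summable_on A" "0 < e"
  shows "\<exists>F. finite F \<and> F \<subseteq> A \<and> (\<Sum>\<^sub>\<infinity>x\<in>A - F. norm (f x)) < e"
proof -
  obtain F where F: "finite F" "F \<subseteq> A"
    "dist (\<Sum>x\<in>F. norm (f x)) (\<Sum>\<^sub>\<infinity>x\<in>A. norm (f x)) \<le> e / 2"
    using infsum_finite_approximation[OF assms(1), of "e / 2"] assms(2) by auto
  have "(\<Sum>\<^sub>\<infinity>x\<in>A - F. norm (f x)) = (\<Sum>\<^sub>\<infinity>x\<in>A. norm (f x)) - (\<Sum>x\<in>F. norm (f x))"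
    using F assms(1) by (subst infsum_Diff) auto
  also have "\<dots> \<le> e / 2" using F(3) unfolding dist_real_def by linarith
  finally show ?thesis using F assms(2) by (intro exI[of _ F]) auto
qed

text \<open>
  The library has this for sort \<open>banach\<close>, which a type of sort
  \<open>{real_normed_vector, complete_space}\<close> need not have formally.
\<close>

lemma abs_summable_summable_heine_borel:
  fixes f :: "'a \<Rightarrow> 'b::{real_normed_vector, heine_borel}"
  assumes f: "f abs_summable_on A"
  shows "f summable_on A"
proof -
  let ?L = "\<Sum>\<^sub>\<infinity>x\<in>A. norm (f x)" and ?G = "filtermap (sum f) (finite_subsets_at_top A)"
  have "norm (sum f F) \<le> ?L" if F: "finite F" "F \<subseteq> A" for F
    using norm_sum[of f F] finite_sum_le_infsum[OF f F] by simp
  \<comment> \<open>The partial sums stay in a compact ball, hence have a cluster point; the small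
    tails turn it into a limit.\<close>
  then have "eventually (\<lambda>s. s \<in> cball 0 ?L) ?G"
    by (auto simp: eventually_filtermap intro!: eventually_finite_subsets_at_top_weakI)
  moreover have "?G \<noteq> bot" by (simp add: filtermap_bot_iff)
  ultimately obtain x where x: "inf (nhds x) ?G \<noteq> bot"
    using compact_cball[of "0 :: 'b" ?L] unfolding compact_filter by blast
  have "(sum f \<longlongrightarrow> x) (finite_subsets_at_top A)"
    unfolding tendsto_iff
  proof (intro allI impI)
    fix e :: real assume e: "0 < e"
    obtain F where F: "finite F" "F \<subseteq> A" "(\<Sum>\<^sub>\<infinity>y\<in>A - F. norm (f y)) < e / 4"
      using abs_summable_tail[OF f, of "e / 4"] e by auto
    have *: "dist (sum f H) (sum f F) < e / 4" if H: "finite H" "F \<subseteq> H" "H \<subseteq> A" for H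
    proof -
      have "dist (sum f H) (sum f F) = norm (sum f (H - F))"
        using H by (simp add: dist_norm sum_diff)
      also have "\<dots> \<le> (\<Sum>y\<in>H - F. norm (f y))" by (rule norm_sum)
      also have "\<dots> \<le> (\<Sum>\<^sub>\<infinity>y\<in>A - F. norm (f y))"
        using H F f by (intro finite_sum_le_infsum summable_on_Diff) auto
      finally show ?thesis using F(3) by simp
    qed
    have "eventually (\<lambda>s. dist s (sum f F) < e / 4) ?G"
      unfolding eventually_filtermap eventually_finite_subsets_at_top using F * by blast
    moreover have "eventually (\<lambda>s. dist s x < e / 4) (nhds x)"
      unfolding eventually_nhds_metric using e by (intro exI[of _ "e / 4"]) auto
    ultimately have "eventually (\<lambda>s. dist s x < e / 4 \<and> dist s (sum f F) < e / 4) (inf (nhds x) ?G)"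
      unfolding eventually_inf by blast
    then obtain s where "dist s x < e / 4" "dist s (sum f F) < e / 4"
      using eventually_happens'[OF x] by blast
    then have "dist (sum f F) x < e / 2" using dist_triangle2[of "sum f F" x s] by (simp add: dist_commute)
    then have "dist (sum f H) x < e" if "finite H" "F \<subseteq> H" "H \<subseteq> A" for H
      using *[OF that] dist_triangle[of "sum f H" x "sum f F"] e by simp
    then show "eventually (\<lambda>H. dist (sum f H) x < e) (finite_subsets_at_top A)"
      unfolding eventually_finite_subsets_at_top using F by blast
  qed
  then show ?thesis by (auto simp: summable_on_def has_sum_def)
qed

section \<open>Clopen sets and continuous functions on ordinal intervals\<close>

lemma atLeastAtMost_ordinal [simp]: "{0..\<alpha>} = {..\<alpha>}" for \<alpha> :: "'i ordinal"
  by auto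

text \<open>For t > 0 the set is of the form (s, t], and for t = 0 it is {0}. The last conjunct
  keeps the trace of this form by which such sets are later shown to be disjoint: everything between
  a point of W and t belongs to W.\<close>

lemma ordinal_clopen_nbhd:
  fixes t :: "'i ordinal"
  assumes "open U" "t \<in> U" "finite G"
  shows "\<exists>W. open W \<and> closed W \<and> t \<in> W \<and> W \<subseteq> U \<inter> {..t} \<and> W \<inter> G \<subseteq> {t} \<and> (\<forall>u\<in>W. {u..t} \<subseteq> W)"
proof (cases "t = 0")
  case True
  have "closed {..t}" by simp
  then show ?thesis using assms True
    by (intro exI[of _ "{..t}"]) (auto simp: open_atMost_ordinal)
next
  case False
  then have t: "0 < t" by (simp add: order_less_le)
  have "open (U \<inter> - (G - {t}))"
    using assms by (intro open_Int open_Compl finite_imp_closed) auto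
  then obtain s where s: "s < t" "{s<..t} \<subseteq> U \<inter> - (G - {t})"
    using open_left[of "U \<inter> - (G - {t})" t 0] assms t by auto
  have "- {s<..t} = {..<osuc s} \<union> {t<..}" by (auto simp: less_osuc_iff)
  then have "closed {s<..t}" unfolding closed_def by auto
  then show ?thesis using s by (intro exI[of _ "{s<..t}"]) (auto simp: open_greaterThanAtMost_ordinal)
qed

lemma continuous_on_if_clopen:
  fixes W :: "'a::topological_space set"
  assumes "open W" "closed W"
  shows "continuous_on UNIV (\<lambda>u. if u \<in> W then c else d)"
proof -
  have "continuous_on (W \<union> - W) (\<lambda>u. if u \<in> W then c else d)"
    using assms by (intro continuous_on_cases) auto
  then show ?thesis by simp
qed

lemma continuous_on_ordinal_left:
  fixes f :: "'i ordinal \<Rightarrow> 'b::metric_space"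
  assumes "continuous_on {..\<alpha>} f" "t \<le> \<alpha>" "0 < t" "0 < e"
  shows "\<exists>s<t. \<forall>u\<in>{s<..t}. dist (f u) (f t) < e"
proof -
  obtain A where A: "open A" "t \<in> A" "\<forall>y\<in>{..\<alpha>}. y \<in> A \<longrightarrow> f y \<in> ball (f t) e"
    using assms unfolding continuous_on_topological
    by (metis atMost_iff centre_in_ball open_ball)
  then obtain s where "s < t" "{s<..t} \<subseteq> A" using open_left assms(3) by blast
  then show ?thesis using A assms(2) by (intro exI[of _ s]) (force simp: dist_commute)
qed

text \<open>Compactness of the interval in the guise of well-founded induction: continuity controls
  f on some (s, t], the induction hypothesis on [0, s].\<close>

lemma bounded_continuous_ordinal:
  fixes f :: "'i ordinal \<Rightarrow> 'b::real_normed_vector"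
  assumes f: "continuous_on {..\<alpha>} f"
  shows "\<exists>C. \<forall>t\<le>\<alpha>. norm (f t) \<le> C"
proof -
  have "t \<le> \<alpha> \<Longrightarrow> \<exists>C. \<forall>u\<le>t. norm (f u) \<le> C" for t
  proof (induction t rule: less_induct)
    case (less t)
    show ?case
    proof (cases "t = 0")
      case False
      then have "0 < t" by (simp add: order_less_le)
      then obtain s where s: "s < t" "\<forall>u\<in>{s<..t}. dist (f u) (f t) < 1"
        using continuous_on_ordinal_left[OF f less.prems, of 1] by auto
      obtain C where C: "\<forall>u\<le>s. norm (f u) \<le> C"
        using less.IH[OF s(1)] s(1) less.prems by (meson order_less_imp_le order_trans)
      have "norm (f u) \<le> max C (norm (f t) + 1)" if "u \<le> t" for u
      proof (cases "u \<le> s")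
        case False
        then have "dist (f u) (f t) < 1" using s that by simp
        then show ?thesis using norm_triangle_ineq2[of "f u" "f t"] by (simp add: dist_norm)
      qed (use C in \<open>simp add: le_max_iff_disj\<close>)
      then show ?thesis by blast
    qed auto
  qed
  then show ?thesis by blast
qed

text \<open>On disjoint clopen neighbourhoods of the points of F, the function is the constant that
  turns the mass at the point into its absolute value. A finite set G carries all but \<sigma> - c
  of the mass and the neighbourhoods avoid G - F, so the other points disturb the total by less than
  \<sigma> - c. The family m is not tied to a functional, so this is available inside the proof of
  the representation.\<close>

lemma ex_norming_function:
  fixes m :: "'i ordinal \<Rightarrow> 'k::real_normed_field"
  assumes m: "m abs_summable_on {..\<beta>}" and U: "open U" and F: "finite F" "F \<subseteq> U \<inter> {..\<beta>}"
    and c: "c < (\<Sum>t\<in>F. norm (m t))"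
  shows "\<exists>f. continuous_on UNIV f \<and> (\<forall>u. norm (f u) \<le> 1) \<and> (\<forall>u. u \<notin> U \<inter> {..\<beta>} \<longrightarrow> f u = 0) \<and>
    (\<forall>S. ((\<lambda>t. m t * f t) has_sum S) {..\<beta>} \<longrightarrow> c < norm S)"
proof -
  define \<sigma> where "\<sigma> = (\<Sum>t\<in>F. norm (m t))"
  obtain G0 where G0: "finite G0" "G0 \<subseteq> {..\<beta>}" "(\<Sum>\<^sub>\<infinity>x\<in>{..\<beta>} - G0. norm (m x)) < \<sigma> - c"
    using abs_summable_tail[OF m, of "\<sigma> - c"] c by (auto simp: \<sigma>_def)
  define G where "G = F \<union> G0"
  have G: "finite G" "G \<subseteq> {..\<beta>}" "F \<subseteq> G" using F G0 by (auto simp: G_def)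
  have "(\<Sum>\<^sub>\<infinity>x\<in>{..\<beta>} - G. norm (m x)) \<le> (\<Sum>\<^sub>\<infinity>x\<in>{..\<beta>} - G0. norm (m x))"
    using m G G0 by (intro infsum_mono2 summable_on_Diff) (auto simp: G_def)
  then have tail: "(\<Sum>\<^sub>\<infinity>x\<in>{..\<beta>} - G. norm (m x)) < \<sigma> - c" using G0(3) by simp
  have "\<exists>W. open W \<and> closed W \<and> t \<in> W \<and> W \<subseteq> U \<inter> {..t} \<and> W \<inter> G \<subseteq> {t} \<and> (\<forall>u\<in>W. {u..t} \<subseteq> W)"
    if "t \<in> F" for t
    using subsetD[OF F(2) that] by (intro ordinal_clopen_nbhd U G(1)) simp
  then obtain W where W: "\<And>t. t \<in> F \<Longrightarrow> open (W t) \<and> closed (W t) \<and> t \<in> W t \<and>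
      W t \<subseteq> U \<inter> {..t} \<and> W t \<inter> G \<subseteq> {t} \<and> (\<forall>u\<in>W t. {u..t} \<subseteq> W t)"
    by metis
  \<comment> \<open>From u \<le> t < t' the point t would lie in \<open>W t'\<close>, which meets G
    in t' only.\<close>
  have W_less: "\<not> t < t'" if "t \<in> F" "t' \<in> F" "u \<in> W t" "u \<in> W t'" for t t' u
  proof
    assume "t < t'"
    moreover have "u \<le> t" using W that by blast
    ultimately have "t \<in> W t'" using W[OF that(2)] that(4) by force
    then show False using W[OF that(2)] that(1) G(3) \<open>t < t'\<close> by blast
  qed
  then have disj: "t = t'" if "t \<in> F" "t' \<in> F" "u \<in> W t" "u \<in> W t'" for t t' u
    using that by (metis linorder_neqE)
  \<comment> \<open>The sign of m t, without conjugation. Where m t = 0, division by zero gives 0,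
    and both facts about s remain true.\<close>
  define s where "s t = of_real (norm (m t)) / m t" for t
  have s: "norm (s t) \<le> 1" "m t * s t = of_real (norm (m t))" for t
    by (auto simp: s_def norm_divide)
  define f where "f u = (\<Sum>t\<in>F. if u \<in> W t then s t else 0)" for u
  have f_in: "f u = s t" if "t \<in> F" "u \<in> W t" for t u
  proof -
    have "f u = (\<Sum>t'\<in>F. if t' = t then s t' else 0)"
      unfolding f_def using disj that by (intro sum.cong) auto
    then show ?thesis using F(1) that by simp
  qed
  have f_out: "f u = 0" if "\<And>t. t \<in> F \<Longrightarrow> u \<notin> W t" for u
    unfolding f_def using that by (intro sum.neutral) auto
  have cont: "continuous_on UNIV f"
    unfolding f_def using W by (intro continuous_on_sum continuous_on_if_clopen) auto
  have f1: "norm (f u) \<le> 1" for u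
    using f_in f_out s(1) by (metis norm_zero zero_le_one)
  have "f u = 0" if "u \<notin> U \<inter> {..\<beta>}" for u
  proof (rule f_out)
    fix t assume "t \<in> F"
    then have "W t \<subseteq> U" "W t \<subseteq> {..t}" "t \<le> \<beta>" using W F by auto
    then show "u \<notin> W t" using that by (auto intro: order_trans)
  qed
  moreover have "c < norm S" if S: "((\<lambda>t. m t * f t) has_sum S) {..\<beta>}" for S
  proof -
    have "((\<lambda>t. m t * f t) has_sum (\<Sum>t\<in>G. m t * f t)) G"
      using G by (intro has_sum_finite)
    moreover have "(\<Sum>t\<in>G. m t * f t) = (\<Sum>t\<in>F. m t * f t)"
    proof (rule sum.mono_neutral_right[OF G(1,3)], intro ballI)
      fix u assume u: "u \<in> G - F"
      have "f u = 0" by (rule f_out) (use u W in blast)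
      then show "m u * f u = 0" by simp
    qed
    moreover have "(\<Sum>t\<in>F. m t * f t) = of_real \<sigma>"
      unfolding \<sigma>_def of_real_sum using W by (intro sum.cong) (auto simp: f_in s)
    ultimately have rest: "((\<lambda>t. m t * f t) has_sum (S - of_real \<sigma>)) ({..\<beta>} - G)"
      using has_sum_Diff[OF S _ G(2)] by metis
    have le: "norm (m t * f t) \<le> norm (m t)" for t
      using f1[of t] by (simp add: norm_mult mult_left_le)
    have sm: "(\<lambda>t. norm (m t)) summable_on {..\<beta>} - G"
      using m G by (intro summable_on_Diff) auto
    then have sm': "(\<lambda>t. norm (m t * f t)) summable_on {..\<beta>} - G"
      by (rule Infinite_Sum.abs_summable_on_comparison_test) (use le in simp)
    then have "norm (S - of_real \<sigma>) \<le> (\<Sum>\<^sub>\<infinity>t\<in>{..\<beta>} - G. norm (m t * f t))"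
      using norm_has_sum_bound[OF has_sum_infsum[OF sm'] rest] by simp
    also have "\<dots> \<le> (\<Sum>\<^sub>\<infinity>x\<in>{..\<beta>} - G. norm (m x))"
      by (rule infsum_mono[OF sm' sm le])
    finally have "norm (S - of_real \<sigma>) < \<sigma> - c" using tail by simp
    moreover have "\<sigma> \<le> norm S + norm (S - of_real \<sigma>)"
      using norm_triangle_ineq3[of S "of_real \<sigma> :: 'k"] norm_triangle_ineq2[of "of_real \<sigma> :: 'k" S]
      by (simp add: norm_minus_commute)
    ultimately show ?thesis by simp
  qed
  ultimately show ?thesis using cont f1 by blast
qed

section \<open>Point masses of a functional\<close>

declare infsum_cong [fundef_cong]

text \<open>If D t is the value of a functional at the indicator of [0, t], this is what is left for
  t itself after all earlier points have received their share, also at limits. As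
  \<open>infsum\<close> is total, the recursion makes sense before any summability is known; the
  congruence rule restricts the recursive calls to s < t for the termination proof.\<close>

function mass :: "('i ordinal \<Rightarrow> 'k) \<Rightarrow> 'i ordinal \<Rightarrow> 'k::{comm_monoid_add, minus, t2_space}" where
  "mass D t = D t - (\<Sum>\<^sub>\<infinity>s\<in>{..<t}. mass D s)"
  by pat_completeness auto
termination
  by (relation "inv_image {(x, y). x < y} (\<lambda>(D, t). t)") (auto intro!: wf_inv_image wf)

declare mass.simps [simp del]

lemma abs_summable_mult_bounded:
  fixes m g :: "'a \<Rightarrow> 'k::real_normed_field"
  assumes "m abs_summable_on A" "\<And>t. t \<in> A \<Longrightarrow> norm (g t) \<le> C"
  shows "(\<lambda>t. m t * g t) abs_summable_on A"
proof -
  have "(\<lambda>t. of_real C * m t) abs_summable_on A"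
    using assms(1) by (simp add: norm_mult summable_on_cmult_right)
  moreover have "norm (m t * g t) \<le> norm (of_real C * m t)" if "t \<in> A" for t
  proof -
    have "norm (g t) \<le> \<bar>C\<bar>" using assms(2)[OF that] by simp
    then show ?thesis by (simp add: norm_mult mult.commute[of "norm (m t)"] mult_right_mono)
  qed
  ultimately show ?thesis by (rule Infinite_Sum.abs_summable_on_comparison_test)
qed

lemma has_sum_norm_le:
  fixes m g :: "'a \<Rightarrow> 'k::real_normed_field"
  assumes m: "m abs_summable_on A" and S: "((\<lambda>t. m t * g t) has_sum S) A"
    and g: "\<And>t. t \<in> A \<Longrightarrow> norm (g t) \<le> C"
  shows "norm S \<le> C * (\<Sum>\<^sub>\<infinity>t\<in>A. norm (m t))"
proof -
  have sm: "(\<lambda>t. norm (m t * g t)) summable_on A"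
    using abs_summable_mult_bounded[OF m g] by simp
  have "norm S \<le> (\<Sum>\<^sub>\<infinity>t\<in>A. norm (m t * g t))"
    by (rule norm_has_sum_bound[OF has_sum_infsum[OF sm] S])
  also have "\<dots> \<le> (\<Sum>\<^sub>\<infinity>t\<in>A. C * norm (m t))"
    using g by (intro infsum_mono sm summable_on_cmult_right m)
      (simp add: norm_mult mult.commute[of "norm (m _)"] mult_right_mono)
  also have "\<dots> = C * (\<Sum>\<^sub>\<infinity>t\<in>A. norm (m t))" using m by (intro infsum_cmult_right) simp
  finally show ?thesis .
qed

lemma C_space_simps [simp]:
  "vectors (C_space K) = {f \<in> extensional K. continuous_on K f}"
  "vadd (C_space K) f g = (\<lambda>x\<in>K. f x + g x)"
  "vscale (C_space K) c f = (\<lambda>x\<in>K. c * f x)"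
  "vnorm (C_space K) f = (SUP x\<in>K. norm (f x))"
  by (simp_all add: C_space_def)

lemma vnorm_C_space_le:
  fixes f :: "'i ordinal \<Rightarrow> 'k::real_normed_field"
  assumes "\<And>t. t \<le> \<alpha> \<Longrightarrow> norm (f t) \<le> e"
  shows "vnorm (C_space {..\<alpha>}) f \<le> e"
  using assms by (auto intro!: cSUP_least)

lemma norm_le_vnorm_C_space:
  fixes f :: "'i ordinal \<Rightarrow> 'k::real_normed_field"
  assumes "f \<in> vectors (C_space {..\<alpha>})" "t \<le> \<alpha>"
  shows "norm (f t) \<le> vnorm (C_space {..\<alpha>}) f"
proof -
  obtain C where "\<forall>t\<le>\<alpha>. norm (f t) \<le> C"
    using bounded_continuous_ordinal[of \<alpha> f] assms(1) by auto
  then have "bdd_above ((\<lambda>x. norm (f x)) ` {..\<alpha>})" by (intro bdd_aboveI2) auto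
  then show ?thesis using assms(2) by (auto intro: cSUP_upper)
qed

lemma restrict_in_vectors: "continuous_on K f \<Longrightarrow> restrict f K \<in> vectors (C_space K)"
  using continuous_on_cong[of K K "restrict f K" f] by auto

lemma restrict_vectors_split:
  fixes f :: "'i ordinal \<Rightarrow> 'k::real_normed_field"
  assumes "f \<in> vectors (C_space {..\<alpha>})"
  shows "(\<lambda>u\<in>{..\<alpha>}. if u \<le> s then f u else 0) \<in> vectors (C_space {..\<alpha>})"
    and "(\<lambda>u\<in>{..\<alpha>}. if u \<le> s then 0 else f u) \<in> vectors (C_space {..\<alpha>})"
proof -
  have "continuous_on {..\<alpha>} (\<lambda>u. (if u \<in> {..s} then c else d) * f u)" for c d :: 'k
    using assms by (intro continuous_on_mult continuous_on_subset[OF continuous_on_if_clopen])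
      (auto simp: open_atMost_ordinal)
  from this[of 1 0] this[of 0 1]
  have "continuous_on {..\<alpha>} (\<lambda>u. if u \<le> s then f u else 0)"
    and "continuous_on {..\<alpha>} (\<lambda>u. if u \<le> s then 0 else f u)"
    by (simp_all add: if_distrib[of "\<lambda>x. x * _"] cong: if_cong)
  then show "(\<lambda>u\<in>{..\<alpha>}. if u \<le> s then f u else 0) \<in> vectors (C_space {..\<alpha>})"
    and "(\<lambda>u\<in>{..\<alpha>}. if u \<le> s then 0 else f u) \<in> vectors (C_space {..\<alpha>})"
    by (blast intro: restrict_in_vectors)+
qed

definition fmass :: "'i ordinal \<Rightarrow> (('i ordinal \<Rightarrow> 'k::{real_normed_field, heine_borel}) \<Rightarrow> 'k) \<Rightarrow> 'i ordinal \<Rightarrow> 'k"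
  where "fmass \<alpha> \<phi> = mass (\<lambda>s. \<phi> (\<lambda>u\<in>{..\<alpha>}. if u \<le> s then 1 else 0))"

text \<open>The Riesz representation, by induction on the end \<beta> of the support. Bound and
  representation have to be proved together: the bound makes the sums over [0, \<beta>) converge,
  and the representation up to \<beta> yields, through \<open>ex_norming_function\<close>, the bound
  up to \<beta>.\<close>

lemma
  fixes \<phi> :: "('i ordinal \<Rightarrow> 'k::{real_normed_field, heine_borel}) \<Rightarrow> 'k"
  assumes \<phi>: "\<phi> \<in> dual (C_space {..\<alpha>})"
  shows abs_summable_fmass: "fmass \<alpha> \<phi> abs_summable_on {..\<alpha>}"
    and has_sum_fmass: "f \<in> vectors (C_space {..\<alpha>}) \<Longrightarrow> ((\<lambda>t. fmass \<alpha> \<phi> t * f t) has_sum \<phi> f) {..\<alpha>}"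
proof -
  let ?X = "C_space {..\<alpha>} :: ('k, 'i ordinal \<Rightarrow> 'k) nspace"
  define M where "M = fmass \<alpha> \<phi>"
  define ind where "ind s = (\<lambda>u\<in>{..\<alpha>}. if u \<le> s then 1 else (0 :: 'k))" for s
  have ind: "ind s \<in> vectors ?X" for s
    unfolding ind_def using continuous_on_if_clopen[of "{..s}" "1 :: 'k" 0]
    by (intro restrict_in_vectors) (auto simp: open_atMost_ordinal intro: continuous_on_subset)
  have M_eq: "M t = \<phi> (ind t) - infsum M {..<t}" for t
    unfolding M_def fmass_def ind_def by (rule mass.simps)
  have add: "\<phi> (vadd ?X u v) = \<phi> u + \<phi> v" if "u \<in> vectors ?X" "v \<in> vectors ?X" for u v
    using \<phi> that unfolding dual_def by blast
  have scale: "\<phi> (vscale ?X c u) = c * \<phi> u" if "u \<in> vectors ?X" for c u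
    using \<phi> that unfolding dual_def by blast
  obtain C0 where C0: "\<And>u. u \<in> vectors ?X \<Longrightarrow> norm (\<phi> u) \<le> C0 * vnorm ?X u"
    using \<phi> unfolding dual_def by blast
  define C where "C = \<bar>C0\<bar>"
  have C: "norm (\<phi> u) \<le> C * e" if u: "u \<in> vectors ?X" "\<And>t. t \<le> \<alpha> \<Longrightarrow> norm (u t) \<le> e" for u e
  proof -
    have "0 \<le> vnorm ?X u"
      using norm_le_vnorm_C_space[OF u(1), of \<alpha>] by (meson norm_ge_zero order_refl order_trans)
    then have "C0 * vnorm ?X u \<le> C * vnorm ?X u" unfolding C_def by (intro mult_right_mono) auto
    moreover have "C * vnorm ?X u \<le> C * e"
      unfolding C_def using vnorm_C_space_le[of \<alpha> u e] u(2) by (intro mult_left_mono) auto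
    ultimately show ?thesis using C0[OF u(1)] by linarith
  qed
  have C_pos: "0 \<le> C" by (simp add: C_def)
  define R where "R \<beta> \<longleftrightarrow> (\<forall>F. finite F \<and> F \<subseteq> {..\<beta>} \<longrightarrow> (\<Sum>t\<in>F. norm (M t)) \<le> C) \<and>
    (\<forall>f\<in>vectors ?X. (\<forall>t\<le>\<alpha>. \<beta> < t \<longrightarrow> f t = 0) \<longrightarrow> ((\<lambda>t. M t * f t) has_sum \<phi> f) {..\<beta>})" for \<beta>
  have "R \<beta>" if "\<beta> \<le> \<alpha>" for \<beta>
    using that
  proof (induction \<beta> rule: less_induct)
    case (less \<beta>)
    then have IH: "R \<beta>'" if "\<beta>' < \<beta>" for \<beta>' using that by (meson order_less_imp_le order_trans)
    have fin: "(\<Sum>t\<in>F. norm (M t)) \<le> C" if F: "finite F" "F \<subseteq> {..<\<beta>}" for F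
    proof (cases "F = {}")
      case False
      then have "Max F < \<beta>" "F \<subseteq> {..Max F}" using F by auto
      then show ?thesis using IH[of "Max F"] F unfolding R_def by blast
    qed (simp add: C_pos)
    have sm: "M abs_summable_on {..<\<beta>}"
      by (rule nonneg_bdd_above_summable_on) (use fin in \<open>auto intro!: bdd_aboveI2[where M = C]\<close>)
    have le_C: "(\<Sum>\<^sub>\<infinity>t\<in>{..<\<beta>}. norm (M t)) \<le> C"
      using sm fin by (intro infsum_le_finite_sums)
    \<comment> \<open>A function vanishing from \<beta> on is, by continuity at \<beta>, its
      restriction to some [0, s] plus a remainder of norm at most e. The induction hypothesis covers
      the restriction; the remainder changes \<phi> g and the sum by at most e * C each.\<close>
    have main: "((\<lambda>t. M t * g t) has_sum \<phi> g) {..<\<beta>}"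
      if g: "g \<in> vectors ?X" "\<And>t. t \<le> \<alpha> \<Longrightarrow> \<beta> \<le> t \<Longrightarrow> g t = 0" for g
    proof -
      have g_cont: "continuous_on {..\<alpha>} g" using g(1) by simp
      obtain D where D: "\<forall>t\<le>\<alpha>. norm (g t) \<le> D"
        using bounded_continuous_ordinal[OF g_cont] by blast
      have "(\<lambda>t. M t * g t) abs_summable_on {..<\<beta>}"
        using D less.prems by (intro abs_summable_mult_bounded[OF sm, where C = D]) auto
      then have "(\<lambda>t. M t * g t) summable_on {..<\<beta>}" by (rule abs_summable_summable_heine_borel)
      then obtain S where S: "((\<lambda>t. M t * g t) has_sum S) {..<\<beta>}" unfolding summable_on_def by blast
      have le: "norm (S - \<phi> g) \<le> e * (C + C)" if e: "0 < e" for e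
      proof (cases "\<beta> = 0")
        case True
        \<comment> \<open>With no point before \<beta> the function g vanishes, and homogeneity with
          factor 0 gives \<phi> g = 0.\<close>
        have "vscale ?X 0 g = g"
        proof
          fix t show "vscale ?X 0 g t = g t"
            using g(1) g(2)[of t] True by (auto simp: extensional_def)
        qed
        then have "\<phi> g = 0" using scale[OF g(1), of 0] by simp
        moreover have "S = 0" using has_sum_unique[OF S, of 0] True by simp
        ultimately show ?thesis using e C_pos by simp
      next
        case False
        then have "0 < \<beta>" by (simp add: order_less_le)
        then obtain s where s: "s < \<beta>" "\<forall>u\<in>{s<..\<beta>}. dist (g u) (g \<beta>) < e"
          using continuous_on_ordinal_left[OF g_cont less.prems _ e] by blast
        have small: "norm (g u) \<le> e" if "s < u" "u \<le> \<alpha>" for u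
        proof (cases "u \<le> \<beta>")
          case True
          then have "dist (g u) (g \<beta>) < e" using s(2) that by simp
          then show ?thesis using g(2)[OF less.prems] by simp
        next
          case False
          then have "\<beta> \<le> u" by simp
          then show ?thesis using g(2)[OF that(2)] e by simp
        qed
        define g1 where "g1 = (\<lambda>u\<in>{..\<alpha>}. if u \<le> s then g u else 0)"
        define g2 where "g2 = (\<lambda>u\<in>{..\<alpha>}. if u \<le> s then 0 else g u)"
        have g12: "g1 \<in> vectors ?X" "g2 \<in> vectors ?X"
          unfolding g1_def g2_def using restrict_vectors_split[OF g(1)] by blast+
        have "g = vadd ?X g1 g2"
        proof
          fix t show "g t = vadd ?X g1 g2 t"
            using g(1) by (auto simp: g1_def g2_def extensional_def)
        qed
        then have "\<phi> g = \<phi> g1 + \<phi> g2" using add[OF g12] by simp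
        moreover have "norm (\<phi> g2) \<le> C * e"
          using small e by (intro C g12) (auto simp: g2_def)
        ultimately have 1: "norm (\<phi> g1 - \<phi> g) \<le> C * e" by simp
        have "\<forall>t\<le>\<alpha>. s < t \<longrightarrow> g1 t = 0" by (auto simp: g1_def)
        then have "((\<lambda>t. M t * g1 t) has_sum \<phi> g1) {..s}"
          using IH[OF s(1)] g12(1) unfolding R_def by blast
        moreover have "M t * g1 t = M t * g t" if "t \<in> {..s}" for t
        proof -
          have "t \<le> \<alpha>" using that s(1) less.prems by (meson atMost_iff order_less_imp_le order_trans)
          then show ?thesis using that by (simp add: g1_def)
        qed
        ultimately have "((\<lambda>t. M t * g t) has_sum \<phi> g1) {..s}"
          using has_sum_cong[of "{..s}" "\<lambda>t. M t * g1 t" "\<lambda>t. M t * g t" "\<phi> g1"] by blast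
        moreover have sub: "{..s} \<subseteq> {..<\<beta>}" using s(1) by auto
        ultimately have "((\<lambda>t. M t * g t) has_sum (S - \<phi> g1)) ({..<\<beta>} - {..s})"
          using has_sum_Diff[OF S] by blast
        moreover have sm': "M abs_summable_on ({..<\<beta>} - {..s})"
          by (rule summable_on_subset_banach[OF sm]) auto
        moreover have "norm (g t) \<le> e" if "t \<in> {..<\<beta>} - {..s}" for t
          using that less.prems by (intro small) (auto intro: order_trans[OF order_less_imp_le])
        ultimately have "norm (S - \<phi> g1) \<le> e * (\<Sum>\<^sub>\<infinity>t\<in>{..<\<beta>} - {..s}. norm (M t))"
          by (intro has_sum_norm_le)
        moreover have "(\<Sum>\<^sub>\<infinity>t\<in>{..<\<beta>} - {..s}. norm (M t)) \<le> C"
          using infsum_mono2[OF sm' sm] le_C by auto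
        then have "e * (\<Sum>\<^sub>\<infinity>t\<in>{..<\<beta>} - {..s}. norm (M t)) \<le> e * C"
          using e by (intro mult_left_mono) auto
        ultimately have "norm (S - \<phi> g1) \<le> e * C" by linarith
        then show ?thesis
          using 1 norm_triangle_ineq[of "S - \<phi> g1" "\<phi> g1 - \<phi> g"] by (simp add: algebra_simps)
      qed
      have "norm (S - \<phi> g) \<le> 0"
      proof (rule field_le_epsilon)
        fix e :: real assume "0 < e"
        \<comment> \<open>The summand 1 in the denominator covers C = 0.\<close>
        then have "norm (S - \<phi> g) \<le> e / (2 * C + 1) * (C + C)"
          using C_pos by (intro le) (auto intro!: divide_pos_pos)
        also have "\<dots> \<le> e" using C_pos \<open>0 < e\<close> by (simp add: field_simps)
        finally show "norm (S - \<phi> g) \<le> 0 + e" by simp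
      qed
      then show ?thesis using S by simp
    qed
    have smM: "(M has_sum infsum M {..<\<beta>}) {..<\<beta>}"
      using abs_summable_summable_heine_borel[OF sm] by simp
    have ins: "{..\<beta>} = insert \<beta> {..<\<beta>}" by auto
    have sums: "((\<lambda>t. M t * f t) has_sum \<phi> f) {..\<beta>}"
      if f: "f \<in> vectors ?X" "\<forall>t\<le>\<alpha>. \<beta> < t \<longrightarrow> f t = 0" for f
    proof -
      \<comment> \<open>Subtracting f \<beta> times the indicator of [0, \<beta>] makes the function
        vanish from \<beta> on, so \<open>main\<close> applies; the recursion \<open>M_eq\<close> at
        \<beta> returns what was subtracted as the summand for \<beta>.\<close>
      define g where "g = vadd ?X f (vscale ?X (- f \<beta>) (ind \<beta>))"
      have v: "vscale ?X (- f \<beta>) (ind \<beta>) \<in> vectors ?X"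
        using ind[of \<beta>] unfolding C_space_simps(3)
        by (intro restrict_in_vectors continuous_on_mult continuous_on_const) simp
      have "g \<in> vectors ?X"
        using f(1) v unfolding g_def C_space_simps(2)
        by (intro restrict_in_vectors continuous_on_add) simp_all
      moreover have "g t = 0" if "t \<le> \<alpha>" "\<beta> \<le> t" for t
        using that f(2) by (cases "t = \<beta>") (auto simp: g_def ind_def)
      ultimately have sum_g: "((\<lambda>t. M t * g t) has_sum \<phi> g) {..<\<beta>}" by (rule main)
      have "\<phi> g = \<phi> f - f \<beta> * \<phi> (ind \<beta>)"
        unfolding g_def add[OF f(1) v] scale[OF ind] by simp
      moreover have "M t * g t = M t * f t + M t * (- f \<beta>)" if "t \<in> {..<\<beta>}" for t
        using that less.prems by (auto simp: g_def ind_def algebra_simps)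
      ultimately have "((\<lambda>t. M t * f t + M t * (- f \<beta>)) has_sum (\<phi> f - f \<beta> * \<phi> (ind \<beta>))) {..<\<beta>}"
        using sum_g has_sum_cong[of "{..<\<beta>}" "\<lambda>t. M t * g t" "\<lambda>t. M t * f t + M t * (- f \<beta>)" "\<phi> g"]
        by simp
      from has_sum_add[OF this has_sum_cmult_left[OF smM, of "f \<beta>"]]
      have "((\<lambda>t. M t * f t) has_sum (\<phi> f - f \<beta> * \<phi> (ind \<beta>) + infsum M {..<\<beta>} * f \<beta>)) {..<\<beta>}"
        by simp
      from has_sum_insert[OF _ this, of \<beta>] show ?thesis
        unfolding ins by (simp add: M_eq[of \<beta>] algebra_simps)
    qed
    have sm_le: "M abs_summable_on {..\<beta>}" using sm by (simp add: ins summable_on_insert_iff)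
    have "(\<Sum>t\<in>F. norm (M t)) \<le> C" if F: "finite F" "F \<subseteq> {..\<beta>}" for F
    proof (rule ccontr)
      assume "\<not> ?thesis"
      then have "C < (\<Sum>t\<in>F. norm (M t))" by simp
      then obtain f where f: "continuous_on UNIV f" "\<forall>u. norm (f u) \<le> 1"
        "\<forall>u. u \<notin> {..\<beta>} \<inter> {..\<beta>} \<longrightarrow> f u = 0"
        "\<forall>S. ((\<lambda>t. M t * f t) has_sum S) {..\<beta>} \<longrightarrow> C < norm S"
        using ex_norming_function[OF sm_le open_atMost_ordinal, of F \<beta> C] F by auto
      define f' where "f' = restrict f {..\<alpha>}"
      have f': "f' \<in> vectors ?X" unfolding f'_def
        by (rule restrict_in_vectors[OF continuous_on_subset[OF f(1)]]) simp
      have "((\<lambda>t. M t * f' t) has_sum \<phi> f') {..\<beta>}"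
        using f(3) by (intro sums f') (auto simp: f'_def)
      moreover have "M t * f' t = M t * f t" if "t \<in> {..\<beta>}" for t
        using that less.prems by (auto simp: f'_def intro: order_trans)
      ultimately have "((\<lambda>t. M t * f t) has_sum \<phi> f') {..\<beta>}"
        using has_sum_cong[of "{..\<beta>}" "\<lambda>t. M t * f' t" "\<lambda>t. M t * f t" "\<phi> f'"] by blast
      then have "C < norm (\<phi> f')" using f(4) by blast
      moreover have "norm (\<phi> f') \<le> C * 1" using f(2) by (intro C f') (auto simp: f'_def)
      ultimately show False by simp
    qed
    then show ?case using sums unfolding R_def by blast
  qed
  then have R: "R \<alpha>" by simp
  show "fmass \<alpha> \<phi> abs_summable_on {..\<alpha>}"
    unfolding M_def[symmetric]
    by (rule nonneg_bdd_above_summable_on) (use R in \<open>auto simp: R_def intro!: bdd_aboveI2[where M = C]\<close>)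
  show "((\<lambda>t. fmass \<alpha> \<phi> t * f t) has_sum \<phi> f) {..\<alpha>}" if "f \<in> vectors ?X"
    using R that unfolding R_def M_def[symmetric] by force
qed

section \<open>Variation\<close>

lemma topspace_weak_star: "topspace (weak_star X) = dual X"
  by (auto simp: weak_star_def dual_def extensional_def PiE_def)

lemma continuous_map_weak_star_eval:
  "u \<in> vectors X \<Longrightarrow> continuous_map (weak_star X) euclidean (\<lambda>\<phi>. \<phi> u)"
  unfolding weak_star_def
  by (intro continuous_map_from_subtopology continuous_map_product_projection)

lemma openin_weak_star_eval:
  assumes "f \<in> vectors X" "open G"
  shows "openin (weak_star X) {\<phi> \<in> dual X. \<phi> f \<in> G}"
proof -
  from openin_continuous_map_preimage[OF continuous_map_weak_star_eval[OF assms(1)], of G] show ?thesis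
    using assms(2) by (simp add: topspace_weak_star)
qed

definition tvar :: "'i ordinal \<Rightarrow> (('i ordinal \<Rightarrow> 'k::{real_normed_field, heine_borel}) \<Rightarrow> 'k) \<Rightarrow> 'i ordinal set \<Rightarrow> real"
  where "tvar \<alpha> \<phi> E = (\<Sum>\<^sub>\<infinity>t\<in>E \<inter> {..\<alpha>}. norm (fmass \<alpha> \<phi> t))"

text \<open>The variation of the difference on E, formed from the two families of masses: the
  pointwise difference of two functionals need not be \<open>undefined\<close> off the carrier and
  so need not belong to \<open>dual\<close>.\<close>

definition mass_dist ::
    "'i ordinal \<Rightarrow> 'i ordinal set \<Rightarrow> (('i ordinal \<Rightarrow> 'k::{real_normed_field, heine_borel}) \<Rightarrow> 'k) \<Rightarrow> (('i ordinal \<Rightarrow> 'k) \<Rightarrow> 'k) \<Rightarrow> real"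
  where "mass_dist \<alpha> E \<phi> \<psi> = (\<Sum>\<^sub>\<infinity>t\<in>E \<inter> {..\<alpha>}. norm (fmass \<alpha> \<phi> t - fmass \<alpha> \<psi> t))"

context
  fixes \<alpha> :: "'i ordinal" and X :: "('k::{real_normed_field, heine_borel}, 'i ordinal \<Rightarrow> 'k) nspace"
  defines "X \<equiv> C_space {..\<alpha>}"
begin

lemma abs_summable_fmass_on:
  assumes "\<phi> \<in> dual X" "A \<subseteq> {..\<alpha>}"
  shows "fmass \<alpha> \<phi> abs_summable_on A"
  using summable_on_subset_banach[OF abs_summable_fmass[OF assms(1)[unfolded X_def]] assms(2)] .

lemma abs_summable_fmass_diff:
  assumes "\<phi> \<in> dual X" "\<psi> \<in> dual X" "A \<subseteq> {..\<alpha>}"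
  shows "(\<lambda>t. fmass \<alpha> \<phi> t - fmass \<alpha> \<psi> t) abs_summable_on A"
proof (rule Infinite_Sum.abs_summable_on_comparison_test)
  show "(\<lambda>t. norm (fmass \<alpha> \<phi> t) + norm (fmass \<alpha> \<psi> t)) abs_summable_on A"
    using summable_on_add[OF abs_summable_fmass_on[OF assms(1,3)] abs_summable_fmass_on[OF assms(2,3)]] by simp
  show "norm (fmass \<alpha> \<phi> t - fmass \<alpha> \<psi> t) \<le> norm (norm (fmass \<alpha> \<phi> t) + norm (fmass \<alpha> \<psi> t))" for t
    using norm_triangle_ineq4[of "fmass \<alpha> \<phi> t" "fmass \<alpha> \<psi> t"] by simp
qed

lemma tvar_nonneg: "0 \<le> tvar \<alpha> \<phi> E"
  unfolding tvar_def by (rule infsum_nonneg) simp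

lemma tvar_mono: "\<phi> \<in> dual X \<Longrightarrow> E \<inter> {..\<alpha>} \<subseteq> E' \<Longrightarrow> tvar \<alpha> \<phi> E \<le> tvar \<alpha> \<phi> E'"
  unfolding tvar_def by (intro infsum_mono2 abs_summable_fmass_on) auto

lemma tvar_split:
  assumes "\<phi> \<in> dual X"
  shows "tvar \<alpha> \<phi> E = tvar \<alpha> \<phi> (E \<inter> A) + tvar \<alpha> \<phi> (E - A)"
proof -
  have "E \<inter> {..\<alpha>} = (E \<inter> A \<inter> {..\<alpha>}) \<union> ((E - A) \<inter> {..\<alpha>})" by auto
  then show ?thesis unfolding tvar_def
    by (simp only:) (intro infsum_Un_disjoint abs_summable_fmass_on assms; auto)
qed

lemma tvar_finite: "finite F \<Longrightarrow> F \<subseteq> {..\<alpha>} \<Longrightarrow> tvar \<alpha> \<phi> F = (\<Sum>t\<in>F. norm (fmass \<alpha> \<phi> t))"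
  by (simp add: tvar_def Int_absorb2)

lemma mass_dist_split:
  assumes "\<phi> \<in> dual X" "\<psi> \<in> dual X"
  shows "mass_dist \<alpha> E \<phi> \<psi> = mass_dist \<alpha> (E \<inter> A) \<phi> \<psi> + mass_dist \<alpha> (E - A) \<phi> \<psi>"
proof -
  have "E \<inter> {..\<alpha>} = (E \<inter> A \<inter> {..\<alpha>}) \<union> ((E - A) \<inter> {..\<alpha>})" by auto
  then show ?thesis unfolding mass_dist_def
    by (simp only:) (intro infsum_Un_disjoint abs_summable_fmass_diff assms; auto)
qed

lemma mass_dist_mono:
  "\<phi> \<in> dual X \<Longrightarrow> \<psi> \<in> dual X \<Longrightarrow> E \<inter> {..\<alpha>} \<subseteq> E' \<Longrightarrow> mass_dist \<alpha> E \<phi> \<psi> \<le> mass_dist \<alpha> E' \<phi> \<psi>"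
  unfolding mass_dist_def by (intro infsum_mono2 abs_summable_fmass_diff) auto

lemma mass_dist_le_tvar:
  assumes "\<phi> \<in> dual X" "\<psi> \<in> dual X"
  shows "mass_dist \<alpha> E \<phi> \<psi> \<le> tvar \<alpha> \<phi> E + tvar \<alpha> \<psi> E"
proof -
  have "mass_dist \<alpha> E \<phi> \<psi> \<le> (\<Sum>\<^sub>\<infinity>t\<in>E \<inter> {..\<alpha>}. norm (fmass \<alpha> \<phi> t) + norm (fmass \<alpha> \<psi> t))"
    unfolding mass_dist_def
    by (intro infsum_mono abs_summable_fmass_diff summable_on_add abs_summable_fmass_on assms norm_triangle_ineq4)
      auto
  also have "\<dots> = tvar \<alpha> \<phi> E + tvar \<alpha> \<psi> E"
    unfolding tvar_def by (intro infsum_add abs_summable_fmass_on assms) auto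
  finally show ?thesis .
qed

text \<open>Passing from E to A costs only the variations left over on E - A. In the upper bound A
  is a finite set of points or a union of shorter bands.\<close>

lemma mass_dist_le_part:
  assumes "\<phi> \<in> dual X" "\<psi> \<in> dual X"
  shows "mass_dist \<alpha> E \<phi> \<psi> \<le> mass_dist \<alpha> A \<phi> \<psi> + tvar \<alpha> \<phi> (E - A) + tvar \<alpha> \<psi> (E - A)"
proof -
  have "mass_dist \<alpha> (E \<inter> A) \<phi> \<psi> \<le> mass_dist \<alpha> A \<phi> \<psi>" by (rule mass_dist_mono[OF assms]) blast
  then show ?thesis
    using mass_dist_split[OF assms, of E A] mass_dist_le_tvar[OF assms, of "E - A"] by linarith
qed

lemma mass_dist_commute: "mass_dist \<alpha> E \<phi> \<psi> = mass_dist \<alpha> E \<psi> \<phi>"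
  by (simp add: mass_dist_def norm_minus_commute)

lemma mass_dist_triangle:
  assumes "\<phi> \<in> dual X" "\<psi> \<in> dual X" "\<eta> \<in> dual X"
  shows "mass_dist \<alpha> E \<phi> \<psi> \<le> mass_dist \<alpha> E \<phi> \<eta> + mass_dist \<alpha> E \<eta> \<psi>"
proof -
  have "norm (fmass \<alpha> \<phi> t - fmass \<alpha> \<psi> t)
      \<le> norm (fmass \<alpha> \<phi> t - fmass \<alpha> \<eta> t) + norm (fmass \<alpha> \<eta> t - fmass \<alpha> \<psi> t)" for t
    using norm_triangle_ineq[of "fmass \<alpha> \<phi> t - fmass \<alpha> \<eta> t" "fmass \<alpha> \<eta> t - fmass \<alpha> \<psi> t"] by simp
  then have "mass_dist \<alpha> E \<phi> \<psi> \<le> (\<Sum>\<^sub>\<infinity>t\<in>E \<inter> {..\<alpha>}. norm (fmass \<alpha> \<phi> t - fmass \<alpha> \<eta> t)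
      + norm (fmass \<alpha> \<eta> t - fmass \<alpha> \<psi> t))"
    unfolding mass_dist_def
    by (intro infsum_mono abs_summable_fmass_diff summable_on_add assms) auto
  also have "\<dots> = mass_dist \<alpha> E \<phi> \<eta> + mass_dist \<alpha> E \<eta> \<psi>"
    unfolding mass_dist_def by (intro infsum_add abs_summable_fmass_diff assms) auto
  finally show ?thesis .
qed

lemma mass_dist_UN_le:
  assumes "\<phi> \<in> dual X" "\<psi> \<in> dual X" "finite S"
  shows "mass_dist \<alpha> (\<Union>q\<in>S. E q) \<phi> \<psi> \<le> (\<Sum>q\<in>S. mass_dist \<alpha> (E q) \<phi> \<psi>)"
  using assms(3)
proof induction
  case empty
  show ?case by (simp add: mass_dist_def)
next
  case (insert q S)
  have "mass_dist \<alpha> (\<Union>q\<in>insert q S. E q) \<phi> \<psi> \<le> mass_dist \<alpha> (E q) \<phi> \<psi> + mass_dist \<alpha> (\<Union>q\<in>S. E q) \<phi> \<psi>"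
    unfolding mass_dist_split[OF assms(1,2), of "\<Union>q\<in>insert q S. E q" "E q"]
    by (intro add_mono mass_dist_mono assms) auto
  then show ?case using insert by simp
qed

lemma tvar_UN_le:
  assumes "\<phi> \<in> dual X" "finite S"
  shows "tvar \<alpha> \<phi> (\<Union>q\<in>S. E q) \<le> (\<Sum>q\<in>S. tvar \<alpha> \<phi> (E q))"
  using assms(2)
proof induction
  case empty
  show ?case by (simp add: tvar_def)
next
  case (insert q S)
  have "tvar \<alpha> \<phi> (\<Union>q\<in>insert q S. E q) \<le> tvar \<alpha> \<phi> (E q) + tvar \<alpha> \<phi> (\<Union>q\<in>S. E q)"
    unfolding tvar_split[OF assms(1), of "\<Union>q\<in>insert q S. E q" "E q"]
    by (intro add_mono tvar_mono assms) auto
  then show ?case using insert by simp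
qed

lemma less_tvar_finite:
  assumes "\<phi> \<in> dual X" "c < tvar \<alpha> \<phi> E"
  shows "\<exists>F. finite F \<and> F \<subseteq> E \<inter> {..\<alpha>} \<and> c < (\<Sum>t\<in>F. norm (fmass \<alpha> \<phi> t))"
proof (rule ccontr)
  assume "\<not> ?thesis"
  then have "tvar \<alpha> \<phi> E \<le> c"
    unfolding tvar_def
    by (intro infsum_le_finite_sums abs_summable_fmass_on assms(1)) (auto simp: not_less)
  then show False using assms(2) by simp
qed

lemma ex_vector_norming:
  assumes "\<phi> \<in> dual X" "c < tvar \<alpha> \<phi> U" "open U"
  shows "\<exists>f\<in>vectors X. (\<forall>t\<le>\<alpha>. norm (f t) \<le> 1) \<and> (\<forall>t\<le>\<alpha>. t \<notin> U \<longrightarrow> f t = 0) \<and> c < norm (\<phi> f)"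
proof -
  obtain F where F: "finite F" "F \<subseteq> U \<inter> {..\<alpha>}" "c < (\<Sum>t\<in>F. norm (fmass \<alpha> \<phi> t))"
    using less_tvar_finite[OF assms(1,2)] by blast
  obtain f where f: "continuous_on UNIV f" "\<forall>u. norm (f u) \<le> 1" "\<forall>u. u \<notin> U \<inter> {..\<alpha>} \<longrightarrow> f u = 0"
    "\<forall>S. ((\<lambda>t. fmass \<alpha> \<phi> t * f t) has_sum S) {..\<alpha>} \<longrightarrow> c < norm S"
    using ex_norming_function[OF abs_summable_fmass_on[OF assms(1) order_refl] assms(3) F] by auto
  define f' where "f' = restrict f {..\<alpha>}"
  have f': "f' \<in> vectors X"
    unfolding f'_def X_def by (rule restrict_in_vectors[OF continuous_on_subset[OF f(1)]]) simp
  then have "((\<lambda>t. fmass \<alpha> \<phi> t * f' t) has_sum \<phi> f') {..\<alpha>}"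
    using has_sum_fmass[OF assms(1)[unfolded X_def]] by (simp add: X_def)
  then have "((\<lambda>t. fmass \<alpha> \<phi> t * f t) has_sum \<phi> f') {..\<alpha>}"
    using has_sum_cong[of "{..\<alpha>}" "\<lambda>t. fmass \<alpha> \<phi> t * f' t" "\<lambda>t. fmass \<alpha> \<phi> t * f t" "\<phi> f'"]
    by (simp add: f'_def)
  then have "c < norm (\<phi> f')" using f(4) by blast
  then show ?thesis using f' f(2,3) by (intro bexI[of _ f']) (auto simp: f'_def)
qed

lemma norm_le_dual_norm:
  assumes "\<phi> \<in> dual X" "u \<in> vectors X" "vnorm X u \<le> 1"
  shows "norm (\<phi> u) \<le> dual_norm X \<phi>"
proof -
  obtain C where C: "\<And>u. u \<in> vectors X \<Longrightarrow> norm (\<phi> u) \<le> C * vnorm X u"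
    using assms(1) unfolding dual_def by blast
  have "norm (\<phi> u) \<le> \<bar>C\<bar>" if "u \<in> vectors X" "vnorm X u \<le> 1" for u
  proof -
    have "0 \<le> vnorm X u"
      using norm_le_vnorm_C_space[of u \<alpha> \<alpha>] that(1) unfolding X_def by (meson norm_ge_zero order_refl order_trans)
    then have "C * vnorm X u \<le> \<bar>C\<bar> * 1" using that(2) by (intro mult_mono) auto
    then show ?thesis using C[OF that(1)] by simp
  qed
  then show ?thesis
    unfolding dual_norm_def using assms by (intro cSUP_upper bdd_aboveI2[where M = "\<bar>C\<bar>"]) auto
qed

lemma tvar_le_1:
  assumes "\<phi> \<in> dual_ball X"
  shows "tvar \<alpha> \<phi> E \<le> 1"
proof -
  have \<phi>: "\<phi> \<in> dual X" "dual_norm X \<phi> \<le> 1" using assms by (auto simp: dual_ball_def)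
  have "tvar \<alpha> \<phi> UNIV \<le> 1"
  proof (rule ccontr)
    assume "\<not> ?thesis"
    then obtain f where f: "f \<in> vectors X" "\<forall>t\<le>\<alpha>. norm (f t) \<le> 1" "1 < norm (\<phi> f)"
      using ex_vector_norming[OF \<phi>(1), of 1 UNIV] by auto
    then have "vnorm X f \<le> 1" using vnorm_C_space_le[of \<alpha> f 1] by (simp add: X_def)
    then show False using norm_le_dual_norm[OF \<phi>(1) f(1)] f(3) \<phi>(2) by linarith
  qed
  then show ?thesis using tvar_mono[OF \<phi>(1), of E UNIV] by simp
qed

text \<open>Pairs far apart in the dual norm are far apart in variation, so emptiness of iterates
  for the variation distance passes to the Szlenk iterates.\<close>

lemma dual_norm_diff_le_mass_dist:
  assumes "\<phi> \<in> dual X" "\<psi> \<in> dual X"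
  shows "dual_norm X (\<lambda>u. \<phi> u - \<psi> u) \<le> mass_dist \<alpha> UNIV \<phi> \<psi>"
  unfolding dual_norm_def
proof (rule cSUP_least)
  have "restrict (\<lambda>_. 0) {..\<alpha>} \<in> vectors X" unfolding X_def by (rule restrict_in_vectors) simp
  moreover have "vnorm X (restrict (\<lambda>_. 0) {..\<alpha>}) \<le> 1" unfolding X_def by (rule vnorm_C_space_le) simp
  ultimately show "{u \<in> vectors X. vnorm X u \<le> 1} \<noteq> {}" by blast
next
  fix u assume "u \<in> {u \<in> vectors X. vnorm X u \<le> 1}"
  then have u: "u \<in> vectors X" "vnorm X u \<le> 1" by auto
  have s: "((\<lambda>t. fmass \<alpha> \<eta> t * u t) has_sum \<eta> u) {..\<alpha>}" if "\<eta> \<in> dual X" for \<eta>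
    using has_sum_fmass[OF that[unfolded X_def]] u(1) by (simp add: X_def)
  have "((\<lambda>t. (fmass \<alpha> \<phi> t - fmass \<alpha> \<psi> t) * u t) has_sum (\<phi> u - \<psi> u)) {..\<alpha>}"
    using has_sum_add[OF s[OF assms(1)], of "\<lambda>t. - (fmass \<alpha> \<psi> t * u t)" "- \<psi> u"] s[OF assms(2)]
    by (simp add: has_sum_uminus left_diff_distrib)
  moreover have "norm (u t) \<le> 1" if "t \<in> {..\<alpha>}" for t
    using norm_le_vnorm_C_space[of u \<alpha> t] u that by (simp add: X_def)
  ultimately have "norm (\<phi> u - \<psi> u) \<le> 1 * (\<Sum>\<^sub>\<infinity>t\<in>{..\<alpha>}. norm (fmass \<alpha> \<phi> t - fmass \<alpha> \<psi> t))"
    by (intro has_sum_norm_le abs_summable_fmass_diff assms) auto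
  then show "norm (\<phi> u - \<psi> u) \<le> mass_dist \<alpha> UNIV \<phi> \<psi>" by (simp add: mass_dist_def)
qed

text \<open>A function bounded by 1, zero off U and nearly norming \<phi> there gives a lower bound
  for the variation of every \<psi>; evaluation at it is weak-* continuous. Openness of U provides a
  continuous such function.\<close>

lemma tvar_lower_semicontinuous:
  assumes \<phi>: "\<phi> \<in> dual X" and c: "c < tvar \<alpha> \<phi> U" and U: "open U"
  shows "\<exists>V. openin (weak_star X) V \<and> \<phi> \<in> V \<and> (\<forall>\<psi>\<in>V. c < tvar \<alpha> \<psi> U)"
proof -
  obtain f where f: "f \<in> vectors X" "\<forall>t\<le>\<alpha>. norm (f t) \<le> 1" "\<forall>t\<le>\<alpha>. t \<notin> U \<longrightarrow> f t = 0" "c < norm (\<phi> f)"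
    using ex_vector_norming[OF assms] by blast
  let ?V = "{\<psi> \<in> dual X. \<psi> f \<in> {x. c < norm x}}"
  have "c < tvar \<alpha> \<psi> U" if "\<psi> \<in> ?V" for \<psi>
  proof -
    have \<psi>: "\<psi> \<in> dual X" "c < norm (\<psi> f)" using that by auto
    have "((\<lambda>t. fmass \<alpha> \<psi> t * f t) has_sum \<psi> f) {..\<alpha>}"
      using has_sum_fmass[OF \<psi>(1)[unfolded X_def]] f(1) by (simp add: X_def)
    then have "((\<lambda>t. fmass \<alpha> \<psi> t * f t) has_sum \<psi> f) (U \<inter> {..\<alpha>})"
      by (rule has_sum_cong_neutral[THEN iffD1, rotated 3]) (use f(3) in auto)
    then have "norm (\<psi> f) \<le> 1 * (\<Sum>\<^sub>\<infinity>t\<in>U \<inter> {..\<alpha>}. norm (fmass \<alpha> \<psi> t))"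
      using f(2) by (intro has_sum_norm_le abs_summable_fmass_on \<psi>(1)) auto
    then show ?thesis using \<psi>(2) by (simp add: tvar_def)
  qed
  moreover have "open {x :: 'k. c < norm x}" by (intro open_Collect_less continuous_intros)
  then have "openin (weak_star X) ?V" by (rule openin_weak_star_eval[OF f(1)])
  ultimately show ?thesis using \<phi> f(4) by (intro exI[of _ ?V]) auto
qed

lemma has_sum_fmass_clopen:
  assumes "\<phi> \<in> dual X" "open W" "closed W"
  shows "(fmass \<alpha> \<phi> has_sum \<phi> (\<lambda>u\<in>{..\<alpha>}. if u \<in> W then 1 else 0)) (W \<inter> {..\<alpha>})"
    and "(\<lambda>u\<in>{..\<alpha>}. if u \<in> W then 1 else 0) \<in> vectors X"
proof -
  let ?f = "\<lambda>u\<in>{..\<alpha>}. if u \<in> W then 1 else (0 :: 'k)"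
  show f: "?f \<in> vectors X"
    unfolding X_def
    by (rule restrict_in_vectors[OF continuous_on_subset[OF continuous_on_if_clopen[OF assms(2,3)]]]) simp
  have "((\<lambda>t. fmass \<alpha> \<phi> t * ?f t) has_sum \<phi> ?f) {..\<alpha>}"
    by (rule has_sum_fmass[OF assms(1)[unfolded X_def] f[unfolded X_def]])
  then show "(fmass \<alpha> \<phi> has_sum \<phi> ?f) (W \<inter> {..\<alpha>})"
    by (rule has_sum_cong_neutral[THEN iffD1, rotated 3]) auto
qed

end

text \<open>Values at indicators of clopen sets are weak-* continuous, whereas point masses in
  general are not; the rest of W accounts for the difference.\<close>

lemma norm_clopen_minus_point_mass_le:
  assumes "\<phi> \<in> dual (C_space {..\<alpha>})" "open W" "closed W" "t \<in> W" "t \<le> \<alpha>"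
  shows "norm (\<phi> (\<lambda>u\<in>{..\<alpha>}. if u \<in> W then 1 else 0) - fmass \<alpha> \<phi> t) \<le> tvar \<alpha> \<phi> (W - {t})"
proof -
  have "(fmass \<alpha> \<phi> has_sum fmass \<alpha> \<phi> t) {t}" by (rule has_sum_finiteI) auto
  then have "(fmass \<alpha> \<phi> has_sum (\<phi> (\<lambda>u\<in>{..\<alpha>}. if u \<in> W then 1 else 0) - fmass \<alpha> \<phi> t)) (W \<inter> {..\<alpha>} - {t})"
    using assms by (intro has_sum_Diff has_sum_fmass_clopen) auto
  moreover have "W \<inter> {..\<alpha>} - {t} = (W - {t}) \<inter> {..\<alpha>}" by auto
  ultimately show ?thesis
    unfolding tvar_def using assms(1)
    by (intro norm_has_sum_bound[OF has_sum_infsum]) (auto intro: abs_summable_fmass_on)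
qed

text \<open>A finite F carries the mass of \<mu> in rank q up to \<delta>. Suitable clopen sets
  around its points otherwise contain lower ranks only, with little mass of \<mu>. A nearby \<nu>
  cannot lose much on the other lower ranks by semicontinuity, so if its variation below q is
  unchanged it has little mass in these sets too, and their indicators read off the masses on F. An
  unchanged variation below \<open>osuc q\<close> then bounds \<nu> on the rest of the rank.\<close>

lemma mass_dist_rank_small:
  fixes \<mu> :: "('i ordinal \<Rightarrow> 'k::{real_normed_field, heine_borel}) \<Rightarrow> 'k"
  assumes \<mu>: "\<mu> \<in> dual (C_space {..\<alpha>})" and \<delta>: "0 < \<delta>"
  shows "\<exists>V. openin (weak_star (C_space {..\<alpha>})) V \<and> \<mu> \<in> V \<and> (\<forall>\<nu>\<in>V.
    \<bar>tvar \<alpha> \<nu> {t. cb_rank t < q} - tvar \<alpha> \<mu> {t. cb_rank t < q}\<bar> < \<delta> \<longrightarrow>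
    \<bar>tvar \<alpha> \<nu> {t. cb_rank t < osuc q} - tvar \<alpha> \<mu> {t. cb_rank t < osuc q}\<bar> < \<delta> \<longrightarrow>
    mass_dist \<alpha> {t. cb_rank t = q} \<nu> \<mu> \<le> 14 * \<delta>)"
proof -
  let ?X = "C_space {..\<alpha>} :: ('k, 'i ordinal \<Rightarrow> 'k) nspace"
  let ?T = "weak_star ?X"
  define R where "R = {t :: 'i ordinal. cb_rank t = q}"
  define L where "L = {t :: 'i ordinal. cb_rank t < q}"
  have L_osuc: "{t. cb_rank t < osuc q} = L \<union> R" by (auto simp: L_def R_def less_osuc_iff)
  obtain G where G: "finite G" "G \<subseteq> {..\<alpha>}" "(\<Sum>\<^sub>\<infinity>t\<in>{..\<alpha>} - G. norm (fmass \<alpha> \<mu> t)) < \<delta>"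
    using abs_summable_tail[OF abs_summable_fmass[OF \<mu>] \<delta>] by blast
  have off_G: "tvar \<alpha> \<mu> E < \<delta>" if "E \<inter> G = {}" for E
  proof -
    have "tvar \<alpha> \<mu> E \<le> tvar \<alpha> \<mu> ({..\<alpha>} - G)" using that by (intro tvar_mono \<mu>) auto
    also have "\<dots> = (\<Sum>\<^sub>\<infinity>t\<in>{..\<alpha>} - G. norm (fmass \<alpha> \<mu> t))"
      unfolding tvar_def by (rule arg_cong[where f = "infsum _"]) auto
    finally show ?thesis using G(3) by simp
  qed
  define F where "F = R \<inter> G"
  have F: "finite F" "F \<subseteq> {..\<alpha>}" "F \<subseteq> R" using G by (auto simp: F_def)
  have "\<exists>W. open W \<and> closed W \<and> t \<in> W \<and> W \<inter> G \<subseteq> {t} \<and> W - {t} \<subseteq> L \<and> (\<forall>u\<in>W. u \<le> t \<and> {u..t} \<subseteq> W)"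
    if "t \<in> F" for t
  proof -
    have rt: "cb_rank t = q" using that F by (auto simp: R_def)
    have "\<exists>U. open U \<and> t \<in> U \<and> (\<forall>u\<in>U. u < t \<longrightarrow> u \<in> L)"
    proof (cases "t = 0")
      case True
      then show ?thesis by (intro exI[of _ UNIV]) auto
    next
      case False
      then have "0 < t" by (simp add: order_less_le)
      then obtain x where "x < t" "\<forall>u\<in>{x<..<t}. cb_rank u < cb_rank t"
        using cb_rank_isolated by blast
      then show ?thesis by (intro exI[of _ "{x<..}"]) (auto simp: L_def rt)
    qed
    then obtain U where U: "open U" "t \<in> U" "\<forall>u\<in>U. u < t \<longrightarrow> u \<in> L" by blast
    obtain W where W: "open W" "closed W" "t \<in> W" "W \<subseteq> U \<inter> {..t}" "W \<inter> G \<subseteq> {t}"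
      "\<forall>u\<in>W. {u..t} \<subseteq> W"
      using ordinal_clopen_nbhd[OF U(1,2) G(1)] by blast
    moreover have "u \<in> L" if "u \<in> W - {t}" for u
      using that W(4) U(3) by (auto simp: order_less_le)
    ultimately show ?thesis by (intro exI[of _ W]) auto
  qed
  then obtain W where W: "\<And>t. t \<in> F \<Longrightarrow> open (W t) \<and> closed (W t) \<and> t \<in> W t \<and> W t \<inter> G \<subseteq> {t} \<and>
      W t - {t} \<subseteq> L \<and> (\<forall>u\<in>W t. u \<le> t \<and> {u..t} \<subseteq> W t)"
    by metis
  have W_less: "\<not> t < t'" if "t \<in> F" "t' \<in> F" "u \<in> W t" "u \<in> W t'" for t t' u
  proof
    assume "t < t'"
    moreover have "u \<le> t" using W that by blast
    moreover have "{u..t'} \<subseteq> W t'" using W that by blast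
    ultimately have "t \<in> W t' - {t'}" by auto
    then have "t \<in> L" using W[OF that(2)] by blast
    then show False using that(1) F by (auto simp: L_def R_def)
  qed
  then have disj: "W t \<inter> W t' = {}" if "t \<in> F" "t' \<in> F" "t \<noteq> t'" for t t'
    using that by (metis disjoint_iff linorder_neqE)
  define WW where "WW = (\<Union>t\<in>F. W t)"
  have WW: "closed WW" "WW - F \<subseteq> L" "F \<subseteq> WW" "WW \<inter> G \<subseteq> F"
    unfolding WW_def using W F(1) by (blast intro: closed_UN)+
  have LF: "L \<inter> F = {}" using F(3) by (auto simp: L_def R_def)
  have WL: "L \<inter> WW = WW - F" using WW LF by blast
  have W_sum: "(\<Sum>t\<in>F. tvar \<alpha> \<nu> (W t - {t})) \<le> tvar \<alpha> \<nu> (L \<inter> WW)" if \<nu>: "\<nu> \<in> dual ?X" for \<nu>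
  proof -
    have "(\<Sum>t\<in>F. tvar \<alpha> \<nu> (W t - {t})) = (\<Sum>\<^sub>\<infinity>u\<in>(\<Union>t\<in>F. (W t - {t}) \<inter> {..\<alpha>}). norm (fmass \<alpha> \<nu> u))"
      unfolding tvar_def
      by (rule sum_infsum[OF F(1)]) (use disj \<nu> in \<open>auto intro!: abs_summable_fmass_on\<close>)
    also have "(\<Union>t\<in>F. (W t - {t}) \<inter> {..\<alpha>}) = (\<Union>t\<in>F. W t - {t}) \<inter> {..\<alpha>}" by blast
    also have "(\<Sum>\<^sub>\<infinity>u\<in>\<dots>. norm (fmass \<alpha> \<nu> u)) = tvar \<alpha> \<nu> (\<Union>t\<in>F. W t - {t})"
      by (simp add: tvar_def)
    also have "\<dots> \<le> tvar \<alpha> \<nu> (L \<inter> WW)"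
    proof (rule tvar_mono[OF \<nu>])
      show "(\<Union>t\<in>F. W t - {t}) \<inter> {..\<alpha>} \<subseteq> L \<inter> WW" unfolding WW_def using W by blast
    qed
    finally show ?thesis .
  qed
  define one where "one t = (\<lambda>u\<in>{..\<alpha>}. if u \<in> W t then 1 else (0 :: 'k))" for t
  \<comment> \<open>One share of \<delta> for each point of F; the 1 covers empty F.\<close>
  define \<eta> where "\<eta> = \<delta> / (card F + 1)"
  have \<eta>: "0 < \<eta>" "card F * \<eta> \<le> \<delta>" using \<delta> by (auto simp: \<eta>_def field_simps)
  have "\<exists>V. openin ?T V \<and> \<mu> \<in> V \<and> (\<forall>\<nu>\<in>UNIV \<inter> V. \<forall>t\<in>F. dist (\<nu> (one t)) (\<mu> (one t)) < \<eta>)"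
  proof (rule openin_finite_Inter_nbhds[OF F(1)])
    fix t assume t: "t \<in> F"
    have "one t \<in> vectors ?X"
      unfolding one_def using W[OF t] by (intro has_sum_fmass_clopen(2)[OF \<mu>]) auto
    then have "openin ?T {\<nu> \<in> dual ?X. \<nu> (one t) \<in> ball (\<mu> (one t)) \<eta>}"
      by (rule openin_weak_star_eval) simp
    then show "\<exists>V. openin ?T V \<and> \<mu> \<in> V \<and> (\<forall>\<nu>\<in>UNIV \<inter> V. dist (\<nu> (one t)) (\<mu> (one t)) < \<eta>)"
      using \<mu> \<eta>(1)
      by (intro exI[of _ "{\<nu> \<in> dual ?X. \<nu> (one t) \<in> ball (\<mu> (one t)) \<eta>}"]) (auto simp: dist_commute)
  qed (use \<mu> in \<open>simp add: topspace_weak_star\<close>)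
  then obtain V1 where V1: "openin ?T V1" "\<mu> \<in> V1" "\<And>\<nu> t. \<nu> \<in> V1 \<Longrightarrow> t \<in> F \<Longrightarrow> dist (\<nu> (one t)) (\<mu> (one t)) < \<eta>"
    by blast
  have "open (L - WW)" using WW(1) open_cb_rank_less[of q] by (auto simp: L_def)
  then obtain V2 where V2: "openin ?T V2" "\<mu> \<in> V2"
    "\<And>\<nu>. \<nu> \<in> V2 \<Longrightarrow> tvar \<alpha> \<mu> (L - WW) - \<delta> < tvar \<alpha> \<nu> (L - WW)"
    using tvar_lower_semicontinuous[OF \<mu>, of "tvar \<alpha> \<mu> (L - WW) - \<delta>" "L - WW"] \<delta> by auto
  have "mass_dist \<alpha> R \<nu> \<mu> \<le> 14 * \<delta>"
    if V: "\<nu> \<in> V1 \<inter> V2" and nL: "\<bar>tvar \<alpha> \<nu> L - tvar \<alpha> \<mu> L\<bar> < \<delta>"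
      and nR: "\<bar>tvar \<alpha> \<nu> (L \<union> R) - tvar \<alpha> \<mu> (L \<union> R)\<bar> < \<delta>" for \<nu>
  proof -
    have \<nu>: "\<nu> \<in> dual ?X" using openin_subset[OF V1(1)] V by (auto simp: topspace_weak_star)
    have LW: "tvar \<alpha> \<mu> (L \<inter> WW) < \<delta>" using WW LF by (intro off_G) blast
    have "tvar \<alpha> \<mu> (L - WW) - \<delta> < tvar \<alpha> \<nu> (L - WW)" using V V2(3) by blast
    \<comment> \<open>On L the functional \<nu> has at most \<delta> more than \<mu>, and outside WW
      at most \<delta> less; inside it gains at most 2 \<delta> on the less than \<delta> of
      \<mu>.\<close>
    then have low: "tvar \<alpha> \<nu> (L \<inter> WW) < 3 * \<delta>"
      using LW nL tvar_split[OF \<mu>, of L WW] tvar_split[OF \<nu>, of L WW] by linarith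
    have point: "norm (fmass \<alpha> \<nu> t - fmass \<alpha> \<mu> t) \<le> \<eta> + tvar \<alpha> \<nu> (W t - {t}) + tvar \<alpha> \<mu> (W t - {t})"
      if t: "t \<in> F" for t
    proof -
      have *: "norm (\<phi> (one t) - fmass \<alpha> \<phi> t) \<le> tvar \<alpha> \<phi> (W t - {t})" if "\<phi> \<in> dual ?X" for \<phi>
        unfolding one_def using W[OF t] t F by (intro norm_clopen_minus_point_mass_le that) auto
      have "norm (\<nu> (one t) - \<mu> (one t)) < \<eta>" using V1(3)[OF _ t] V by (auto simp: dist_norm)
      moreover have "fmass \<alpha> \<nu> t - fmass \<alpha> \<mu> t = (\<nu> (one t) - \<mu> (one t)) -
          (\<nu> (one t) - fmass \<alpha> \<nu> t) + (\<mu> (one t) - fmass \<alpha> \<mu> t)" by simp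
      ultimately show ?thesis
        using *[OF \<nu>] *[OF \<mu>] norm_triangle_ineq4[of "\<nu> (one t) - \<mu> (one t)" "\<nu> (one t) - fmass \<alpha> \<nu> t"]
          norm_triangle_ineq[of "(\<nu> (one t) - \<mu> (one t)) - (\<nu> (one t) - fmass \<alpha> \<nu> t)" "\<mu> (one t) - fmass \<alpha> \<mu> t"]
        by simp
    qed
    have "(\<Sum>t\<in>F. norm (fmass \<alpha> \<nu> t - fmass \<alpha> \<mu> t))
        \<le> (\<Sum>t\<in>F. \<eta> + tvar \<alpha> \<nu> (W t - {t}) + tvar \<alpha> \<mu> (W t - {t}))"
      using point by (intro sum_mono)
    also have "\<dots> = card F * \<eta> + (\<Sum>t\<in>F. tvar \<alpha> \<nu> (W t - {t})) + (\<Sum>t\<in>F. tvar \<alpha> \<mu> (W t - {t}))"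
      by (simp add: sum.distrib)
    \<comment> \<open>The indicators contribute \<delta>, the variations of \<nu> and \<mu> around
      the points 3 \<delta> and \<delta>.\<close>
    finally have sumF: "(\<Sum>t\<in>F. norm (fmass \<alpha> \<nu> t - fmass \<alpha> \<mu> t)) \<le> 5 * \<delta>"
      using W_sum[OF \<nu>] W_sum[OF \<mu>] low LW \<eta>(2) by linarith
    have "tvar \<alpha> \<mu> F \<le> tvar \<alpha> \<nu> F + (\<Sum>t\<in>F. norm (fmass \<alpha> \<nu> t - fmass \<alpha> \<mu> t))"
      unfolding tvar_finite[OF F(1,2)] sum.distrib[symmetric]
    proof (rule sum_mono)
      fix t show "norm (fmass \<alpha> \<mu> t) \<le> norm (fmass \<alpha> \<nu> t) + norm (fmass \<alpha> \<nu> t - fmass \<alpha> \<mu> t)"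
        using norm_triangle_sub[of "fmass \<alpha> \<mu> t" "fmass \<alpha> \<nu> t"] by (simp add: norm_minus_commute)
    qed
    moreover have "tvar \<alpha> \<phi> (L \<union> R) = tvar \<alpha> \<phi> L + tvar \<alpha> \<phi> F + tvar \<alpha> \<phi> (R - F)"
      if "\<phi> \<in> dual ?X" for \<phi>
    proof -
      have "(L \<union> R) \<inter> L = L" "L \<union> R - L = R" "R \<inter> F = F" using F(3) by (auto simp: L_def R_def)
      then show ?thesis using tvar_split[OF that, of "L \<union> R" L] tvar_split[OF that, of R F] by simp
    qed
    moreover have tail: "tvar \<alpha> \<mu> (R - F) < \<delta>" by (intro off_G) (auto simp: F_def)
    \<comment> \<open>On R - F the excess of \<nu> over \<mu> is at most \<delta> for each of the
      two fixed variations plus 5 \<delta> for F. Adding 5 \<delta> on F and \<delta> for \<mu> on R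
      - F to these 8 \<delta> gives the constant 14.\<close>
    ultimately have "tvar \<alpha> \<nu> (R - F) \<le> 8 * \<delta>" using \<nu> \<mu> nL nR sumF by fastforce
    moreover have "mass_dist \<alpha> R \<nu> \<mu> \<le> mass_dist \<alpha> F \<nu> \<mu> + tvar \<alpha> \<nu> (R - F) + tvar \<alpha> \<mu> (R - F)"
      by (rule mass_dist_le_part[OF \<nu> \<mu>])
    moreover have "mass_dist \<alpha> F \<nu> \<mu> = (\<Sum>t\<in>F. norm (fmass \<alpha> \<nu> t - fmass \<alpha> \<mu> t))"
      using F by (simp add: mass_dist_def Int_absorb2)
    ultimately show ?thesis using sumF tail by simp
  qed
  then show ?thesis
    using V1 V2 unfolding R_def[symmetric] L_def[symmetric] L_osuc
    by (intro exI[of _ "V1 \<inter> V2"]) auto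
qed

section \<open>The upper bound\<close>

lemma sep_deriv_empty:
  assumes "A \<subseteq> topspace T" "\<And>y z. y \<in> A \<Longrightarrow> z \<in> A \<Longrightarrow> d y z \<le> \<epsilon>"
  shows "sep_deriv T d \<epsilon> A = {}"
proof -
  have "x \<notin> sep_deriv T d \<epsilon> A" for x
  proof
    assume x: "x \<in> sep_deriv T d \<epsilon> A"
    then have "x \<in> topspace T" using sep_deriv_subset[of T d \<epsilon> A] assms(1) by blast
    then obtain y z where "y \<in> A" "z \<in> A" "\<epsilon> < d y z"
      using x openin_topspace[of T] unfolding sep_deriv_def by blast
    then show False using assms(2)[of y z] by simp
  qed
  then show ?thesis by blast
qed

text \<open>Finitely many points carry all but \<delta> of the variation, and their ranks, each
  below a limit, have a common bound below it.\<close>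

lemma tvar_rank_approx:
  assumes "\<mu> \<in> dual (C_space {..\<alpha>})" "0 < \<delta>" "limit_ordinal \<kappa>"
  shows "\<exists>y<\<kappa>. tvar \<alpha> \<mu> {t. cb_rank t < a + \<kappa>} - \<delta> < tvar \<alpha> \<mu> {t. cb_rank t < a + y}"
proof -
  have "tvar \<alpha> \<mu> {t. cb_rank t < a + \<kappa>} - \<delta> < tvar \<alpha> \<mu> {t. cb_rank t < a + \<kappa>}"
    using assms(2) by simp
  from less_tvar_finite[OF assms(1) this]
  obtain F where F: "finite F" "F \<subseteq> {t. cb_rank t < a + \<kappa>} \<inter> {..\<alpha>}"
    "tvar \<alpha> \<mu> {t. cb_rank t < a + \<kappa>} - \<delta> < (\<Sum>t\<in>F. norm (fmass \<alpha> \<mu> t))"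
    by blast
  have "\<exists>z<\<kappa>. cb_rank t < a + z" if "t \<in> F" for t
    using subsetD[OF F(2) that] by (simp add: less_plus_limit_iff[OF assms(3)])
  then obtain z where z: "\<And>t. t \<in> F \<Longrightarrow> z t < \<kappa> \<and> cb_rank t < a + z t" by metis
  define y where "y = Max (insert 0 (z ` F))"
  have y: "y < \<kappa>" unfolding y_def using F(1) z limit_ordinal_pos[OF assms(3)] by (subst Max_less_iff) auto
  have "cb_rank t < a + y" if "t \<in> F" for t
  proof -
    have "z t \<le> y" unfolding y_def using F(1) that by (intro Max_ge) auto
    then have "a + z t \<le> a + y" by simp
    then show ?thesis using z[OF that] by (meson order_less_le_trans)
  qed
  then have "(\<Sum>t\<in>F. norm (fmass \<alpha> \<mu> t)) \<le> tvar \<alpha> \<mu> {t. cb_rank t < a + y}"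
    using tvar_mono[OF assms(1), of F "{t. cb_rank t < a + y}"] tvar_finite[OF F(1), of \<alpha> \<mu>] F(2)
    by (simp add: subset_iff)
  then show ?thesis using y F(3) by (intro exI[of _ y]) simp
qed

text \<open>One common length but arbitrary starting points: the pieces cut from a band start at its
  start plus multiples of their own length.\<close>

definition rank_bands :: "'i ordinal set \<Rightarrow> 'i ordinal \<Rightarrow> 'i ordinal set"
  where "rank_bands S \<kappa> = {t. \<exists>a\<in>S. a \<le> cb_rank t \<and> cb_rank t < a + \<kappa>}"

lemma dual_ball_subset_dual: "dual_ball X \<subseteq> dual X"
  by (auto simp: dual_ball_def)

lemma sep_iter_rank_bands_empty:
  fixes \<alpha> \<gamma> :: "'i ordinal"
  defines "B \<equiv> dual_ball (C_space {..\<alpha>} :: ('k::{real_normed_field, heine_borel}, 'i ordinal \<Rightarrow> 'k) nspace)"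
    and "T \<equiv> weak_star (C_space {..\<alpha>})"
  assumes "finite S" "0 < \<epsilon>"
  shows "\<exists>n. sep_iter T (mass_dist \<alpha> (rank_bands S (\<omega> ^\<^sub>o \<gamma>))) \<epsilon> B (\<omega> ^\<^sub>o \<gamma> * (osuc ^^ n) 0) = {}"
  using assms(3,4)
proof (induction \<gamma> arbitrary: S \<epsilon> rule: less_induct)
  case (less \<gamma>)
  note S = less.prems(1) and \<epsilon> = less.prems(2)
  \<comment> \<open>The complement turns lower semicontinuity of the variation into the upper
    semicontinuity of a potential with values in [0, 1].\<close>
  define g where "g r \<mu> = 1 - tvar \<alpha> \<mu> {t. cb_rank t < r}" for r and \<mu> :: "('i ordinal \<Rightarrow> 'k) \<Rightarrow> 'k"
  have dual: "\<mu> \<in> dual (C_space {..\<alpha>})" if "\<mu> \<in> B" for \<mu>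
    using that dual_ball_subset_dual unfolding B_def by blast
  have BT: "B \<subseteq> topspace T" unfolding B_def T_def topspace_weak_star by (rule dual_ball_subset_dual)
  have bound: "0 \<le> g r \<mu> \<and> g r \<mu> \<le> 1" if "\<mu> \<in> B" for r \<mu>
    using that tvar_le_1 tvar_nonneg unfolding g_def B_def by auto
  have usc: "\<exists>V. openin T V \<and> \<mu> \<in> V \<and> (\<forall>\<nu>\<in>B \<inter> V. g r \<nu> < c)" if \<mu>: "\<mu> \<in> B" "g r \<mu> < c" for r \<mu> c
  proof -
    have "1 - c < tvar \<alpha> \<mu> {t. cb_rank t < r}" using \<mu>(2) by (simp add: g_def)
    then obtain V where "openin T V" "\<mu> \<in> V" "\<forall>\<nu>\<in>V. 1 - c < tvar \<alpha> \<nu> {t. cb_rank t < r}"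
      using tvar_lower_semicontinuous[OF dual[OF \<mu>(1)] _ open_cb_rank_less] unfolding T_def by blast
    then show ?thesis by (intro exI[of _ V]) (auto simp: g_def)
  qed
  define \<kappa> where "\<kappa> = \<omega> ^\<^sub>o \<gamma>"
  show ?case
    unfolding \<kappa>_def[symmetric]
  proof (cases "\<gamma> = 0")
    case True
    then have \<kappa>: "\<kappa> = osuc 0" by (simp add: \<kappa>_def one_ordinal_def)
    have E: "rank_bands S \<kappa> = (\<Union>q\<in>S. {t. cb_rank t = q})"
      unfolding rank_bands_def \<kappa> plus_ordinal_osuc plus_ordinal_0 less_osuc_iff
      using order_antisym by blast
    \<comment> \<open>Two functionals are compared through \<mu>, each at distance at most 14
      \<delta> per rank in S. The 1 covers empty S.\<close>
    define \<delta> where "\<delta> = \<epsilon> / (28 * (real (card S) + 1))"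
    have \<delta>: "0 < \<delta>" "28 * (card S * \<delta>) \<le> \<epsilon>"
      using \<epsilon> by (auto simp: \<delta>_def field_simps intro!: divide_pos_pos)
    show "\<exists>n. sep_iter T (mass_dist \<alpha> (rank_bands S \<kappa>)) \<epsilon> B (\<kappa> * (osuc ^^ n) 0) = {}"
    proof (rule sep_iter_times_empty[of "S \<union> osuc ` S" \<delta> B T g])
      fix \<mu> assume \<mu>: "\<mu> \<in> B"
      have "\<exists>V. openin T V \<and> \<mu> \<in> V \<and> (\<forall>\<nu>\<in>B \<inter> V. \<forall>q\<in>S.
          \<bar>g q \<nu> - g q \<mu>\<bar> < \<delta> \<longrightarrow> \<bar>g (osuc q) \<nu> - g (osuc q) \<mu>\<bar> < \<delta> \<longrightarrow>
          mass_dist \<alpha> {t. cb_rank t = q} \<nu> \<mu> \<le> 14 * \<delta>)"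
      proof (rule openin_finite_Inter_nbhds[OF S])
        fix q assume "q \<in> S"
        obtain V where "openin T V" "\<mu> \<in> V" "\<forall>\<nu>\<in>V.
          \<bar>tvar \<alpha> \<nu> {t. cb_rank t < q} - tvar \<alpha> \<mu> {t. cb_rank t < q}\<bar> < \<delta> \<longrightarrow>
          \<bar>tvar \<alpha> \<nu> {t. cb_rank t < osuc q} - tvar \<alpha> \<mu> {t. cb_rank t < osuc q}\<bar> < \<delta> \<longrightarrow>
          mass_dist \<alpha> {t. cb_rank t = q} \<nu> \<mu> \<le> 14 * \<delta>"
          using mass_dist_rank_small[OF dual[OF \<mu>] \<delta>(1), of q] unfolding T_def by blast
        then show "\<exists>V. openin T V \<and> \<mu> \<in> V \<and> (\<forall>\<nu>\<in>B \<inter> V.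
          \<bar>g q \<nu> - g q \<mu>\<bar> < \<delta> \<longrightarrow> \<bar>g (osuc q) \<nu> - g (osuc q) \<mu>\<bar> < \<delta> \<longrightarrow>
          mass_dist \<alpha> {t. cb_rank t = q} \<nu> \<mu> \<le> 14 * \<delta>)"
          by (intro exI[of _ V]) (auto simp: g_def abs_minus_commute)
      qed (use \<mu> BT in blast)
      then obtain V where V: "openin T V" "\<mu> \<in> V"
        "\<And>\<nu> q. \<nu> \<in> B \<inter> V \<Longrightarrow> q \<in> S \<Longrightarrow> \<bar>g q \<nu> - g q \<mu>\<bar> < \<delta> \<Longrightarrow>
          \<bar>g (osuc q) \<nu> - g (osuc q) \<mu>\<bar> < \<delta> \<Longrightarrow> mass_dist \<alpha> {t. cb_rank t = q} \<nu> \<mu> \<le> 14 * \<delta>"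
        by blast
      let ?C = "{\<nu> \<in> B \<inter> V. \<forall>r\<in>S \<union> osuc ` S. \<bar>g r \<nu> - g r \<mu>\<bar> < \<delta>}"
      have near: "mass_dist \<alpha> (rank_bands S \<kappa>) \<nu> \<mu> \<le> \<epsilon> / 2" if \<nu>: "\<nu> \<in> ?C" for \<nu>
      proof -
        have "mass_dist \<alpha> (rank_bands S \<kappa>) \<nu> \<mu> \<le> (\<Sum>q\<in>S. mass_dist \<alpha> {t. cb_rank t = q} \<nu> \<mu>)"
          unfolding E using dual \<mu> \<nu> by (intro mass_dist_UN_le S) auto
        also have "\<dots> \<le> (\<Sum>q\<in>S. 14 * \<delta>)"
          using \<nu> by (intro sum_mono V(3)) auto
        finally show ?thesis using \<delta>(2) by simp
      qed
      have "mass_dist \<alpha> (rank_bands S \<kappa>) \<nu> \<nu>' \<le> \<epsilon>" if "\<nu> \<in> ?C" "\<nu>' \<in> ?C" for \<nu> \<nu>'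
      proof -
        have d: "\<nu> \<in> dual (C_space {..\<alpha>})" "\<nu>' \<in> dual (C_space {..\<alpha>})" using that dual by auto
        show ?thesis
          using mass_dist_triangle[OF d dual[OF \<mu>], of "rank_bands S \<kappa>"] near[OF that(1)] near[OF that(2)]
            mass_dist_commute[of \<alpha> "rank_bands S \<kappa>" \<mu> \<nu>'] by linarith
      qed
      then have "sep_deriv T (mass_dist \<alpha> (rank_bands S \<kappa>)) \<epsilon> ?C = {}"
        using BT by (intro sep_deriv_empty) auto
      then show "\<exists>V. openin T V \<and> \<mu> \<in> V \<and> sep_iter T (mass_dist \<alpha> (rank_bands S \<kappa>)) \<epsilon>
          {\<nu> \<in> B \<inter> V. \<forall>r\<in>S \<union> osuc ` S. \<bar>g r \<nu> - g r \<mu>\<bar> < \<delta>} \<kappa> = {}"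
        using V(1,2) by (intro exI[of _ V]) (simp add: \<kappa> sep_iter_osuc)
    qed (use S \<delta> BT bound usc in auto)
  next
    case False
    then have "0 < \<gamma>" by (simp add: order_less_le)
    then have lim: "limit_ordinal \<kappa>" unfolding \<kappa>_def by (rule limit_ordinal_omega_opow_pos)
    \<comment> \<open>Two functionals with tails of at most 2 \<delta> per band lose at most
      \<epsilon> / 2 together.\<close>
    define \<delta> where "\<delta> = \<epsilon> / (8 * (real (card S) + 1))"
    have \<delta>: "0 < \<delta>" "8 * (card S * \<delta>) \<le> \<epsilon>"
      using \<epsilon> by (auto simp: \<delta>_def field_simps intro!: divide_pos_pos)
    show "\<exists>n. sep_iter T (mass_dist \<alpha> (rank_bands S \<kappa>)) \<epsilon> B (\<kappa> * (osuc ^^ n) 0) = {}"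
    proof (rule sep_iter_times_empty[of "(\<lambda>a. a + \<kappa>) ` S" \<delta> B T g])
      fix \<mu> assume \<mu>: "\<mu> \<in> B"
      have "\<exists>y<\<kappa>. tvar \<alpha> \<mu> {t. cb_rank t < a + \<kappa>} - \<delta> < tvar \<alpha> \<mu> {t. cb_rank t < a + y}" for a
        by (rule tvar_rank_approx[OF dual[OF \<mu>] \<delta>(1) lim])
      then obtain z where z: "\<And>a. z a < \<kappa> \<and>
          tvar \<alpha> \<mu> {t. cb_rank t < a + \<kappa>} - \<delta> < tvar \<alpha> \<mu> {t. cb_rank t < a + z a}"
        by metis
      \<comment> \<open>One initial length for all bands; 0 is inserted because S may be
        empty.\<close>
      define y where "y = Max (insert 0 (z ` S))"
      have "y < \<kappa>" unfolding y_def using S z limit_ordinal_pos[OF lim] by (subst Max_less_iff) auto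
      then obtain \<gamma>' n where \<gamma>': "\<gamma>' < \<gamma>" "y < \<omega> ^\<^sub>o \<gamma>' * (osuc ^^ n) 0"
        using omega_opow_less[of y \<gamma>] \<open>0 < \<gamma>\<close> unfolding \<kappa>_def by blast
      have "\<exists>V. openin T V \<and> \<mu> \<in> V \<and> (\<forall>\<nu>\<in>B \<inter> V. \<forall>a\<in>S.
          tvar \<alpha> \<mu> {t. cb_rank t < a + \<kappa>} - \<delta> < tvar \<alpha> \<nu> {t. cb_rank t < a + y})"
      proof (rule openin_finite_Inter_nbhds[OF S])
        fix a assume a: "a \<in> S"
        have "z a \<le> y" unfolding y_def using S a by (intro Max_ge) auto
        then have "a + z a \<le> a + y" by simp
        then have "tvar \<alpha> \<mu> {t. cb_rank t < a + z a} \<le> tvar \<alpha> \<mu> {t. cb_rank t < a + y}"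
          by (intro tvar_mono dual[OF \<mu>]) (auto intro: order_less_le_trans)
        then have "tvar \<alpha> \<mu> {t. cb_rank t < a + \<kappa>} - \<delta> < tvar \<alpha> \<mu> {t. cb_rank t < a + y}"
          using z[of a] by linarith
        from tvar_lower_semicontinuous[OF dual[OF \<mu>] this open_cb_rank_less]
        show "\<exists>V. openin T V \<and> \<mu> \<in> V \<and> (\<forall>\<nu>\<in>B \<inter> V.
            tvar \<alpha> \<mu> {t. cb_rank t < a + \<kappa>} - \<delta> < tvar \<alpha> \<nu> {t. cb_rank t < a + y})"
          unfolding T_def by blast
      qed (use \<mu> BT in blast)
      then obtain V where V: "openin T V" "\<mu> \<in> V" "\<And>\<nu> a. \<nu> \<in> B \<inter> V \<Longrightarrow> a \<in> S \<Longrightarrow>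
          tvar \<alpha> \<mu> {t. cb_rank t < a + \<kappa>} - \<delta> < tvar \<alpha> \<nu> {t. cb_rank t < a + y}"
        by blast
      let ?C = "{\<nu> \<in> B \<inter> V. \<forall>r\<in>(\<lambda>a. a + \<kappa>) ` S. \<bar>g r \<nu> - g r \<mu>\<bar> < \<delta>}"
      \<comment> \<open>Every initial piece of length y is covered by n consecutive shorter
        bands.\<close>
      define S' where "S' = (\<lambda>(a, i). a + \<omega> ^\<^sub>o \<gamma>' * (osuc ^^ i) 0) ` (S \<times> {..<n})"
      let ?E = "rank_bands S \<kappa>" and ?E' = "rank_bands S' (\<omega> ^\<^sub>o \<gamma>')"
      have sub: "?E - ?E' \<subseteq> (\<Union>a\<in>S. {t. cb_rank t < a + \<kappa>} - {t. cb_rank t < a + y})"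
      proof
        fix t assume t: "t \<in> ?E - ?E'"
        then obtain a where a: "a \<in> S" "a \<le> cb_rank t" "cb_rank t < a + \<kappa>"
          unfolding rank_bands_def by blast
        have "\<not> cb_rank t < a + y"
        proof
          assume "cb_rank t < a + y"
          then have "cb_rank t < a + \<omega> ^\<^sub>o \<gamma>' * (osuc ^^ n) 0"
            using \<gamma>'(2) by (meson order_less_trans plus_ordinal_less_iff)
          from less_plus_times_funpow[OF a(2) this] have "t \<in> ?E'"
            using a(1) unfolding rank_bands_def S'_def by fastforce
          then show False using t by blast
        qed
        then show "t \<in> (\<Union>a\<in>S. {t. cb_rank t < a + \<kappa>} - {t. cb_rank t < a + y})" using a by blast
      qed
      \<comment> \<open>Compared with \<mu> below a + \<kappa>, the variation of \<nu> below a +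
        \<kappa> is larger by less than \<delta>, and that below a + y is smaller by less than
        \<delta>.\<close>
      have small: "tvar \<alpha> \<nu> (?E - ?E') \<le> card S * (2 * \<delta>)" if \<nu>: "\<nu> \<in> ?C" for \<nu>
      proof -
        have \<nu>d: "\<nu> \<in> dual (C_space {..\<alpha>})" using \<nu> dual by blast
        have "tvar \<alpha> \<nu> ({t. cb_rank t < a + \<kappa>} - {t. cb_rank t < a + y}) \<le> 2 * \<delta>" if a: "a \<in> S" for a
        proof -
          have "{t. cb_rank t < a + \<kappa>} \<inter> {t. cb_rank t < a + y} = {t. cb_rank t < a + y}"
            using \<open>y < \<kappa>\<close> by (auto intro: order_less_trans)
          then have "tvar \<alpha> \<nu> ({t. cb_rank t < a + \<kappa>} - {t. cb_rank t < a + y})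
              = tvar \<alpha> \<nu> {t. cb_rank t < a + \<kappa>} - tvar \<alpha> \<nu> {t. cb_rank t < a + y}"
            using tvar_split[OF \<nu>d, of "{t. cb_rank t < a + \<kappa>}" "{t. cb_rank t < a + y}"] by simp
          moreover have "\<bar>g (a + \<kappa>) \<nu> - g (a + \<kappa>) \<mu>\<bar> < \<delta>" using \<nu> a by blast
          ultimately show ?thesis using V(3)[OF _ a] \<nu> unfolding g_def by fastforce
        qed
        then have "(\<Sum>a\<in>S. tvar \<alpha> \<nu> ({t. cb_rank t < a + \<kappa>} - {t. cb_rank t < a + y})) \<le> card S * (2 * \<delta>)"
          by (rule sum_bounded_above)
        moreover have "tvar \<alpha> \<nu> (?E - ?E')
            \<le> tvar \<alpha> \<nu> (\<Union>a\<in>S. {t. cb_rank t < a + \<kappa>} - {t. cb_rank t < a + y})"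
          using sub by (intro tvar_mono \<nu>d) blast
        ultimately show ?thesis
          using tvar_UN_le[OF \<nu>d S, of "\<lambda>a. {t. cb_rank t < a + \<kappa>} - {t. cb_rank t < a + y}"] by linarith
      qed
      have "\<epsilon> / 2 < mass_dist \<alpha> ?E' \<nu> \<nu>'" if "\<nu> \<in> ?C" "\<nu>' \<in> ?C" "\<epsilon> < mass_dist \<alpha> ?E \<nu> \<nu>'" for \<nu> \<nu>'
      proof -
        have "\<nu> \<in> dual (C_space {..\<alpha>})" "\<nu>' \<in> dual (C_space {..\<alpha>})" using that dual by auto
        from mass_dist_le_part[OF this, of ?E ?E'] show ?thesis
          using small[OF that(1)] small[OF that(2)] that(3) \<delta>(2) by simp
      qed
      then have *: "sep_iter T (mass_dist \<alpha> ?E) \<epsilon> ?C \<kappa> \<subseteq> sep_iter T (mass_dist \<alpha> ?E') (\<epsilon> / 2) B \<kappa>"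
        by (intro sep_iter_mono) auto
      obtain m where m: "sep_iter T (mass_dist \<alpha> ?E') (\<epsilon> / 2) B (\<omega> ^\<^sub>o \<gamma>' * (osuc ^^ m) 0) = {}"
        using less.IH[OF \<gamma>'(1), of S' "\<epsilon> / 2"] S \<epsilon> by (auto simp: S'_def)
      \<comment> \<open>Here m depends on \<mu> through \<gamma>' and S', but \<kappa> bounds all
        these multiples.\<close>
      have "\<omega> ^\<^sub>o \<gamma>' * (osuc ^^ m) 0 \<le> \<kappa>"
        unfolding \<kappa>_def using omega_opow_times_less[OF \<gamma>'(1)] by (rule order_less_imp_le)
      from sep_iter_antimono[OF this, of T "mass_dist \<alpha> ?E'" "\<epsilon> / 2" B] m *
      have "sep_iter T (mass_dist \<alpha> ?E) \<epsilon> ?C \<kappa> = {}" by blast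
      then show "\<exists>V. openin T V \<and> \<mu> \<in> V \<and> sep_iter T (mass_dist \<alpha> ?E) \<epsilon>
          {\<nu> \<in> B \<inter> V. \<forall>r\<in>(\<lambda>a. a + \<kappa>) ` S. \<bar>g r \<nu> - g r \<mu>\<bar> < \<delta>} \<kappa> = {}"
        using V(1,2) by blast
    qed (use S \<delta> BT bound usc in auto)
  qed
qed

text \<open>The sign of \<epsilon> matters because \<open>ennreal\<close> sends every negative real
  to 0.\<close>

lemma szlenk_iter_eq_sep_iter:
  assumes "0 \<le> \<epsilon>"
  shows "szlenk_iter X \<epsilon> B = sep_iter (weak_star X) (\<lambda>\<phi> \<psi>. dual_norm X (\<lambda>u. \<phi> u - \<psi> u)) \<epsilon> B"
proof -
  have "ennreal \<epsilon> < dual_diam X A \<longleftrightarrow> (\<exists>\<phi>\<in>A. \<exists>\<psi>\<in>A. \<epsilon> < dual_norm X (\<lambda>u. \<phi> u - \<psi> u))" for A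
    unfolding dual_diam_def less_SUP_iff using assms by (simp add: ennreal_less_iff)
  then have "szlenk_deriv X \<epsilon> = sep_deriv (weak_star X) (\<lambda>\<phi> \<psi>. dual_norm X (\<lambda>u. \<phi> u - \<psi> u)) \<epsilon>"
    by (simp add: fun_eq_iff szlenk_deriv_def sep_deriv_def)
  then show ?thesis by (intro ext) (simp add: szlenk_iter_def sep_iter_def)
qed

text \<open>The interval ends below \<open>\<omega> ^\<^sub>o r\<close> with r below a finite
  multiple of \<open>\<omega> ^\<^sub>o \<gamma>\<close>. That many consecutive bands contain every
  rank that occurs, and on them the variation distance is the full one.\<close>

lemma szlenk_iter_C_space_empty:
  fixes \<alpha> \<gamma> :: "'i ordinal"
  defines "X \<equiv> C_space {..\<alpha>} :: ('k::{real_normed_field, heine_borel}, 'i ordinal \<Rightarrow> 'k) nspace"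
  assumes \<alpha>: "\<alpha> < \<omega> ^\<^sub>o (\<omega> ^\<^sub>o (\<gamma> + 1))" and \<epsilon>: "0 < \<epsilon>"
  shows "\<exists>\<beta><\<omega> ^\<^sub>o (\<gamma> + 1). szlenk_iter X \<epsilon> (dual_ball X) \<beta> = {}"
proof -
  have opow1: "\<omega> ^\<^sub>o (\<gamma> + 1) = \<omega> ^\<^sub>o \<gamma> * \<omega>" by (simp add: plus_ordinal_1 opow_osuc)
  have "limit_ordinal (\<omega> ^\<^sub>o (\<gamma> + 1))"
    by (rule limit_ordinal_omega_opow_pos) (simp add: plus_ordinal_1 order_less_le osuc_neq_0[symmetric] del: osuc_neq_0)
  then obtain r where r: "r < \<omega> ^\<^sub>o (\<gamma> + 1)" "\<alpha> < \<omega> ^\<^sub>o r"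
    using \<alpha> by (auto simp: less_opow_limit_iff)
  then obtain n where n: "r < \<omega> ^\<^sub>o \<gamma> * (osuc ^^ n) 0"
    unfolding opow1 less_times_omega_iff by blast
  define S where "S = (\<lambda>i. \<omega> ^\<^sub>o \<gamma> * (osuc ^^ i) 0) ` {..<n}"
  have "t \<in> rank_bands S (\<omega> ^\<^sub>o \<gamma>)" if "t \<le> \<alpha>" for t
  proof -
    have "t \<le> \<omega> ^\<^sub>o r" using that r(2) by (meson order_less_imp_le order_trans)
    then have "cb_rank t < 0 + \<omega> ^\<^sub>o \<gamma> * (osuc ^^ n) 0"
      using cb_rank_le_opow n by (metis order_le_less_trans plus_ordinal_left_0)
    from less_plus_times_funpow[OF _ this] show ?thesis
      unfolding rank_bands_def S_def by auto
  qed
  then have UNIV: "mass_dist \<alpha> (rank_bands S (\<omega> ^\<^sub>o \<gamma>)) = mass_dist \<alpha> UNIV"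
    unfolding mass_dist_def by (intro ext infsum_cong_neutral) auto
  obtain m where m: "sep_iter (weak_star X) (mass_dist \<alpha> (rank_bands S (\<omega> ^\<^sub>o \<gamma>))) \<epsilon> (dual_ball X)
      (\<omega> ^\<^sub>o \<gamma> * (osuc ^^ m) 0) = {}"
    using sep_iter_rank_bands_empty[of S \<epsilon> \<alpha> \<gamma>] \<epsilon> unfolding X_def S_def by blast
  have "szlenk_iter X \<epsilon> (dual_ball X) (\<omega> ^\<^sub>o \<gamma> * (osuc ^^ m) 0)
      \<subseteq> sep_iter (weak_star X) (mass_dist \<alpha> UNIV) \<epsilon> (dual_ball X) (\<omega> ^\<^sub>o \<gamma> * (osuc ^^ m) 0)"
    unfolding szlenk_iter_eq_sep_iter[OF order_less_imp_le[OF \<epsilon>]]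
  proof (rule sep_iter_mono)
    fix \<phi> \<psi> assume "\<phi> \<in> dual_ball X" "\<psi> \<in> dual_ball X" "\<epsilon> < dual_norm X (\<lambda>u. \<phi> u - \<psi> u)"
    then show "\<epsilon> < mass_dist \<alpha> UNIV \<phi> \<psi>"
      using dual_norm_diff_le_mass_dist[of \<phi> \<alpha> \<psi>] unfolding X_def dual_ball_def by auto
  qed simp
  then have "szlenk_iter X \<epsilon> (dual_ball X) (\<omega> ^\<^sub>o \<gamma> * (osuc ^^ m) 0) = {}"
    using m unfolding UNIV by blast
  moreover have "\<omega> ^\<^sub>o \<gamma> * (osuc ^^ m) 0 < \<omega> ^\<^sub>o (\<gamma> + 1)"
    unfolding opow1 by (rule times_omega_less[OF omega_opow_pos])
  ultimately show ?thesis by blast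
qed

section \<open>The lower bound\<close>

definition dirac :: "'i ordinal \<Rightarrow> 'i ordinal \<Rightarrow> ('i ordinal \<Rightarrow> 'k::real_normed_field) \<Rightarrow> 'k"
  where "dirac \<alpha> t = (\<lambda>f\<in>vectors (C_space {..\<alpha>}). f t)"

definition average :: "('k, 'v) nspace \<Rightarrow> ('v \<Rightarrow> 'k::real_normed_field) \<Rightarrow> ('v \<Rightarrow> 'k) \<Rightarrow> 'v \<Rightarrow> 'k"
  where "average X \<phi> \<psi> = (\<lambda>u\<in>vectors X. (\<phi> u + \<psi> u) / 2)"

lemma continuous_map_weak_star:
  assumes "h ` topspace S \<subseteq> dual X" "\<And>u. u \<in> vectors X \<Longrightarrow> continuous_map S euclidean (\<lambda>x. h x u)"
  shows "continuous_map S (weak_star X) h"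
proof -
  have "h ` topspace S \<subseteq> extensional (vectors X)" using assms(1) by (auto simp: dual_def)
  then show ?thesis
    unfolding weak_star_def continuous_map_in_subtopology continuous_map_componentwise
    using assms by auto
qed

lemma zero_in_unit_ball_C_space:
  fixes \<alpha> :: "'i ordinal"
  shows "(\<lambda>x\<in>{..\<alpha>}. 0 :: 'k::real_normed_field) \<in> {u \<in> vectors (C_space {..\<alpha>}). vnorm (C_space {..\<alpha>}) u \<le> 1}"
proof -
  have "(\<lambda>x\<in>{..\<alpha>}. 0 :: 'k) \<in> vectors (C_space {..\<alpha>})" by (rule restrict_in_vectors) simp
  moreover have "vnorm (C_space {..\<alpha>}) (\<lambda>x\<in>{..\<alpha>}. 0 :: 'k) \<le> 1" by (rule vnorm_C_space_le) simp
  ultimately show ?thesis by blast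
qed

lemma dirac_in_dual_ball:
  assumes "t \<le> \<alpha>"
  shows "dirac \<alpha> t \<in> dual_ball (C_space {..\<alpha>} :: ('k::real_normed_field, 'i ordinal \<Rightarrow> 'k) nspace)"
proof -
  let ?X = "C_space {..\<alpha>} :: ('k, 'i ordinal \<Rightarrow> 'k) nspace"
  have le: "norm (dirac \<alpha> t u) \<le> 1 * vnorm ?X u" if "u \<in> vectors ?X" for u
    using norm_le_vnorm_C_space[OF that assms] that by (simp add: dirac_def)
  have "vadd ?X u v \<in> vectors ?X" if "u \<in> vectors ?X" "v \<in> vectors ?X" for u v
    unfolding C_space_simps(2) using that by (intro restrict_in_vectors continuous_on_add) auto
  moreover have "vscale ?X c u \<in> vectors ?X" if "u \<in> vectors ?X" for c u
    unfolding C_space_simps(3) using that by (intro restrict_in_vectors continuous_on_mult) auto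
  moreover have "vadd ?X u v t = u t + v t" "vscale ?X c u t = c * u t" for u v c
    using assms by simp_all
  ultimately have "dirac \<alpha> t \<in> dual ?X"
    unfolding dual_def using le
    by (intro CollectI conjI exI[of _ 1]) (auto simp: dirac_def simp del: C_space_simps)
  moreover have "dual_norm ?X (dirac \<alpha> t) \<le> 1"
    unfolding dual_norm_def
  proof (rule cSUP_least)
    show "{u \<in> vectors ?X. vnorm ?X u \<le> 1} \<noteq> {}" using zero_in_unit_ball_C_space by blast
    show "norm (dirac \<alpha> t u) \<le> 1" if "u \<in> {u \<in> vectors ?X. vnorm ?X u \<le> 1}" for u
      using le[of u] that by simp
  qed
  ultimately show ?thesis by (simp add: dual_ball_def)
qed

lemma continuous_map_dirac:
  "continuous_map (top_of_set {..\<alpha>}) (weak_star (C_space {..\<alpha>} :: ('k::real_normed_field, 'i ordinal \<Rightarrow> 'k) nspace))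
    (dirac \<alpha>)"
proof (rule continuous_map_weak_star)
  show "dirac \<alpha> ` topspace (top_of_set {..\<alpha>}) \<subseteq> dual (C_space {..\<alpha>} :: ('k, 'i ordinal \<Rightarrow> 'k) nspace)"
    using dirac_in_dual_ball by (force simp: dual_ball_def)
  fix u :: "'i ordinal \<Rightarrow> 'k" assume u: "u \<in> vectors (C_space {..\<alpha>})"
  then have "continuous_on {..\<alpha>} u" by simp
  then show "continuous_map (top_of_set {..\<alpha>}) euclidean (\<lambda>x. dirac \<alpha> x u)"
    using u by (simp add: dirac_def continuous_map_iff_continuous)
qed

lemma less_dual_norm_diff_iff:
  fixes \<phi> :: "('i ordinal \<Rightarrow> 'k::{real_normed_field, heine_borel}) \<Rightarrow> 'k"
  assumes "\<phi> \<in> dual_ball (C_space {..\<alpha>})" "\<psi> \<in> dual_ball (C_space {..\<alpha>})"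
  shows "c < dual_norm (C_space {..\<alpha>}) (\<lambda>u. \<phi> u - \<psi> u) \<longleftrightarrow>
    (\<exists>u\<in>vectors (C_space {..\<alpha>}). vnorm (C_space {..\<alpha>}) u \<le> 1 \<and> c < norm (\<phi> u - \<psi> u))"
proof -
  let ?X = "C_space {..\<alpha>} :: ('k, 'i ordinal \<Rightarrow> 'k) nspace" 
  let ?U = "{u \<in> vectors ?X. vnorm ?X u \<le> 1}"
  have "norm (\<phi> u - \<psi> u) \<le> 2" if "u \<in> ?U" for u
  proof -
    have "norm (\<phi> u) \<le> 1" "norm (\<psi> u) \<le> 1"
      using assms norm_le_dual_norm[of \<phi> \<alpha> u] norm_le_dual_norm[of \<psi> \<alpha> u] that
      by (auto simp: dual_ball_def simp del: C_space_simps)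
    then show ?thesis using norm_triangle_ineq4[of "\<phi> u" "\<psi> u"] by simp
  qed
  then have "bdd_above ((\<lambda>u. norm (\<phi> u - \<psi> u)) ` ?U)" by (rule bdd_aboveI2)
  moreover have "?U \<noteq> {}" using zero_in_unit_ball_C_space by blast
  ultimately show ?thesis unfolding dual_norm_def by (subst less_cSUP_iff) auto
qed

lemma
  fixes \<phi> :: "('i ordinal \<Rightarrow> 'k::{real_normed_field, heine_borel}) \<Rightarrow> 'k"
  assumes "\<phi> \<in> dual (C_space {..\<alpha>})" "\<psi> \<in> dual (C_space {..\<alpha>})"
  shows average_in_dual: "average (C_space {..\<alpha>}) \<phi> \<psi> \<in> dual (C_space {..\<alpha>})"
    and average_in_dual_ball: "\<phi> \<in> dual_ball (C_space {..\<alpha>}) \<Longrightarrow> \<psi> \<in> dual_ball (C_space {..\<alpha>}) \<Longrightarrow>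
      average (C_space {..\<alpha>}) \<phi> \<psi> \<in> dual_ball (C_space {..\<alpha>})"
proof -
  let ?X = "C_space {..\<alpha>} :: ('k, 'i ordinal \<Rightarrow> 'k) nspace"
  obtain C D where CD: "\<And>u. u \<in> vectors ?X \<Longrightarrow> norm (\<phi> u) \<le> C * vnorm ?X u"
    "\<And>u. u \<in> vectors ?X \<Longrightarrow> norm (\<psi> u) \<le> D * vnorm ?X u"
    using assms unfolding dual_def by blast
  have le: "norm (average ?X \<phi> \<psi> u) \<le> (norm (\<phi> u) + norm (\<psi> u)) / 2" if "u \<in> vectors ?X" for u
    using that norm_triangle_ineq[of "\<phi> u" "\<psi> u"]
    by (simp add: average_def norm_divide del: C_space_simps)
  have "norm (average ?X \<phi> \<psi> u) \<le> (C + D) / 2 * vnorm ?X u" if "u \<in> vectors ?X" for u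
    using le[OF that] CD[OF that] by (simp add: field_simps del: C_space_simps)
  then have bounded: "\<exists>C. \<forall>u\<in>vectors ?X. norm (average ?X \<phi> \<psi> u) \<le> C * vnorm ?X u" by blast
  have "vadd ?X u v \<in> vectors ?X" if "u \<in> vectors ?X" "v \<in> vectors ?X" for u v
    unfolding C_space_simps(2) using that by (intro restrict_in_vectors continuous_on_add) auto
  moreover have "vscale ?X c u \<in> vectors ?X" if "u \<in> vectors ?X" for c u
    unfolding C_space_simps(3) using that by (intro restrict_in_vectors continuous_on_mult) auto
  ultimately show dual: "average ?X \<phi> \<psi> \<in> dual ?X"
    using assms unfolding dual_def
    by (intro CollectI conjI bounded) (auto simp: average_def field_simps simp del: C_space_simps)
  assume b: "\<phi> \<in> dual_ball ?X" "\<psi> \<in> dual_ball ?X"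
  have "dual_norm ?X (average ?X \<phi> \<psi>) \<le> 1"
    unfolding dual_norm_def
  proof (rule cSUP_least)
    show "{u \<in> vectors ?X. vnorm ?X u \<le> 1} \<noteq> {}" using zero_in_unit_ball_C_space by blast
    fix u assume "u \<in> {u \<in> vectors ?X. vnorm ?X u \<le> 1}"
    then have u: "u \<in> vectors ?X" "vnorm ?X u \<le> 1" by auto
    have "norm (\<phi> u) \<le> 1" "norm (\<psi> u) \<le> 1"
      using b norm_le_dual_norm[OF assms(1) u] norm_le_dual_norm[OF assms(2) u]
      by (auto simp: dual_ball_def)
    then show "norm (average ?X \<phi> \<psi> u) \<le> 1" using le[OF u(1)] by simp
  qed
  then show "average ?X \<phi> \<psi> \<in> dual_ball ?X" using dual by (simp add: dual_ball_def)
qed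

lemma average_commute: "average X \<phi> \<psi> = average X \<psi> \<phi>"
  by (simp add: average_def add.commute)

context
  fixes \<alpha> :: "'i ordinal" and X :: "('k::{real_normed_field, heine_borel}, 'i ordinal \<Rightarrow> 'k) nspace"
    and d :: "(('i ordinal \<Rightarrow> 'k) \<Rightarrow> 'k) \<Rightarrow> (('i ordinal \<Rightarrow> 'k) \<Rightarrow> 'k) \<Rightarrow> real"
  defines "X \<equiv> C_space {..\<alpha>}" and "d \<equiv> \<lambda>\<phi> \<psi>. dual_norm X (\<lambda>u. \<phi> u - \<psi> u)"
begin

text \<open>Averaging with a fixed \<psi> is weak-* continuous and halves distances. The target A is
  a parameter since it is first the ball and then an iterate of the ball.\<close>

lemma sep_iter_average:
  assumes "\<psi> \<in> dual_ball X" "\<And>\<phi>. \<phi> \<in> dual_ball X \<Longrightarrow> average X \<phi> \<psi> \<in> A"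
    and "\<phi> \<in> sep_iter (weak_star X) d \<epsilon> (dual_ball X) \<beta>"
  shows "average X \<phi> \<psi> \<in> sep_iter (weak_star X) d (\<epsilon> / 2) A \<beta>"
proof -
  let ?h = "\<lambda>\<phi>. average X \<phi> \<psi>"
  have \<psi>: "\<psi> \<in> dual X" using assms(1) by (simp add: dual_ball_def)
  have "?h ` sep_iter (weak_star X) d \<epsilon> (dual_ball X) \<beta> \<subseteq> sep_iter (weak_star X) d (\<epsilon> / 2) A \<beta>"
  proof (rule sep_iter_image)
    show "continuous_map (weak_star X) (weak_star X) ?h"
    proof (rule continuous_map_weak_star)
      show "?h ` topspace (weak_star X) \<subseteq> dual X"
        using average_in_dual[OF _ \<psi>[unfolded X_def]] by (auto simp: topspace_weak_star X_def)
      fix u assume u: "u \<in> vectors X"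
      have "continuous_map (weak_star X) euclidean (\<lambda>\<phi>. (\<phi> u + \<psi> u) / 2)"
        using continuous_map_compose[OF continuous_map_weak_star_eval[OF u], of euclidean "\<lambda>x. (x + \<psi> u) / 2"]
        by (simp add: o_def continuous_on_divide continuous_on_add)
      then show "continuous_map (weak_star X) euclidean (\<lambda>\<phi>. ?h \<phi> u)"
        using u by (simp add: average_def)
    qed
    show "dual_ball X \<subseteq> topspace (weak_star X)"
      unfolding topspace_weak_star by (rule dual_ball_subset_dual)
    show "?h ` dual_ball X \<subseteq> A" using assms(2) by blast
    fix y z assume yz: "y \<in> dual_ball X" "z \<in> dual_ball X" "\<epsilon> < d y z"
    have av: "?h y \<in> dual_ball X" "?h z \<in> dual_ball X"
      using yz assms(1) dual_ball_subset_dual unfolding X_def by (blast intro: average_in_dual_ball)+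
    obtain u where u: "u \<in> vectors X" "vnorm X u \<le> 1" "\<epsilon> < norm (y u - z u)"
      using yz less_dual_norm_diff_iff[OF yz(1,2)[unfolded X_def]] unfolding d_def X_def by blast
    have "?h y u - ?h z u = (y u - z u) / 2"
      using u(1) by (simp add: average_def diff_divide_distrib add_divide_distrib)
    then have "norm (?h y u - ?h z u) = norm (y u - z u) / 2" by (simp only: norm_divide norm_numeral)
    then have "\<epsilon> / 2 < norm (?h y u - ?h z u)" using u(3) by simp
    then show "\<epsilon> / 2 < d (?h y) (?h z)"
      using less_dual_norm_diff_iff[OF av[unfolded X_def]] u unfolding d_def X_def by blast
  qed
  then show ?thesis using assms(3) by blast
qed

text \<open>Let \<phi> survive \<beta> steps. Moving the half \<phi> with \<psi> fixed shows that
  the average of \<psi> and \<phi> survives \<beta> steps at \<epsilon> / 2, for every \<psi> in the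
  ball. Moving the other half, now inside that iterate, gives \<beta> more steps.\<close>

lemma sep_iter_double_nonempty:
  assumes "sep_iter (weak_star X) d \<epsilon> (dual_ball X) \<beta> \<noteq> {}"
  shows "sep_iter (weak_star X) d (\<epsilon> / 2) (dual_ball X) (\<beta> + \<beta>) \<noteq> {}"
proof -
  obtain \<phi> where \<phi>: "\<phi> \<in> sep_iter (weak_star X) d \<epsilon> (dual_ball X) \<beta>" using assms by blast
  have \<phi>B: "\<phi> \<in> dual_ball X" by (rule subsetD[OF sep_iter_subset \<phi>])
  have "average X \<psi> \<phi> \<in> sep_iter (weak_star X) d (\<epsilon> / 2) (dual_ball X) \<beta>" if "\<psi> \<in> dual_ball X" for \<psi>
  proof (subst average_commute, rule sep_iter_average[OF that _ \<phi>])
    fix \<theta> assume "\<theta> \<in> dual_ball X"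
    then show "average X \<theta> \<psi> \<in> dual_ball X"
      using that dual_ball_subset_dual unfolding X_def by (blast intro: average_in_dual_ball)
  qed
  from sep_iter_average[OF \<phi>B this \<phi>] show ?thesis
    unfolding sep_iter_plus by blast
qed

text \<open>Repeated doubling. Keeping \<beta> \<le> b allows one more \<beta> to be absorbed in b +
  b, despite the noncommutative addition.\<close>

lemma sep_iter_times_nonempty:
  assumes "sep_iter (weak_star X) d \<epsilon> (dual_ball X) \<beta> \<noteq> {}"
  shows "\<exists>b. \<beta> \<le> b \<and> \<beta> * (osuc ^^ n) 0 \<le> b \<and> sep_iter (weak_star X) d (\<epsilon> / 2 ^ n) (dual_ball X) b \<noteq> {}"
proof (induction n)
  case 0
  show ?case using assms by (intro exI[of _ \<beta>]) simp
next
  case (Suc n)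
  then obtain b where b: "\<beta> \<le> b" "\<beta> * (osuc ^^ n) 0 \<le> b"
    "sep_iter (weak_star X) d (\<epsilon> / 2 ^ n) (dual_ball X) b \<noteq> {}" by blast
  have "\<beta> * (osuc ^^ n) 0 + \<beta> \<le> b + b"
    using plus_ordinal_mono_left[OF b(2), of \<beta>] b(1) by (meson order_trans plus_ordinal_le_iff)
  moreover have "\<beta> \<le> b + b" using b(1) le_plus_ordinal by (rule order_trans)
  moreover have "sep_iter (weak_star X) d (\<epsilon> / 2 ^ Suc n) (dual_ball X) (b + b) \<noteq> {}"
    using sep_iter_double_nonempty[OF b(3)] by (simp add: mult.commute)
  ultimately show ?case by (intro exI[of _ "b + b"]) (simp add: times_ordinal_osuc)
qed

text \<open>By continuity of \<open>dirac \<alpha>\<close>, Diracs at points just below t enter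
  every weak-* neighbourhood, and they stay far from the Dirac at t.\<close>

lemma dirac_limit_point:
  assumes "t \<le> \<alpha>" "\<And>s. s < t \<Longrightarrow> \<exists>u\<in>{s<..<t}. dirac \<alpha> u \<in> sep_iter (weak_star X) d (1 / 2) (dual_ball X) \<beta>"
    and "0 < t" "dirac \<alpha> t \<in> sep_iter (weak_star X) d (1 / 2) (dual_ball X) \<beta>"
  shows "dirac \<alpha> t \<in> sep_deriv (weak_star X) d (1 / 2) (sep_iter (weak_star X) d (1 / 2) (dual_ball X) \<beta>)"
proof -
  let ?A = "sep_iter (weak_star X) d (1 / 2) (dual_ball X) \<beta>"
  have "\<exists>y\<in>?A \<inter> V. \<exists>z\<in>?A \<inter> V. 1 / 2 < d y z"
    if V: "openin (weak_star X) V" "dirac \<alpha> t \<in> V" for V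
  proof -
    have "openin (top_of_set {..\<alpha>}) {x \<in> topspace (top_of_set {..\<alpha>}). (dirac \<alpha> x :: ('i ordinal \<Rightarrow> 'k) \<Rightarrow> 'k) \<in> V}"
      by (rule openin_continuous_map_preimage[OF continuous_map_dirac V(1)[unfolded X_def]])
    then obtain O' where O': "open O'"
      "{x \<in> topspace (top_of_set {..\<alpha>}). (dirac \<alpha> x :: ('i ordinal \<Rightarrow> 'k) \<Rightarrow> 'k) \<in> V} = {..\<alpha>} \<inter> O'"
      unfolding openin_open by blast
    then have "t \<in> O'" using V(2) assms(1) by auto
    then obtain s where s: "s < t" "{s<..t} \<subseteq> O'" using open_left[OF O'(1)] assms(3) by blast
    obtain u where u: "s < u" "u < t" "dirac \<alpha> u \<in> ?A" using assms(2)[OF s(1)] by auto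
    have ua: "u \<le> \<alpha>" using u(2) assms(1) by (meson order_less_imp_le order_trans)
    have "u \<in> O'" using s(2) u by auto
    then have "dirac \<alpha> u \<in> V" using O'(2) ua by auto
    moreover have "1 / 2 < d (dirac \<alpha> u) (dirac \<alpha> t)"
    proof -
      \<comment> \<open>The indicator of [0, u] is 1 at u and 0 at t, so the distance exceeds 1 /
        2.\<close>
      let ?f = "\<lambda>x\<in>{..\<alpha>}. if x \<in> {..u} then 1 else (0 :: 'k)"
      have f: "?f \<in> vectors (C_space {..\<alpha>})"
        by (rule restrict_in_vectors[OF continuous_on_subset[OF continuous_on_if_clopen]])
          (auto simp: open_atMost_ordinal)
      have "vnorm (C_space {..\<alpha>}) ?f \<le> 1" by (rule vnorm_C_space_le) simp
      moreover have diff: "dirac \<alpha> u ?f - dirac \<alpha> t ?f = 1"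
        using f ua assms(1) u(2) by (simp add: dirac_def del: C_space_simps)
      have "1 / 2 < norm (dirac \<alpha> u ?f - dirac \<alpha> t ?f)" unfolding diff by simp
      ultimately show ?thesis
        unfolding d_def X_def less_dual_norm_diff_iff[OF dirac_in_dual_ball[OF ua] dirac_in_dual_ball[OF assms(1)]]
        using f by blast
    qed
    ultimately show ?thesis using u(3) V(2) assms(4) by blast
  qed
  then show ?thesis using assms(4) unfolding sep_deriv_def by blast
qed

text \<open>A closedness property of the iterates along Diracs; at a successor the approaching
  Diracs also supply the separated pairs.\<close>

lemma dirac_in_sep_iter_limit:
  assumes "t \<le> \<alpha>" "0 < t" "\<And>s. s < t \<Longrightarrow> \<exists>u\<in>{s<..<t}. dirac \<alpha> u \<in> sep_iter (weak_star X) d (1 / 2) (dual_ball X) \<beta>"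
  shows "dirac \<alpha> t \<in> sep_iter (weak_star X) d (1 / 2) (dual_ball X) \<beta>"
  using assms(3)
proof (induction \<beta> rule: ordinal_induct)
  case zero
  show ?case using dirac_in_dual_ball[OF assms(1)] by (simp add: X_def)
next
  case (succ \<beta>)
  have near: "\<exists>u\<in>{s<..<t}. dirac \<alpha> u \<in> sep_iter (weak_star X) d (1 / 2) (dual_ball X) \<beta>" if s: "s < t" for s
  proof -
    obtain u where u: "u \<in> {s<..<t}" "dirac \<alpha> u \<in> sep_iter (weak_star X) d (1 / 2) (dual_ball X) (osuc \<beta>)"
      using succ.prems[OF s] by blast
    from subsetD[OF sep_deriv_subset u(2)[unfolded sep_iter_osuc]] u(1) show ?thesis by (rule bexI)
  qed
  show ?case
    unfolding sep_iter_osuc by (rule dirac_limit_point[OF assms(1) near assms(2) succ.IH[OF near]])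
next
  case (limit \<beta>)
  have "dirac \<alpha> t \<in> sep_iter (weak_star X) d (1 / 2) (dual_ball X) \<sigma>" if \<sigma>: "\<sigma> < \<beta>" for \<sigma>
  proof (rule limit.IH[OF \<sigma>])
    fix s assume "s < t"
    then show "\<exists>u\<in>{s<..<t}. dirac \<alpha> u \<in> sep_iter (weak_star X) d (1 / 2) (dual_ball X) \<sigma>"
      using limit.prems \<sigma> unfolding sep_iter_limit[OF limit.hyps] by blast
  qed
  then show ?case unfolding sep_iter_limit[OF limit.hyps] by blast
qed

text \<open>The offset x varies because the points that approach
  \<open>x + \<omega> ^\<^sub>o osuc \<eta>\<close> are powers
  \<open>\<omega> ^\<^sub>o \<eta>\<close> attached to larger and larger offsets.\<close>

lemma dirac_in_sep_iter:
  "x + \<omega> ^\<^sub>o \<eta> \<le> \<alpha> \<Longrightarrow> dirac \<alpha> (x + \<omega> ^\<^sub>o \<eta>) \<in> sep_iter (weak_star X) d (1 / 2) (dual_ball X) \<eta>"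
proof (induction \<eta> arbitrary: x rule: ordinal_induct)
  case zero
  then show ?case using dirac_in_dual_ball by (simp add: X_def)
next
  case (succ \<eta>)
  let ?t = "x + \<omega> ^\<^sub>o osuc \<eta>"
  have pos: "0 < ?t"
    using less_plus_ordinal[OF omega_opow_pos, of x "osuc \<eta>"] by (meson order_le_less_trans ordinal_zero_le)
  have near: "\<exists>u\<in>{s<..<?t}. dirac \<alpha> u \<in> sep_iter (weak_star X) d (1 / 2) (dual_ball X) \<eta>"
    if s: "s < ?t" for s
  proof -
    obtain y where y: "y < \<omega> ^\<^sub>o osuc \<eta>" "s < x + y"
      using s less_plus_limit_iff[OF limit_ordinal_omega_opow_pos, of "osuc \<eta>" s x] less_osuc
      by (metis ordinal_zero_le order_le_less_trans)
    then obtain n where n: "y < \<omega> ^\<^sub>o \<eta> * (osuc ^^ n) 0"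
      unfolding opow_osuc less_times_omega_iff by blast
    let ?u = "x + \<omega> ^\<^sub>o \<eta> * (osuc ^^ n) 0 + \<omega> ^\<^sub>o \<eta>"
    have eq: "?u = x + \<omega> ^\<^sub>o \<eta> * (osuc ^^ Suc n) 0"
      by (simp add: times_ordinal_osuc plus_ordinal_assoc)
    then have ut: "?u < ?t"
      using omega_opow_times_less[OF less_osuc, of \<eta> "Suc n"] by simp
    have "x + y < x + \<omega> ^\<^sub>o \<eta> * (osuc ^^ n) 0" using n by simp
    then have "s < ?u" using y(2) le_plus_ordinal by (meson order_less_le_trans order_less_trans)
    moreover have "?u \<le> \<alpha>" using ut succ.prems by (meson order_less_imp_le order_trans)
    ultimately show ?thesis using succ.IH[of "x + \<omega> ^\<^sub>o \<eta> * (osuc ^^ n) 0"] ut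
      by (intro bexI[of _ ?u]) auto
  qed
  show ?case
    unfolding sep_iter_osuc
    by (rule dirac_limit_point[OF succ.prems near pos dirac_in_sep_iter_limit[OF succ.prems pos near]])
next
  case (limit \<eta>)
  let ?t = "x + \<omega> ^\<^sub>o \<eta>"
  have pos: "0 < ?t"
    using less_plus_ordinal[OF omega_opow_pos, of x \<eta>] by (meson order_le_less_trans ordinal_zero_le)
  have "dirac \<alpha> ?t \<in> sep_iter (weak_star X) d (1 / 2) (dual_ball X) \<sigma>" if \<sigma>: "\<sigma> < \<eta>" for \<sigma>
  proof (rule dirac_in_sep_iter_limit[OF limit.prems pos])
    fix s assume "s < ?t"
    then obtain y where y: "y < \<omega> ^\<^sub>o \<eta>" "s < x + y"
      unfolding less_plus_limit_iff[OF limit_ordinal_omega_opow[OF limit.hyps]] by blast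
    then obtain \<tau> where \<tau>: "\<tau> < \<eta>" "y < \<omega> ^\<^sub>o \<tau>"
      unfolding less_opow_limit_iff[OF limit.hyps] by blast
    \<comment> \<open>The exponent \<tau> takes the point beyond s, and \<sigma> guarantees enough
      steps survived.\<close>
    define \<rho> where "\<rho> = max \<sigma> \<tau>"
    have \<rho>: "\<rho> < \<eta>" "\<sigma> \<le> \<rho>" "\<omega> ^\<^sub>o \<tau> \<le> \<omega> ^\<^sub>o \<rho>"
      using \<sigma> \<tau>(1) by (auto simp: \<rho>_def strict_mono_less_eq[OF strict_mono_omega_opow])
    have "y < \<omega> ^\<^sub>o \<rho>" using \<tau>(2) \<rho>(3) by (rule order_less_le_trans)
    then have su: "s < x + \<omega> ^\<^sub>o \<rho>" using y(2) by (meson order_less_trans plus_ordinal_less_iff)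
    have ut: "x + \<omega> ^\<^sub>o \<rho> < ?t" using strict_monoD[OF strict_mono_omega_opow \<rho>(1)] by simp
    then have "x + \<omega> ^\<^sub>o \<rho> \<le> \<alpha>" using limit.prems by (meson order_less_imp_le order_trans)
    from limit.IH[OF \<rho>(1) this] sep_iter_antimono[OF \<rho>(2), of "weak_star X" d "1 / 2" "dual_ball X"]
    have "dirac \<alpha> (x + \<omega> ^\<^sub>o \<rho>) \<in> sep_iter (weak_star X) d (1 / 2) (dual_ball X) \<sigma>" by blast
    then show "\<exists>u\<in>{s<..<?t}. dirac \<alpha> u \<in> sep_iter (weak_star X) d (1 / 2) (dual_ball X) \<sigma>"
      using su ut by (intro bexI[of _ "x + \<omega> ^\<^sub>o \<rho>"]) auto
  qed
  then show ?case unfolding sep_iter_limit[OF limit.hyps] by blast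
qed

lemma szlenk_iter_C_space_nonempty:
  assumes "\<omega> ^\<^sub>o (\<omega> ^\<^sub>o \<gamma>) \<le> \<alpha>"
  shows "\<exists>\<epsilon>>0. \<exists>b. \<omega> ^\<^sub>o \<gamma> * (osuc ^^ n) 0 \<le> b \<and> szlenk_iter X \<epsilon> (dual_ball X) b \<noteq> {}"
proof -
  have "sep_iter (weak_star X) d (1 / 2) (dual_ball X) (\<omega> ^\<^sub>o \<gamma>) \<noteq> {}"
    using dirac_in_sep_iter[of 0 "\<omega> ^\<^sub>o \<gamma>"] assms by auto
  from sep_iter_times_nonempty[OF this, of n]
  obtain b where b: "\<omega> ^\<^sub>o \<gamma> * (osuc ^^ n) 0 \<le> b"
    "sep_iter (weak_star X) d (1 / 2 / 2 ^ n) (dual_ball X) b \<noteq> {}" by blast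
  have "szlenk_iter X (1 / 2 / 2 ^ n) (dual_ball X) b \<noteq> {}"
    using b(2) unfolding d_def by (subst szlenk_iter_eq_sep_iter) auto
  then show ?thesis using b(1) by (intro exI[of _ "1 / 2 / 2 ^ n"]) auto
qed

end

theorem theorem2p6:
  fixes \<alpha> \<gamma> :: "'i ordinal"
  assumes "\<omega> \<le> \<alpha>"
    and "\<omega> ^\<^sub>o (\<omega> ^\<^sub>o \<gamma>) \<le> \<alpha>" and "\<alpha> < \<omega> ^\<^sub>o (\<omega> ^\<^sub>o (\<gamma> + 1))"
  shows "Szlenk (C_space {0..\<alpha>} :: ('k::{real_normed_field, heine_borel}, 'i ordinal \<Rightarrow> 'k) nspace)
    = \<omega> ^\<^sub>o (\<gamma> + 1)"
proof -
  define X where "X = (C_space {..\<alpha>} :: ('k, 'i ordinal \<Rightarrow> 'k) nspace)"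
  have upper: "\<exists>\<beta><\<omega> ^\<^sub>o (\<gamma> + 1). szlenk_iter X \<epsilon> (dual_ball X) \<beta> = {}" if "0 < \<epsilon>" for \<epsilon>
    unfolding X_def by (rule szlenk_iter_C_space_empty[OF assms(3) that])
  have le: "(Szlenk_eps X \<epsilon> :: 'i ordinal) \<le> \<omega> ^\<^sub>o (\<gamma> + 1)" if \<epsilon>: "0 < \<epsilon>" for \<epsilon>
  proof -
    obtain \<beta> where "\<beta> < \<omega> ^\<^sub>o (\<gamma> + 1)" "szlenk_iter X \<epsilon> (dual_ball X) \<beta> = {}"
      using upper[OF \<epsilon>] by blast
    then have "Szlenk_eps X \<epsilon> \<le> \<beta>" unfolding Szlenk_eps_def by (intro Least_le)
    also have "\<beta> \<le> \<omega> ^\<^sub>o (\<gamma> + 1)" using \<open>\<beta> < \<omega> ^\<^sub>o (\<gamma> + 1)\<close> by (rule order_less_imp_le)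
    finally show ?thesis .
  qed
  have "(Szlenk X :: 'i ordinal) \<le> \<omega> ^\<^sub>o (\<gamma> + 1)"
    unfolding Szlenk_def using le by (intro cSUP_least) auto
  moreover have "\<not> (Szlenk X :: 'i ordinal) < \<omega> ^\<^sub>o (\<gamma> + 1)"
  proof
    assume "(Szlenk X :: 'i ordinal) < \<omega> ^\<^sub>o (\<gamma> + 1)"
    \<comment> \<open>An index below the claimed value would lie below some finite multiple of
      \<open>\<omega> ^\<^sub>o \<gamma>\<close>, whereas for small \<epsilon> an iterate at or
      beyond that multiple is nonempty.\<close>
    then obtain n where n: "Szlenk X < \<omega> ^\<^sub>o \<gamma> * (osuc ^^ n) 0"
      unfolding plus_ordinal_1 opow_osuc less_times_omega_iff by blast
    have "\<exists>\<epsilon>>0. \<exists>b. \<omega> ^\<^sub>o \<gamma> * (osuc ^^ n) 0 \<le> b \<and> szlenk_iter X \<epsilon> (dual_ball X) b \<noteq> {}"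
      unfolding X_def by (rule szlenk_iter_C_space_nonempty[OF assms(2)])
    then obtain \<epsilon> b where \<epsilon>: "0 < \<epsilon>"
      and b: "\<omega> ^\<^sub>o \<gamma> * (osuc ^^ n) 0 \<le> b" "szlenk_iter X \<epsilon> (dual_ball X) b \<noteq> {}"
      by blast
    \<comment> \<open>An empty iterate has to exist before \<open>LEAST\<close> says anything about
      \<open>Szlenk_eps\<close>.\<close>
    have "\<exists>\<beta> :: 'i ordinal. szlenk_iter X \<epsilon> (dual_ball X) \<beta> = {}" using upper[OF \<epsilon>] by blast
    then have empty: "szlenk_iter X \<epsilon> (dual_ball X) (Szlenk_eps X \<epsilon> :: 'i ordinal) = {}"
      unfolding Szlenk_eps_def by (rule LeastI_ex)
    have "\<not> Szlenk_eps X \<epsilon> \<le> b"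
    proof
      assume "Szlenk_eps X \<epsilon> \<le> b"
      then have "szlenk_iter X \<epsilon> (dual_ball X) b \<subseteq> szlenk_iter X \<epsilon> (dual_ball X) (Szlenk_eps X \<epsilon> :: 'i ordinal)"
        unfolding szlenk_iter_eq_sep_iter[OF order_less_imp_le[OF \<epsilon>]] by (rule sep_iter_antimono)
      then show False using empty b(2) by simp
    qed
    moreover have "Szlenk_eps X \<epsilon> \<le> (Szlenk X :: 'i ordinal)"
      unfolding Szlenk_def using \<epsilon> le by (intro cSUP_upper bdd_aboveI2[where M = "\<omega> ^\<^sub>o (\<gamma> + 1)"]) auto
    ultimately show False using n b(1) by (meson order_less_imp_le order_trans)
  qed
  ultimately show ?thesis unfolding X_def by simp
qed

end
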